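(* Let $D_{11}>0$, $v_0\in\mathbb{R}$, $L>0$, $c_a^0\in\mathbb{R}$, and let $c_p:[0,+\infty)\to\mathbb{R}$ be of class $\mathcal{C}^1$. Consider the initial-boundary value problem $$\frac{\partial c}{\partial t}+v_0\frac{\partial c}{\partial x}-D_{11}\frac{\partial^2c}{\partial x^2}=0\quad\text{on }(0,L)\times(0,+\infty),$$ with initial condition $c(x,0)=c_a^0$ for $x\in(0,L]$ and boundary conditions $c(0,t)=c_p(t)$ and $c(L,t)=c_a^0$ for all $t>0$. The solution of this problem is $$c(x,t)=c_a^0+\int_0^t g(x,\tau)\big(c_a^0-c_p(t-\tau)\big)\,d\tau,\qquad x\in(0,L],\ t>0,$$ where, for $x\in(0,L]$ and $\tau>0$, $$g(x,\tau)=-e^{\alpha x}\sum_{n=1}^{\infty}\frac{2n\pi D_{11}}{L^2}\,e^{s_n\tau}\sin\Big(\frac{n\pi x}{L}\Big),\qquad \alpha=\frac{v_0}{2D_{11}},\quad s_n=-\frac{v_0^2}{4D_{11}}-\frac{n^2\pi^2D_{11}}{L^2}.$$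
   Context: The boundary condition at $x=0$ is recovered as the limit $\lim_{x\to0^+}c(x,t)=c_p(t)$ for each $t>0$; it is not obtained by substituting $x=0$ in the series, which vanishes there for every $\tau>0$.
   Formalization: Uniqueness ("the solution") is asserted only among classical solutions bounded on (0,L]×[0,T] for every T; without a bound it fails, since adding the kernel g(x,t), extended by 0 at t=0, gives another solution. *)

theory Defs
  imports "HOL-Analysis.Analysis"
begin

text \<open>Functions of position and time are curried: \<open>u x t\<close>.\<close>

definition drift_exponent :: "real \<Rightarrow> real \<Rightarrow> real" where
  "drift_exponent D v = v / (2 * D)"

definition decay_rate :: "real \<Rightarrow> real \<Rightarrow> real \<Rightarrow> nat \<Rightarrow> real" where
  "decay_rate D v L n = - (v\<^sup>2 / (4 * D)) - (real n)\<^sup>2 * pi\<^sup>2 * D / L\<^sup>2"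

definition kernel_term :: "real \<Rightarrow> real \<Rightarrow> real \<Rightarrow> nat \<Rightarrow> real \<Rightarrow> real \<Rightarrow> real" where
  "kernel_term D v L n x \<tau> =
     2 * real n * pi * D / L\<^sup>2 * exp (decay_rate D v L n * \<tau>) * sin (real n * pi * x / L)"

definition green_kernel :: "real \<Rightarrow> real \<Rightarrow> real \<Rightarrow> real \<Rightarrow> real \<Rightarrow> real" where
  "green_kernel D v L x \<tau> =
     - exp (drift_exponent D v * x) * (\<Sum>n. kernel_term D v L (Suc n) x \<tau>)"

definition conc ::
  "real \<Rightarrow> real \<Rightarrow> real \<Rightarrow> real \<Rightarrow> (real \<Rightarrow> real) \<Rightarrow> real \<Rightarrow> real \<Rightarrow> real" where
  "conc D v L c\<^sub>a c\<^sub>p x t =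
     c\<^sub>a + (LBINT \<tau>:{0<..t}. green_kernel D v L x \<tau> * (c\<^sub>a - c\<^sub>p (t - \<tau>)))"

text \<open>
  Classical solutions.  The initial datum and the datum at \<open>x = L\<close> are attained continuously,
  by the continuity on \<open>(0,L] \<times> [0,\<infinity>)\<close>.  The datum at \<open>x = 0\<close> is attained as a limit for each
  fixed \<open>t > 0\<close>, so the value of \<open>u\<close> at \<open>x = 0\<close> is irrelevant.  No compatibility
  \<open>c\<^sub>p 0 = c\<^sub>a\<close> is imposed at the corner.
\<close>

definition classical_solution ::
  "real \<Rightarrow> real \<Rightarrow> real \<Rightarrow> real \<Rightarrow> (real \<Rightarrow> real) \<Rightarrow> (real \<Rightarrow> real \<Rightarrow> real) \<Rightarrow> bool" where
  "classical_solution D v L c\<^sub>a c\<^sub>p u \<longleftrightarrow>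
     (\<exists>u\<^sub>t u\<^sub>x u\<^sub>x\<^sub>x.
        continuous_on ({0<..<L} \<times> {0<..}) (\<lambda>(x, t). u\<^sub>t x t) \<and>
        continuous_on ({0<..<L} \<times> {0<..}) (\<lambda>(x, t). u\<^sub>x x t) \<and>
        continuous_on ({0<..<L} \<times> {0<..}) (\<lambda>(x, t). u\<^sub>x\<^sub>x x t) \<and>
        (\<forall>x\<in>{0<..<L}. \<forall>t>0.
           ((\<lambda>s. u x s) has_real_derivative u\<^sub>t x t) (at t) \<and>
           ((\<lambda>y. u y t) has_real_derivative u\<^sub>x x t) (at x) \<and>
           ((\<lambda>y. u\<^sub>x y t) has_real_derivative u\<^sub>x\<^sub>x x t) (at x) \<and>
           u\<^sub>t x t + v * u\<^sub>x x t - D * u\<^sub>x\<^sub>x x t = 0)) \<and>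
     continuous_on ({0<..L} \<times> {0..}) (\<lambda>(x, t). u x t) \<and>
     (\<forall>x\<in>{0<..L}. u x 0 = c\<^sub>a) \<and>
     (\<forall>t>0. ((\<lambda>x. u x t) \<longlongrightarrow> c\<^sub>p t) (at_right 0)) \<and>
     (\<forall>t>0. u L t = c\<^sub>a)"

text \<open>
  Without a bound near the corner \<open>(0,0)\<close> classical solutions are not unique: with \<open>c\<^sub>a = 0\<close> and
  \<open>c\<^sub>p = 0\<close>, the function \<open>(x, t) \<mapsto> green_kernel D v L x t\<close>, set to \<open>0\<close> at \<open>t = 0\<close>, is a nonzero
  solution.
\<close>

definition bounded_on_finite_times :: "real \<Rightarrow> (real \<Rightarrow> real \<Rightarrow> real) \<Rightarrow> bool" where
  "bounded_on_finite_times L u \<longleftrightarrow> (\<forall>T>0. bounded ((\<lambda>(x, t). u x t) ` ({0<..L} \<times> {0..T})))"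

end

(*
  Write the series kernel as exp (alpha x - beta tau) times a space derivative of a theta
  series in y = pi x / L, s = D pi^2 tau / L^2.  Summation by parts k times, i.e.
  multiplication by (cis (- y) - 1)^k, replaces the coefficients N^j exp (- N^2 s) by their
  k-th differences, which are of order sqrt s ^ (k - j) since the coefficients are samples of
  a Schwartz function on a grid of mesh sqrt s.  Hence away from x = 0 the kernel and its
  derivatives vanish as s -> 0, extending it by 0 to negative times keeps it smooth, and the
  convolution may be differentiated under the integral sign.  The same estimate with k = 2
  gives the integrable majorant y / (s + y^2)^(3/2) near the corner, so the kernel is an
  approximate identity in tau as x -> 0; its total mass is the boundary value of the response
  to a unit step, identified through the sum of 1/N^2.

  For uniqueness, the time integral W of the difference w of two solutions satisfies the
  inhomogeneous equation with right-hand side w(x,s), s -> 0, and by dominated convergence its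
  values on x = rho tend to 0 uniformly in time as rho -> 0, so the maximum principle gives
  W = 0.
*)

theory Submission
  imports Defs "HOL-Computational_Algebra.Polynomial"
begin

text \<open>Every term of the kernel series vanishes at x = 0, so the datum \<open>c\<^sub>p\<close>
  can only appear there as a limit of mass concentrating at tau = 0, exactly where the exponential
  damping of the series is lost. Absolute values of the terms are therefore useless in this regime,
  and the cancellation has to be extracted from the differences of the coefficients. The integer
  index j of \<open>heat_series\<close>, negative values included, puts all derivatives and
  antiderivatives into one family, so a single decay estimate serves for all positive j. The limit
  mass needs the initial value of the series with j = -1, whose coefficients 1/N are not absolutely
  summable at s = 0. It is reached through j = -2, which is continuous down to s = 0. Expansion at y
  = pi, far from the singular corner, shows that the integrated profile at s = 0 is an unknown
  multiple of (pi - y)^2; its value at y = 0, computed from the sum of 1/N^2, makes the multiple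
  zero.\<close>

section \<open>Polynomials times a Gaussian and their finite differences\<close>

definition gauss :: "real poly \<Rightarrow> real \<Rightarrow> real" where
  "gauss p w = poly p w * exp (- (w\<^sup>2))"

text \<open>The factor \<open>[:0, 2:]\<close> is 2 w, from differentiating exp (- w^2). The class
  is closed under differentiation, so a bound for arbitrary \<open>p\<close> covers all
  derivatives.\<close>

definition gauss_pderiv :: "real poly \<Rightarrow> real poly" where
  "gauss_pderiv p = pderiv p - [:0, 2:] * p"

lemma has_real_derivative_gauss:
  "(gauss p has_real_derivative gauss (gauss_pderiv p) w) (at w)"
  unfolding gauss_def [abs_def] gauss_pderiv_def
  by (auto intro!: derivative_eq_intros simp: algebra_simps)

lemma poly_le_power_square:
  fixes p :: "real poly"
  shows "\<exists>C\<ge>0. \<exists>m. \<forall>w. \<bar>poly p w\<bar> \<le> C * (1 + w\<^sup>2) ^ m"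
proof (induction p)
  case 0
  show ?case by (rule exI[of _ 0]) auto
next
  case (pCons a p)
  then obtain C m where C: "C \<ge> 0" "\<And>w. \<bar>poly p w\<bar> \<le> C * (1 + w\<^sup>2) ^ m" by blast
  have "\<bar>poly (pCons a p) w\<bar> \<le> (\<bar>a\<bar> + C) * (1 + w\<^sup>2) ^ Suc m" for w
  proof -
    have *: "\<bar>w\<bar> \<le> 1 + w\<^sup>2"
      using zero_le_power2[of "\<bar>w\<bar> - 1"] by (simp add: power2_eq_square algebra_simps)
    have 1: "(1::real) \<le> (1 + w\<^sup>2) ^ Suc m" by (rule one_le_power) simp
    have "\<bar>poly (pCons a p) w\<bar> \<le> \<bar>a\<bar> + \<bar>w\<bar> * \<bar>poly p w\<bar>"
      by (simp add: abs_mult[symmetric])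
    also have "\<dots> \<le> \<bar>a\<bar> * (1 + w\<^sup>2) ^ Suc m + (1 + w\<^sup>2) * (C * (1 + w\<^sup>2) ^ m)"
      by (intro add_mono mult_mono * C mult_left_mono[OF 1, of "\<bar>a\<bar>", simplified mult_1_right]) auto
    finally show ?thesis by (simp add: algebra_simps)
  qed
  with C(1) show ?case by (intro exI[of _ "\<bar>a\<bar> + C"] conjI exI[of _ "Suc m"]) auto
qed

lemma power_times_exp_minus_bounded:
  "\<exists>C\<ge>0. \<forall>x\<ge>0. (1 + x) ^ m * exp (- x :: real) \<le> C"
proof (intro exI conjI allI impI)
  fix x :: real assume x: "x \<ge> 0"
  \<comment> \<open>The constant comes from u <= exp u at u = (1 + x) / (m + 1), raised to the power
    m: the resulting exponent m (1 + x) / (m + 1) stays below 1 + x.\<close>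
  show "(1 + x) ^ m * exp (- x) \<le> real (Suc m) ^ m * exp 1"
  proof -
    have "(1 + x) / real (Suc m) \<le> exp ((1 + x) / real (Suc m))"
      using exp_ge_add_one_self[of "(1 + x) / real (Suc m)"] by linarith
    then have "((1 + x) / real (Suc m)) ^ m \<le> exp ((1 + x) / real (Suc m)) ^ m"
      using x by (intro power_mono) auto
    also have "\<dots> = exp (real m * ((1 + x) / real (Suc m)))" by (rule exp_of_nat_mult[symmetric])
    also have "\<dots> \<le> exp (1 + x)"
      using x by (simp add: divide_simps)
    finally have "(1 + x) ^ m \<le> real (Suc m) ^ m * exp (1 + x)"
      by (simp add: power_divide divide_simps mult.commute del: of_nat_Suc)
    then have "(1 + x) ^ m * exp (- x) \<le> real (Suc m) ^ m * exp (1 + x) * exp (- x)"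
      by (intro mult_right_mono) auto
    then show ?thesis by (simp add: mult.assoc flip: exp_add)
  qed
qed simp

text \<open>Quadratic decay is all that is kept: it lets a sum over a grid of mesh h cost only a
  factor of order 1/h. The exponential bound is used at x = w^2 with one power more than the growth
  of the polynomial.\<close>

lemma gauss_le:
  obtains C where "C \<ge> 0" "\<And>w. \<bar>gauss p w\<bar> \<le> C / (1 + w\<^sup>2)"
proof -
  obtain A m where A: "A \<ge> 0" "\<And>w. \<bar>poly p w\<bar> \<le> A * (1 + w\<^sup>2) ^ m"
    using poly_le_power_square by blast
  obtain B where B: "B \<ge> 0" "\<And>x. x \<ge> 0 \<Longrightarrow> (1 + x) ^ Suc m * exp (- x :: real) \<le> B"
    using power_times_exp_minus_bounded by metis
  have "\<bar>gauss p w\<bar> \<le> A * B / (1 + w\<^sup>2)" for w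
  proof -
    have pos: "1 + w\<^sup>2 > 0" by (simp add: add_pos_nonneg)
    have "\<bar>gauss p w\<bar> * (1 + w\<^sup>2) = \<bar>poly p w\<bar> * (exp (- (w\<^sup>2)) * (1 + w\<^sup>2))"
      by (simp add: gauss_def abs_mult)
    also have "\<dots> \<le> A * (1 + w\<^sup>2) ^ m * (exp (- (w\<^sup>2)) * (1 + w\<^sup>2))"
      using A(2)[of w] by (intro mult_right_mono) auto
    also have "\<dots> = A * ((1 + w\<^sup>2) ^ Suc m * exp (- (w\<^sup>2)))" by simp
    also have "\<dots> \<le> A * B" using A B by (intro mult_left_mono) auto
    finally show ?thesis using pos by (simp add: pos_le_divide_eq)
  qed
  with A B that show thesis by (meson mult_nonneg_nonneg)
qed

definition fdiff :: "real \<Rightarrow> (real \<Rightarrow> real) \<Rightarrow> real \<Rightarrow> real" where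
  "fdiff h f z = f (z + h) - f z"

text \<open>An iterated mean value theorem. The functions \<open>fdiff h (f j)\<close> again form a
  chain of derivatives, so the induction hypothesis turns k differences of the first difference into
  h^k times one difference of \<open>f k\<close>, and one more mean value step finishes.\<close>

lemma iterated_fdiff_eq_derivative:
  assumes "h > 0" and "\<And>k x. (f k has_real_derivative f (Suc k) x) (at x)"
  shows "\<exists>\<xi>\<in>{z..z + real k * h}. (fdiff h ^^ k) (f 0) z = h ^ k * f k \<xi>"
  using assms(2)
proof (induction k arbitrary: f)
  case 0
  then show ?case by auto
next
  case (Suc k)
  have "\<exists>\<xi>\<in>{z..z + real k * h}. (fdiff h ^^ k) (fdiff h (f 0)) z = h ^ k * fdiff h (f k) \<xi>"
    by (rule Suc.IH[of "\<lambda>j. fdiff h (f j)"])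
       (auto simp: fdiff_def [abs_def] intro!: derivative_eq_intros
          DERIV_chain2[OF Suc.prems] Suc.prems)
  then obtain \<xi> where \<xi>: "\<xi> \<in> {z..z + real k * h}"
    "(fdiff h ^^ k) (fdiff h (f 0)) z = h ^ k * fdiff h (f k) \<xi>" by blast
  obtain \<zeta> where \<zeta>: "\<xi> < \<zeta>" "\<zeta> < \<xi> + h" "f k (\<xi> + h) - f k \<xi> = h * f (Suc k) \<zeta>"
    using MVT2[of \<xi> "\<xi> + h" "f k" "f (Suc k)"] Suc.prems \<open>h > 0\<close> by auto
  have "(fdiff h ^^ Suc k) (f 0) z = h ^ k * (h * f (Suc k) \<zeta>)"
    using \<xi>(2) \<zeta>(3) by (simp only: funpow_Suc_right o_apply fdiff_def[of h "f k"])
  then show ?case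
    using \<xi>(1) \<zeta> by (intro bexI[of _ \<zeta>]) (auto simp: algebra_simps)
qed

lemma iterated_fdiff_gauss_le:
  assumes "H > 0"
  obtains C where "C \<ge> 0"
    "\<And>h N. 0 < h \<Longrightarrow> h \<le> H \<Longrightarrow> \<bar>(fdiff h ^^ k) (gauss p) (h * N)\<bar> \<le> C * h ^ k / (1 + (h * N)\<^sup>2)"
proof -
  define f where "f j = gauss ((gauss_pderiv ^^ j) p)" for j
  obtain A where A: "A \<ge> 0" "\<And>w. \<bar>f k w\<bar> \<le> A / (1 + w\<^sup>2)"
    using gauss_le[of "(gauss_pderiv ^^ k) p"] unfolding f_def by metis
  \<comment> \<open>\<open>B\<close> pays for replacing the intermediate point by the grid point
    \<open>h * N\<close>; they differ by at most k h <= k H.\<close>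
  define B where "B = 2 + 2 * (real k * H)\<^sup>2"
  have "\<bar>(fdiff h ^^ k) (gauss p) (h * N)\<bar> \<le> A * B * h ^ k / (1 + (h * N)\<^sup>2)"
    if h: "0 < h" "h \<le> H" for h N
  proof -
    have "\<exists>\<xi>\<in>{h * N..h * N + real k * h}. (fdiff h ^^ k) (f 0) (h * N) = h ^ k * f k \<xi>"
      by (rule iterated_fdiff_eq_derivative[OF h(1)]) (auto simp: f_def has_real_derivative_gauss)
    then obtain \<xi> where \<xi>: "h * N \<le> \<xi>" "\<xi> \<le> h * N + real k * h"
      "(fdiff h ^^ k) (gauss p) (h * N) = h ^ k * f k \<xi>"
      by (auto simp: f_def)
    have "(h * N)\<^sup>2 \<le> 2 * \<xi>\<^sup>2 + 2 * (\<xi> - h * N)\<^sup>2"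
      using zero_le_power2[of "2 * \<xi> - h * N"] by (simp add: power2_eq_square algebra_simps)
    also have "(\<xi> - h * N)\<^sup>2 \<le> (real k * H)\<^sup>2"
      using \<xi>(1,2) h mult_left_mono[OF h(2), of "real k"] by (intro power_mono) auto
    finally have "1 + (h * N)\<^sup>2 \<le> 1 + 2 * \<xi>\<^sup>2 + 2 * (real k * H)\<^sup>2" by simp
    also have "\<dots> \<le> B * (1 + \<xi>\<^sup>2)"
      by (simp add: B_def algebra_simps)
    finally have *: "1 + (h * N)\<^sup>2 \<le> B * (1 + \<xi>\<^sup>2)" .
    have pos: "1 + \<xi>\<^sup>2 > 0" "1 + (h * N)\<^sup>2 > 0" by (simp_all add: add_pos_nonneg)
    have "A / (1 + \<xi>\<^sup>2) \<le> A * B / (1 + (h * N)\<^sup>2)"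
      using mult_left_mono[OF *, of A] A(1) pos by (simp add: field_simps)
    with A(2)[of \<xi>] have "\<bar>f k \<xi>\<bar> \<le> A * B / (1 + (h * N)\<^sup>2)" by linarith
    then have "h ^ k * \<bar>f k \<xi>\<bar> \<le> h ^ k * (A * B / (1 + (h * N)\<^sup>2))"
      using h by (intro mult_left_mono) auto
    then show ?thesis unfolding \<xi>(3) abs_mult using h by (simp add: mult_ac)
  qed
  moreover have "A * B \<ge> 0" using A by (auto simp: B_def)
  ultimately show thesis using that by blast
qed

section \<open>Trigonometric sums and summation by parts\<close>

lemma sum_symmetric_int:
  fixes f :: "int \<Rightarrow> 'a::ab_group_add"
  shows "(\<Sum>N\<in>{- int M..int M}. f N) = f 0 + (\<Sum>n<M. f (int (Suc n)) + f (- int (Suc n)))"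
proof (induction M)
  case (Suc M)
  have "{- int (Suc M)..int (Suc M)} = insert (int (Suc M)) (insert (- int (Suc M)) {- int M..int M})"
    by auto
  then have "(\<Sum>N\<in>{- int (Suc M)..int (Suc M)}. f N)
      = f (int (Suc M)) + (f (- int (Suc M)) + (\<Sum>N\<in>{- int M..int M}. f N))"
    by (simp only:) (subst sum.insert; simp)+
  with Suc show ?case by (simp add: algebra_simps)
qed simp

text \<open>Comparison with the integral of 1 / (1 + z^2): the mean value theorem for arctan on each
  grid cell bounds the term at its right end, and arctan stays below pi/2. Both half-lines together
  give pi/h, and N = 0 gives 1.\<close>

lemma sum_inverse_one_plus_square_le:
  assumes "h > 0"
  shows "(\<Sum>N\<in>{- int M..int M}. 1 / (1 + (h * real_of_int N)\<^sup>2)) \<le> 1 + pi / h"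
proof -
  have "(\<Sum>n<M. 1 / (1 + (h * real (Suc n))\<^sup>2)) \<le> arctan (h * real M) / h"
  proof (induction M)
    case (Suc M)
    obtain z where z: "h * real M < z" "z < h * real (Suc M)"
      "arctan (h * real (Suc M)) - arctan (h * real M)
         = (h * real (Suc M) - h * real M) * inverse (1 + z\<^sup>2)"
      using MVT2[of "h * real M" "h * real (Suc M)" arctan "\<lambda>z. inverse (1 + z\<^sup>2)"]
        \<open>h > 0\<close> DERIV_arctan by auto
    have "0 \<le> h * real M" using \<open>h > 0\<close> by simp
    with z have "z\<^sup>2 \<le> (h * real (Suc M))\<^sup>2" by (intro power_mono) auto
    then have "1 / (1 + (h * real (Suc M))\<^sup>2) \<le> inverse (1 + z\<^sup>2)"
      by (auto simp: inverse_eq_divide add_pos_nonneg intro!: divide_left_mono mult_pos_pos)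
    also have "\<dots> = (arctan (h * real (Suc M)) - arctan (h * real M)) / h"
      using \<open>h > 0\<close> unfolding z(3) by (simp add: algebra_simps)
    finally show ?case using Suc by (simp add: diff_divide_distrib)
  qed simp
  also have "\<dots> \<le> (pi / 2) / h"
    using \<open>h > 0\<close> arctan_ubound[of "h * real M"] by (intro divide_right_mono) auto
  finally have "(\<Sum>n<M. 1 / (1 + (h * real (Suc n))\<^sup>2)) \<le> (pi / 2) / h" .
  then show ?thesis
    unfolding sum_symmetric_int sum.distrib by (simp del: of_nat_Suc)
qed

definition trig_sum :: "real \<Rightarrow> (int \<Rightarrow> real) \<Rightarrow> nat \<Rightarrow> complex" where
  "trig_sum y a M = (\<Sum>N\<in>{- int M..int M}. of_real (a N) * cis (real_of_int N * y))"

text \<open>Summation by parts: multiplying a trigonometric series by \<open>cis (- y) - 1\<close> amounts to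
  taking differences of its coefficients.\<close>

lemma trig_sum_difference:
  "trig_sum y (\<lambda>N. a (N + 1) - a N) M
     = (cis (- y) - 1) * trig_sum y a M
       + of_real (a (int M + 1)) * cis (real M * y) - of_real (a (- int M)) * cis (- (real M + 1) * y)"
proof -
  have "(\<Sum>N\<in>{- int M..int M}. of_real (a (N + 1)) * cis (real_of_int N * y))
      = (\<Sum>N\<in>{- int M + 1..int M + 1}. of_real (a N) * cis ((real_of_int N - 1) * y))"
    by (rule sum.reindex_bij_witness[of _ "\<lambda>N. N - 1" "\<lambda>N. N + 1"]) auto
  also have "\<dots> = (\<Sum>N\<in>{- int M..int M}. of_real (a N) * cis ((real_of_int N - 1) * y))
       + of_real (a (int M + 1)) * cis (real M * y) - of_real (a (- int M)) * cis (- (real M + 1) * y)"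
  proof -
    let ?g = "\<lambda>N. of_real (a N) * cis ((real_of_int N - 1) * y)"
    have 1: "{- int M..int M + 1} = insert (int M + 1) {- int M..int M}" by auto
    have 2: "{- int M..int M + 1} = insert (- int M) {- int M + 1..int M + 1}" by auto
    have "sum ?g {- int M..int M + 1} = ?g (int M + 1) + sum ?g {- int M..int M}"
      unfolding 1 by (subst sum.insert) auto
    moreover have "sum ?g {- int M..int M + 1} = ?g (- int M) + sum ?g {- int M + 1..int M + 1}"
      unfolding 2 by (subst sum.insert) auto
    ultimately have "?g (int M + 1) + sum ?g {- int M..int M}
        = ?g (- int M) + sum ?g {- int M + 1..int M + 1}" by simp
    then have "sum ?g {- int M + 1..int M + 1}
        = sum ?g {- int M..int M} + ?g (int M + 1) - ?g (- int M)"
      unfolding eq_diff_eq by (simp only: add.commute)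
    moreover have "(real_of_int (- int M) - 1) * y = - (real M + 1) * y" by (simp add: ring_distribs)
    ultimately show ?thesis by simp
  qed
  also have "(\<Sum>N\<in>{- int M..int M}. of_real (a N) * cis ((real_of_int N - 1) * y))
      = cis (- y) * trig_sum y a M"
  proof -
    have "cis ((real_of_int N - 1) * y) = cis (- y) * cis (real_of_int N * y)" for N
      by (simp add: cis_mult algebra_simps)
    then show ?thesis by (simp add: trig_sum_def sum_distrib_left mult.left_commute)
  qed
  finally have "(\<Sum>N\<in>{- int M..int M}. of_real (a (N + 1)) * cis (real_of_int N * y))
      = cis (- y) * trig_sum y a M + of_real (a (int M + 1)) * cis (real M * y)
        - of_real (a (- int M)) * cis (- (real M + 1) * y)" .
  moreover have "trig_sum y (\<lambda>N. a (N + 1) - a N) M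
      = (\<Sum>N\<in>{- int M..int M}. of_real (a (N + 1)) * cis (real_of_int N * y)) - trig_sum y a M"
    by (simp only: trig_sum_def of_real_diff left_diff_distrib sum_subtractf)
  moreover have "R = (c - 1) * T + u - v" if "S = c * T + u - v" "R = S - T" for R S T c u v :: complex
    unfolding that(2) unfolding that(1) by (simp add: algebra_simps)
  ultimately show ?thesis by blast
qed

lemma norm_trig_sum_le: "norm (trig_sum y a M) \<le> (\<Sum>N\<in>{- int M..int M}. \<bar>a N\<bar>)"
  unfolding trig_sum_def by (rule order.trans[OF norm_sum]) (simp add: norm_mult)

text \<open>Each difference multiplies the sum by \<open>cis (- y) - 1\<close> up to two boundary
  coefficients, at M + 1 and -M, which the last two assumptions send to zero.\<close>

lemma trig_sum_iterated_fdiff_tendsto: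
  assumes "trig_sum y (\<lambda>N. f (h * real_of_int N)) \<longlonglongrightarrow> A"
    and "\<And>k. (\<lambda>M. (fdiff h ^^ k) f (h * real M)) \<longlonglongrightarrow> 0"
    and "\<And>k. (\<lambda>M. (fdiff h ^^ k) f (- (h * real M))) \<longlonglongrightarrow> 0"
  shows "trig_sum y (\<lambda>N. (fdiff h ^^ k) f (h * real_of_int N)) \<longlonglongrightarrow> (cis (- y) - 1) ^ k * A"
proof (induction k)
  case (Suc k)
  let ?a = "\<lambda>N. (fdiff h ^^ k) f (h * real_of_int N)"
  have eq: "(fdiff h ^^ Suc k) f (h * real_of_int N) = ?a (N + 1) - ?a N" for N
    by (simp add: fdiff_def algebra_simps)
  have b1: "(\<lambda>M. of_real (?a (int M + 1)) * cis (real M * y)) \<longlonglongrightarrow> 0"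
  proof (rule tendsto_norm_zero_cancel)
    show "(\<lambda>M. norm (of_real (?a (int M + 1)) * cis (real M * y))) \<longlonglongrightarrow> 0"
      using LIMSEQ_Suc[OF assms(2)[of k]] by (simp add: norm_mult tendsto_rabs_zero add_ac)
  qed
  have b2: "(\<lambda>M. of_real (?a (- int M)) * cis (- (real M + 1) * y)) \<longlonglongrightarrow> 0"
  proof (rule tendsto_norm_zero_cancel)
    show "(\<lambda>M. norm (of_real (?a (- int M)) * cis (- (real M + 1) * y))) \<longlonglongrightarrow> 0"
      using assms(3)[of k] by (simp add: norm_mult tendsto_rabs_zero)
  qed
  have "(\<lambda>M. trig_sum y (\<lambda>N. ?a (N + 1) - ?a N) M) \<longlonglongrightarrow> (cis (- y) - 1) * ((cis (- y) - 1) ^ k * A) + 0 - 0"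
    unfolding trig_sum_difference[of y ?a] by (intro tendsto_intros Suc b1 b2)
  moreover have "(\<lambda>N. ?a (N + 1) - ?a N) = (\<lambda>N. (fdiff h ^^ Suc k) f (h * real_of_int N))"
    using eq by auto
  ultimately show ?case by (simp only: power_Suc mult.assoc add_0_right diff_zero)
qed (use assms(1) in simp)

text \<open>A crude Jordan inequality. Passing to x/2 keeps the argument below pi/4, where cosine is
  at least 1/2; this is used once in the mean value theorem for sine and once for the factor cos
  (x/2).\<close>

lemma sin_ge_quarter:
  assumes "0 \<le> x" "x \<le> pi / 2"
  shows "x / 4 \<le> sin x"
proof -
  have cos: "cos z \<ge> 1 / 2" if "0 \<le> z" "z \<le> pi / 4" for z
  proof -
    have "cos (pi / 3) \<le> cos z" using that by (intro cos_monotone_0_pi_le) auto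
    then show ?thesis by (simp add: cos_60)
  qed
  have "x / 2 * (1 / 2) \<le> sin (x / 2)"
  proof (cases "x = 0")
    case False
    then have "0 < x / 2" using assms by simp
    then obtain z where z: "0 < z" "z < x / 2" "sin (x / 2) - sin 0 = (x / 2 - 0) * cos z"
      using MVT2[of 0 "x / 2" sin cos] DERIV_sin by auto
    have "x / 2 * (1 / 2) \<le> x / 2 * cos z"
      using z assms by (intro mult_left_mono cos) auto
    moreover have "sin (x / 2) = x / 2 * cos z" using z(3) by simp
    ultimately show ?thesis by linarith
  qed simp
  moreover have "sin (x / 2) * (1 / 2) \<le> sin (x / 2) * cos (x / 2)"
    using assms by (intro mult_left_mono cos sin_ge_zero) auto
  moreover have "sin x = 2 * sin (x / 2) * cos (x / 2)" using sin_double[of "x / 2"] by simp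
  ultimately show ?thesis by simp
qed

text \<open>The chord has length 2 sin (y/2). This bound turns the k-th power of the summation
  factor into y^k; the range must stop short of y = 2 pi, where the chord closes up again.\<close>

lemma norm_cis_minus_one_ge:
  assumes "0 \<le> y" "y \<le> pi"
  shows "norm (cis (- y) - 1) \<ge> y / 4"
proof -
  have "(norm (cis (- y) - 1))\<^sup>2 = (cos y)\<^sup>2 + (sin y)\<^sup>2 + 1 - 2 * cos y"
    by (simp add: cmod_power2 power2_diff)
  also have "\<dots> = 2 - 2 * cos (2 * (y / 2))" by simp
  also have "\<dots> = (2 * sin (y / 2))\<^sup>2"
    unfolding cos_double_sin by (simp add: power2_eq_square)
  finally have sq: "(norm (cis (- y) - 1))\<^sup>2 = (2 * sin (y / 2))\<^sup>2" .
  have "sin (y / 2) \<ge> 0" using assms by (intro sin_ge_zero) auto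
  then have "norm (cis (- y) - 1) = 2 * sin (y / 2)"
    by (intro power2_eq_imp_eq[OF sq]) simp_all
  with sin_ge_quarter[of "y / 2"] assms show ?thesis by simp
qed

section \<open>The family of heat series: convergence, derivatives, continuity\<close>

text \<open>With \<open>N = n + 1\<close>: both \<open>\<partial>\<^sub>y\<close> and \<open>\<partial>\<^sub>s\<close> raise the index \<open>j\<close>, by one and by two,
  because \<open>cos (\<theta> + \<pi>)\<close> absorbs the sign of \<open>- N\<^sup>2\<close>.\<close>

definition heat_term :: "int \<Rightarrow> nat \<Rightarrow> real \<Rightarrow> real \<Rightarrow> real" where
  "heat_term j n y s = real (Suc n) powi j * exp (- ((real (Suc n))\<^sup>2 * s))
     * cos (real (Suc n) * y + of_int j * (pi / 2))"

definition heat_series :: "int \<Rightarrow> real \<Rightarrow> real \<Rightarrow> real" where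
  "heat_series j y s = (\<Sum>n. heat_term j n y s)"

text \<open>The cosine is dropped; what is left decreases in s, so one time s0 majorizes all later
  times at once.\<close>

definition heat_majorant :: "int \<Rightarrow> real \<Rightarrow> nat \<Rightarrow> real" where
  "heat_majorant j s n = real (Suc n) powi j * exp (- ((real (Suc n))\<^sup>2 * s))"

lemma heat_term_le_majorant:
  assumes "s0 \<le> s"
  shows "\<bar>heat_term j n y s\<bar> \<le> heat_majorant j s0 n"
proof -
  have "\<bar>heat_term j n y s\<bar> = heat_majorant j s n * \<bar>cos (real (Suc n) * y + of_int j * (pi / 2))\<bar>"
    by (simp add: heat_term_def heat_majorant_def abs_mult power_int_abs del: of_nat_Suc)
  also have "\<dots> \<le> heat_majorant j s n * 1"
    by (intro mult_left_mono abs_cos_le_one) (simp add: heat_majorant_def)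
  also have "\<dots> \<le> heat_majorant j s0 n"
    using assms by (auto simp: heat_majorant_def simp del: of_nat_Suc intro!: mult_left_mono)
  finally show ?thesis .
qed

text \<open>The Gaussian bound at w = sqrt s N leaves a multiple of 1/N^2. For negative j the choice
  m = 0 merely weakens the estimate, because N >= 1.\<close>

lemma summable_heat_majorant:
  assumes "s > 0"
  shows "summable (heat_majorant j s)"
proof -
  define m where "m = nat j"
  define h where "h = sqrt s"
  have h: "h > 0" "h\<^sup>2 = s" using assms by (auto simp: h_def)
  obtain C where C: "C \<ge> 0" "\<And>w. \<bar>gauss (monom 1 m) w\<bar> \<le> C / (1 + w\<^sup>2)"
    using gauss_le by metis
  have sm: "summable (\<lambda>n. C / (h ^ m * s) * inverse (real (Suc n) ^ 2))"
    using summable_ignore_initial_segment[OF inverse_power_summable[of 2, where 'a=real], of 1]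
    by (intro summable_mult) simp
  have "norm (heat_majorant j s n) \<le> C / (h ^ m * s) * inverse (real (Suc n) ^ 2)" for n
  proof -
    let ?N = "real (Suc n)"
    have N: "?N \<ge> 1" "?N > 0" by auto
    have "?N powi j \<le> ?N powi (int m)"
      using N(1) by (intro power_int_increasing) (auto simp: m_def)
    then have "heat_majorant j s n \<le> ?N ^ m * exp (- (?N\<^sup>2 * s))"
      by (simp add: heat_majorant_def del: of_nat_Suc)
    also have "\<dots> = gauss (monom 1 m) (h * ?N) / h ^ m"
      using h(1) by (simp add: gauss_def poly_monom power_mult_distrib h(2) mult_ac del: of_nat_Suc)
    also have "\<dots> \<le> (C / (1 + (h * ?N)\<^sup>2)) / h ^ m"
      using C(2)[of "h * ?N"] h(1) by (intro divide_right_mono) auto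
    also have "\<dots> \<le> (C / (s * ?N\<^sup>2)) / h ^ m"
      using C(1) h N assms
      by (intro divide_right_mono divide_left_mono mult_pos_pos zero_le_power) 
         (auto simp: power_mult_distrib add_pos_nonneg simp del: of_nat_Suc)
    finally show ?thesis
      using N by (simp add: heat_majorant_def abs_mult divide_inverse mult_ac del: of_nat_Suc)
  qed
  with sm show ?thesis by (rule summable_comparison_test'[where N = 0])
qed

lemma summable_heat_term:
  assumes "s > 0"
  shows "summable (\<lambda>n. heat_term j n y s)"
  by (rule summable_comparison_test'[OF summable_heat_majorant[OF assms, of j], where N = 0])
     (use heat_term_le_majorant in auto)

lemma real_Suc_times_powi: "real (Suc n) * real (Suc n) powi j = real (Suc n) powi (j + 1)"
  by (subst power_int_add_1') auto

lemma heat_term_has_derivative_space: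
  "((\<lambda>y. heat_term j n y s) has_real_derivative heat_term (j + 1) n y s) (at y within S)"
proof -
  let ?N = "real (Suc n)"
  have "?N * y + of_int (j + 1) * (pi / 2) = (?N * y + of_int j * (pi / 2)) + pi / 2"
    by (simp add: ring_distribs del: of_nat_Suc)
  then have "cos (?N * y + of_int (j + 1) * (pi / 2)) = - sin (?N * y + of_int j * (pi / 2))"
    by (simp only: cos_add[of _ "pi / 2"] cos_pi_half sin_pi_half mult_zero_right mult_1_right diff_0)
  then have "heat_term (j + 1) n y s
      = (?N * ?N powi j) * exp (- (?N\<^sup>2 * s)) * - sin (?N * y + of_int j * (pi / 2))"
    by (simp add: heat_term_def real_Suc_times_powi del: of_nat_Suc)
  then show ?thesis unfolding heat_term_def[of j]
    by (auto intro!: derivative_eq_intros simp del: of_nat_Suc)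
qed

lemma heat_term_has_derivative_time:
  "((\<lambda>s. heat_term j n y s) has_real_derivative heat_term (j + 2) n y s) (at s within S)"
proof -
  let ?N = "real (Suc n)"
  have "?N * y + of_int (j + 2) * (pi / 2) = (?N * y + of_int j * (pi / 2)) + pi"
    by (simp add: ring_distribs del: of_nat_Suc)
  then have "cos (?N * y + of_int (j + 2) * (pi / 2)) = - cos (?N * y + of_int j * (pi / 2))"
    by (simp only: cos_periodic_pi)
  moreover have "?N powi (j + 2) = ?N\<^sup>2 * ?N powi j"
    by (subst power_int_add) (auto simp: mult.commute simp del: of_nat_Suc)
  ultimately show ?thesis unfolding heat_term_def
    by (auto intro!: derivative_eq_intros simp del: of_nat_Suc)
qed

lemma heat_series_has_derivative_space:
  assumes "s > 0"
  shows "((\<lambda>y. heat_series j y s) has_real_derivative heat_series (j + 1) y s) (at y)"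
  unfolding heat_series_def
proof (rule has_field_derivative_series'(2)[where S = UNIV and ?x0.0 = y])
  show "uniformly_convergent_on UNIV (\<lambda>n y. \<Sum>i<n. heat_term (j + 1) i y s)"
    using heat_term_le_majorant[of s s "j + 1"]
    by (intro Weierstrass_m_test'_ev[OF _ summable_heat_majorant[OF assms, of "j + 1"]]) auto
qed (use summable_heat_term[OF assms] heat_term_has_derivative_space in auto)

lemma heat_series_has_derivative_time:
  assumes "s > 0"
  shows "((\<lambda>s. heat_series j y s) has_real_derivative heat_series (j + 2) y s) (at s)"
  unfolding heat_series_def
\<comment> \<open>Uniform convergence is at hand only away from time 0; the half-line from s/2 has s
  in its interior.\<close>
proof (rule has_field_derivative_series'(2)[where S = "{s / 2..}" and ?x0.0 = s])
  show "uniformly_convergent_on {s / 2..} (\<lambda>n s. \<Sum>i<n. heat_term (j + 2) i y s)"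
    using heat_term_le_majorant[of "s / 2" _ "j + 2"] assms
    by (intro Weierstrass_m_test'_ev[OF _ summable_heat_majorant[of "s / 2" "j + 2"]]) auto
qed (use summable_heat_term[OF assms] heat_term_has_derivative_time assms in
      \<open>auto simp: interior_real_atLeast\<close>)

text \<open>The majorant \<open>B\<close> stays a parameter to serve two kinds of set: times bounded
  below by a positive number, and, for j = -2, all s >= 0 with \<open>B n\<close> equal to
  1/N^2.\<close>

lemma continuous_on_heat_series_majorized:
  assumes "\<And>n y s. (y, s) \<in> S \<Longrightarrow> \<bar>heat_term j n y s\<bar> \<le> B n" and "summable B"
  shows "continuous_on S (\<lambda>(y, s). heat_series j y s)"
proof (rule uniform_limit_theorem[OF _ _ trivial_limit_sequentially])
  have "uniform_limit S (\<lambda>n p. \<Sum>i<n. heat_term j i (fst p) (snd p))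
      (\<lambda>p. suminf (\<lambda>i. heat_term j i (fst p) (snd p))) sequentially"
    by (rule Weierstrass_m_test[OF _ assms(2)]) (use assms(1) in auto)
  then show "uniform_limit S (\<lambda>n p. \<Sum>i<n. heat_term j i (fst p) (snd p))
      (\<lambda>(y, s). heat_series j y s) sequentially"
    by (simp add: heat_series_def case_prod_beta')
  show "\<forall>\<^sub>F n in sequentially. continuous_on S (\<lambda>p. \<Sum>i<n. heat_term j i (fst p) (snd p))"
    unfolding heat_term_def by (intro always_eventually allI continuous_intros)
qed

lemma continuous_on_heat_series: "continuous_on (UNIV \<times> {0<..}) (\<lambda>(y, s). heat_series j y s)"
proof -
  have "continuous_on (\<Union>a\<in>{0<..}. UNIV \<times> {a<..}) (\<lambda>(y, s). heat_series j y s)"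
  proof (rule continuous_on_open_UN)
    fix a :: real assume "a \<in> {0<..}"
    then show "continuous_on (UNIV \<times> {a<..}) (\<lambda>(y, s). heat_series j y s)"
      by (intro continuous_on_heat_series_majorized[OF _ summable_heat_majorant[of a j]])
         (auto intro!: heat_term_le_majorant)
  qed (auto intro: open_Times)
  moreover have "(\<Union>a\<in>{0<..}. UNIV \<times> {a<..}) = (UNIV \<times> {0<..} :: (real \<times> real) set)"
  proof (intro subset_antisym subsetI)
    fix p :: "real \<times> real" assume "p \<in> UNIV \<times> {0<..}"
    then show "p \<in> (\<Union>a\<in>{0<..}. UNIV \<times> {a<..})" by (intro UN_I[of "snd p / 2"]) auto
  qed auto
  ultimately show ?thesis by simp
qed

section \<open>Decay of the heat series as s tends to 0\<close>

text \<open>Joins the contributions of N and -N: the coefficient N^j has parity (-1)^j, and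
  multiplication by i^j makes the pair a real cosine shifted by j quarter turns, the phase built
  into \<open>heat_term\<close>.\<close>

lemma cos_plus_quarter_turns:
  "\<i> ^ j * (cis t + (- 1) ^ j * cis (- t)) = of_real (2 * cos (t + of_int (int j) * (pi / 2)))"
proof -
  have "\<i> ^ j = cis (real j * (pi / 2))" unfolding cis_pi_half[symmetric] by (rule Complex.DeMoivre)
  moreover have "\<i> ^ j * (- 1) ^ j = cis (- (real j * (pi / 2)))"
  proof -
    have "\<i> ^ j * (- 1) ^ j = (- \<i>) ^ j" by (simp flip: power_mult_distrib)
    also have "\<dots> = cis (- (pi / 2)) ^ j" by simp
    also have "\<dots> = cis (real j * - (pi / 2))" by (rule Complex.DeMoivre)
    finally show ?thesis by simp
  qed
  ultimately have "\<i> ^ j * (cis t + (- 1) ^ j * cis (- t))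
      = cis (real j * (pi / 2)) * cis t + cis (- (real j * (pi / 2))) * cis (- t)"
    by (simp only: ring_distribs mult.assoc[symmetric])
  also have "\<dots> = cis (t + real j * (pi / 2)) + cis (- (t + real j * (pi / 2)))"
    by (simp add: cis_mult add.commute)
  also have "cis x + cis (- x) = of_real (2 * cos x)" for x
    by (rule complex_eqI) simp_all
  finally show ?thesis by simp
qed

text \<open>Brings the heat series into the scope of summation by parts: its coefficients are
  samples of w^j exp (- w^2) on the grid of mesh sqrt s. Positivity of j removes the term N = 0,
  which has no counterpart in the series.\<close>

lemma trig_sum_gauss_monom:
  assumes "s > 0" "j > 0"
  shows "\<i> ^ j * trig_sum y (\<lambda>N. gauss (monom 1 j) (sqrt s * real_of_int N)) M
     = of_real (2 * sqrt s ^ j * (\<Sum>n<M. heat_term (int j) n y s))"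
proof -
  have "\<i> ^ j * (of_real (gauss (monom 1 j) (sqrt s * real (Suc n))) * cis (real (Suc n) * y)
          + of_real (gauss (monom 1 j) (sqrt s * - real (Suc n))) * cis (- (real (Suc n) * y)))
      = of_real (2 * sqrt s ^ j * heat_term (int j) n y s)" for n
  proof -
    let ?N = "real (Suc n)"
    have s: "(sqrt s)\<^sup>2 = s" using assms by simp
    define g where "g = sqrt s ^ j * ?N ^ j * exp (- (?N\<^sup>2 * s))"
    have 1: "gauss (monom 1 j) (sqrt s * ?N) = g"
      by (simp add: gauss_def poly_monom power_mult_distrib s g_def mult_ac del: of_nat_Suc)
    have "sqrt s * - ?N = - (sqrt s * ?N)" by (rule mult_minus_right)
    then have 2: "gauss (monom 1 j) (sqrt s * - ?N) = (- 1) ^ j * g"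
      by (simp only: 1[symmetric])
         (simp add: gauss_def poly_monom power_minus[of "sqrt s * _" j] del: of_nat_Suc)
    have "\<i> ^ j * (of_real g * cis (?N * y) + of_real ((- 1) ^ j * g) * cis (- (?N * y)))
        = of_real g * (\<i> ^ j * (cis (?N * y) + (- 1) ^ j * cis (- (?N * y))))"
      by (simp add: algebra_simps del: of_nat_Suc)
    also have "\<dots> = of_real (2 * sqrt s ^ j * heat_term (int j) n y s)"
      unfolding cos_plus_quarter_turns by (simp add: g_def heat_term_def del: of_nat_Suc)
    finally show ?thesis unfolding 1 2 .
  qed
  then show ?thesis
    using assms(2) unfolding trig_sum_def sum_symmetric_int
    by (simp add: gauss_def poly_monom power_0_left sum_distrib_left del: of_nat_Suc)
qed

text \<open>The power \<open>sqrt s ^ (j + 1)\<close> on the left has two sources: j factors from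
  rescaling N^j to grid points, and one from the 1/h cost of summing over the grid. Each of the k
  differences contributes one factor sqrt s on the right and, through \<open>cis (- y) - 1\<close>,
  one factor y on the left. As k is free, the decay away from y = 0 is of any order.\<close>

lemma heat_series_decay:
  assumes "H > 0" "j > 0"
  obtains C where "C \<ge> 0"
    "\<And>y s. 0 \<le> y \<Longrightarrow> y \<le> pi \<Longrightarrow> 0 < s \<Longrightarrow> s \<le> H \<Longrightarrow>
       \<bar>heat_series (int j) y s\<bar> * y ^ k * sqrt s ^ (j + 1) \<le> C * sqrt s ^ k"
proof -
  let ?g = "gauss (monom 1 j)"
  have H: "sqrt H > 0" using assms by simp
  obtain C where C: "C \<ge> 0" "\<And>h N. 0 < h \<Longrightarrow> h \<le> sqrt H \<Longrightarrow>
      \<bar>(fdiff h ^^ k) ?g (h * N)\<bar> \<le> C * h ^ k / (1 + (h * N)\<^sup>2)"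
    using iterated_fdiff_gauss_le[OF H] by metis
  have "\<bar>heat_series (int j) y s\<bar> * y ^ k * sqrt s ^ (j + 1) \<le> 4 ^ k * C * (sqrt H + pi) * sqrt s ^ k"
    if y: "0 \<le> y" "y \<le> pi" and s: "0 < s" "s \<le> H" for y s
  proof -
    define h where "h = sqrt s"
    have h: "0 < h" "h \<le> sqrt H" using s by (auto simp: h_def)
    define A where "A = (- \<i>) ^ j * of_real (2 * h ^ j * heat_series (int j) y s)"
    have T: "trig_sum y (\<lambda>N. ?g (h * real_of_int N)) \<longlonglongrightarrow> A"
    proof -
      have eq: "trig_sum y (\<lambda>N. ?g (h * real_of_int N)) M
          = (- \<i>) ^ j * of_real (2 * h ^ j * (\<Sum>n<M. heat_term (int j) n y s))" for M
      proof -
        have "trig_sum y (\<lambda>N. ?g (h * real_of_int N)) M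
            = (- \<i>) ^ j * (\<i> ^ j * trig_sum y (\<lambda>N. ?g (h * real_of_int N)) M)"
          by (simp flip: power_mult_distrib mult.assoc)
        then show ?thesis unfolding h_def trig_sum_gauss_monom[OF s(1) assms(2)] .
      qed
      have "(\<lambda>M. (\<Sum>n<M. heat_term (int j) n y s)) \<longlonglongrightarrow> heat_series (int j) y s"
        using summable_LIMSEQ[OF summable_heat_term[OF s(1)]] by (simp add: heat_series_def)
      then have "(\<lambda>M. (- \<i>) ^ j * of_real (2 * h ^ j * (\<Sum>n<M. heat_term (int j) n y s))) \<longlonglongrightarrow> A"
        unfolding A_def by (intro tendsto_intros)
      then show ?thesis by (simp only: ext[OF eq])
    qed
    have inf: "(\<lambda>M. C * h ^ k / (1 + (h * real M)\<^sup>2)) \<longlonglongrightarrow> 0" for C k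
    proof (rule tendsto_divide_0[OF tendsto_const filterlim_at_top_imp_at_infinity])
      show "filterlim (\<lambda>M. 1 + (h * real M)\<^sup>2) at_top sequentially"
        using h(1)
        by (intro filterlim_tendsto_add_at_top[OF tendsto_const] filterlim_pow_at_top
            filterlim_tendsto_pos_mult_at_top[OF tendsto_const] filterlim_real_sequentially) auto
    qed
    \<comment> \<open>The differences of all orders vanish at both ends of the grid; the sign
      \<open>\<sigma>\<close> treats N = M and N = -M together.\<close>
    have z: "(\<lambda>M. (fdiff h ^^ i) ?g (\<sigma> * (h * real M))) \<longlonglongrightarrow> 0" if "\<sigma> = 1 \<or> \<sigma> = -1" for i \<sigma>
    proof -
      obtain C' where C': "\<And>h N. 0 < h \<Longrightarrow> h \<le> sqrt H \<Longrightarrow>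
          \<bar>(fdiff h ^^ i) ?g (h * N)\<bar> \<le> C' * h ^ i / (1 + (h * N)\<^sup>2)"
        using iterated_fdiff_gauss_le[OF H, of i "monom 1 j"] by metis
      have "norm ((fdiff h ^^ i) ?g (\<sigma> * (h * real M))) \<le> C' * h ^ i / (1 + (h * real M)\<^sup>2)" for M
        using C'[OF h, of "\<sigma> * real M"] that by auto
      then show ?thesis
        by (intro Lim_null_comparison[OF _ inf[of C' i]] always_eventually) auto
    qed
    have lim: "trig_sum y (\<lambda>N. (fdiff h ^^ k) ?g (h * real_of_int N)) \<longlonglongrightarrow> (cis (- y) - 1) ^ k * A"
      by (rule trig_sum_iterated_fdiff_tendsto[OF T]) (use z[of 1] z[of "-1"] in auto)
    have "norm (trig_sum y (\<lambda>N. (fdiff h ^^ k) ?g (h * real_of_int N)) M) \<le> C * h ^ k * (1 + pi / h)" for M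
    proof -
      have "norm (trig_sum y (\<lambda>N. (fdiff h ^^ k) ?g (h * real_of_int N)) M)
          \<le> (\<Sum>N\<in>{- int M..int M}. \<bar>(fdiff h ^^ k) ?g (h * real_of_int N)\<bar>)" by (rule norm_trig_sum_le)
      also have "\<dots> \<le> (\<Sum>N\<in>{- int M..int M}. C * h ^ k * (1 / (1 + (h * real_of_int N)\<^sup>2)))"
        using C(2)[OF h] by (intro sum_mono) simp
      also have "\<dots> \<le> C * h ^ k * (1 + pi / h)"
        unfolding sum_distrib_left[symmetric]
        using C(1) h(1) by (intro mult_left_mono sum_inverse_one_plus_square_le) auto
      finally show ?thesis .
    qed
    then have "norm ((cis (- y) - 1) ^ k * A) \<le> C * h ^ k * (1 + pi / h)"
      by (intro LIMSEQ_le_const2[OF tendsto_norm[OF lim]]) auto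
    moreover have "norm ((cis (- y) - 1) ^ k * A) \<ge> (y / 4) ^ k * (h ^ j * \<bar>heat_series (int j) y s\<bar>)"
    proof -
      have "norm A = 2 * h ^ j * \<bar>heat_series (int j) y s\<bar>"
        using h by (simp add: A_def norm_mult norm_power abs_mult)
      then have "norm A \<ge> h ^ j * \<bar>heat_series (int j) y s\<bar>" using h by simp
      moreover have "(y / 4) ^ k \<le> norm (cis (- y) - 1) ^ k"
        using norm_cis_minus_one_ge[OF y] y by (intro power_mono) auto
      ultimately show ?thesis using y h by (auto simp: norm_mult norm_power intro!: mult_mono)
    qed
    ultimately have "(y / 4) ^ k * (h ^ j * \<bar>heat_series (int j) y s\<bar>) \<le> C * h ^ k * (1 + pi / h)"
      by linarith
    \<comment> \<open>This factor clears the 4 of the chord bound and the pole pi/h of the grid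
      sum.\<close>
    then have "4 ^ k * h * ((y / 4) ^ k * (h ^ j * \<bar>heat_series (int j) y s\<bar>))
        \<le> 4 ^ k * h * (C * h ^ k * (1 + pi / h))"
      using h by (intro mult_left_mono) auto
    moreover have "4 ^ k * h * ((y / 4) ^ k * (h ^ j * \<bar>heat_series (int j) y s\<bar>))
        = \<bar>heat_series (int j) y s\<bar> * y ^ k * h ^ (j + 1)" by (simp add: power_divide)
    moreover have "4 ^ k * h * (C * h ^ k * (1 + pi / h)) = 4 ^ k * C * (h + pi) * h ^ k"
      using h by (simp add: field_simps)
    moreover have "4 ^ k * C * (h + pi) * h ^ k \<le> 4 ^ k * C * (sqrt H + pi) * h ^ k"
      using h C(1) by (intro mult_right_mono mult_left_mono) auto
    ultimately show ?thesis unfolding h_def by linarith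
  qed
  moreover have "4 ^ k * C * (sqrt H + pi) \<ge> 0" using C(1) H by simp
  ultimately show thesis using that by blast
qed

text \<open>With k = 8 differences the surviving power of sqrt s is 7 - j, at least 4 for j up to 3,
  hence the rate s^2. Any rate faster than linear makes the extension by zero differentiable in time
  at s = 0.\<close>

lemma heat_series_decay_low_order:
  assumes "H > 0" "j \<in> {1, 2, 3}"
  obtains C where "C \<ge> 0"
    "\<And>y s. 0 < y \<Longrightarrow> y \<le> pi \<Longrightarrow> 0 < s \<Longrightarrow> s \<le> H \<Longrightarrow> \<bar>heat_series j y s\<bar> \<le> C * s\<^sup>2 / y ^ 8"
proof -
  define i where "i = nat j"
  have i: "i > 0" "i \<le> 3" "j = int i" using assms(2) by (auto simp: i_def)
  obtain C where C: "C \<ge> 0"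
    "\<And>y s. 0 \<le> y \<Longrightarrow> y \<le> pi \<Longrightarrow> 0 < s \<Longrightarrow> s \<le> H \<Longrightarrow>
       \<bar>heat_series (int i) y s\<bar> * y ^ 8 * sqrt s ^ (i + 1) \<le> C * sqrt s ^ 8"
    using heat_series_decay[OF assms(1) i(1), of 8] by blast
  have "\<bar>heat_series j y s\<bar> \<le> C * sqrt H ^ (3 - i) * s\<^sup>2 / y ^ 8"
    if y: "0 < y" "y \<le> pi" and s: "0 < s" "s \<le> H" for y s
  proof -
    have "8 = (i + 1) + (4 + (3 - i))" using i by simp
    then have "sqrt s ^ 8 = sqrt s ^ (i + 1) * (sqrt s ^ 4 * sqrt s ^ (3 - i))"
      by (metis power_add)
    moreover have "sqrt s ^ 4 = s\<^sup>2" using s by (simp add: power4_eq_xxxx power2_eq_square)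
    ultimately have "sqrt s ^ (i + 1) * (\<bar>heat_series (int i) y s\<bar> * y ^ 8)
        \<le> sqrt s ^ (i + 1) * (C * (s\<^sup>2 * sqrt s ^ (3 - i)))"
      using C(2)[of y s] y s by (simp add: mult_ac)
    then have "\<bar>heat_series (int i) y s\<bar> * y ^ 8 \<le> C * (s\<^sup>2 * sqrt s ^ (3 - i))"
      by (rule mult_left_le_imp_le) (use s in simp)
    also have "\<dots> \<le> C * (s\<^sup>2 * sqrt H ^ (3 - i))"
      using s C(1) by (intro mult_left_mono power_mono) auto
    finally show ?thesis using y i by (simp add: pos_le_divide_eq mult_ac)
  qed
  moreover have "C * sqrt H ^ (3 - i) \<ge> 0" using C(1) assms(1) by simp
  ultimately show thesis using that by blast
qed

text \<open>There are two regimes. When y dominates sqrt s, two differences give a bound A / y^2.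
  When sqrt s dominates, the series vanishes at y = 0 and its slope \<open>heat_series 2\<close> is
  at most B / s^(3/2), even with no difference taken, which gives B y / s^(3/2). Since sqrt (s +
  y^2) is at most twice the larger of y and sqrt s, both fit under one majorant; the 8 is the cube
  of that 2.\<close>

lemma heat_series_1_le:
  assumes "H > 0"
  obtains C where "C \<ge> 0"
    "\<And>y s. 0 < y \<Longrightarrow> y \<le> pi \<Longrightarrow> 0 < s \<Longrightarrow> s \<le> H \<Longrightarrow>
       \<bar>heat_series 1 y s\<bar> \<le> C * (y / ((s + y\<^sup>2) * sqrt (s + y\<^sup>2)))"
proof -
  obtain A where A: "A \<ge> 0" "\<And>y s. 0 \<le> y \<Longrightarrow> y \<le> pi \<Longrightarrow> 0 < s \<Longrightarrow> s \<le> H \<Longrightarrow>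
       \<bar>heat_series 1 y s\<bar> * y ^ 2 * sqrt s ^ 2 \<le> A * sqrt s ^ 2"
    using heat_series_decay[OF assms(1), of 1 2] by (auto simp: numeral_2_eq_2)
  obtain B where B: "B \<ge> 0" "\<And>y s. 0 \<le> y \<Longrightarrow> y \<le> pi \<Longrightarrow> 0 < s \<Longrightarrow> s \<le> H \<Longrightarrow>
       \<bar>heat_series 2 y s\<bar> * sqrt s ^ 3 \<le> B"
    using heat_series_decay[OF assms(1), of 2 0] by (auto simp: numeral_3_eq_3)
  have "\<bar>heat_series 1 y s\<bar> \<le> 8 * (A + B) * (y / ((s + y\<^sup>2) * sqrt (s + y\<^sup>2)))"
    if y: "0 < y" "y \<le> pi" and s: "0 < s" "s \<le> H" for y s
  proof -
    define q where "q = sqrt (s + y\<^sup>2)"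
    have q: "q > 0" "q\<^sup>2 = s + y\<^sup>2" using s by (auto simp: q_def add_pos_nonneg)
    have q3: "(s + y\<^sup>2) * sqrt (s + y\<^sup>2) = q ^ 3"
      unfolding q_def[symmetric] unfolding q(2)[symmetric]
      by (simp add: power3_eq_cube power2_eq_square)
    have near: "\<bar>heat_series 1 y s\<bar> * y ^ 3 \<le> A * y"
    proof -
      have "\<bar>heat_series 1 y s\<bar> * y ^ 2 \<le> A" using A(2)[of y s] y s by simp
      then have "\<bar>heat_series 1 y s\<bar> * y ^ 2 * y \<le> A * y" using y by (intro mult_right_mono) auto
      then show ?thesis by (simp add: power3_eq_cube power2_eq_square mult_ac)
    qed
    have far: "\<bar>heat_series 1 y s\<bar> * sqrt s ^ 3 \<le> B * y"
    proof -
      have "heat_term 1 n 0 s = 0" for n by (simp add: heat_term_def)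
      then have 0: "heat_series 1 0 s = 0" by (simp add: heat_series_def)
      obtain z where z: "0 < z" "z < y"
        "heat_series 1 y s - heat_series 1 0 s = (y - 0) * heat_series 2 z s"
        using MVT2[of 0 y "\<lambda>y. heat_series 1 y s" "\<lambda>y. heat_series 2 y s"]
          heat_series_has_derivative_space[OF s(1), of 1] y by auto
      have "y * (\<bar>heat_series 2 z s\<bar> * sqrt s ^ 3) \<le> y * B"
        using z y s by (intro mult_left_mono B) auto
      with z(3) y 0 show ?thesis by (simp add: abs_mult mult_ac)
    qed
    have "q \<le> 2 * max y (sqrt s)"
    proof (rule power2_le_imp_le)
      have "s = (sqrt s)\<^sup>2" using s by simp
      also have "\<dots> \<le> (max y (sqrt s))\<^sup>2" using s by (intro power_mono) auto
      finally have "s \<le> (max y (sqrt s))\<^sup>2" .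
      moreover have "y\<^sup>2 \<le> (max y (sqrt s))\<^sup>2" using y by (intro power_mono) auto
      moreover have "(max y (sqrt s))\<^sup>2 \<ge> 0" by simp
      ultimately have "s + y\<^sup>2 \<le> 4 * (max y (sqrt s))\<^sup>2" by linarith
      then show "q\<^sup>2 \<le> (2 * max y (sqrt s))\<^sup>2" by (simp add: q(2) power_mult_distrib)
    qed (use y in auto)
    then have "q ^ 3 \<le> (2 * max y (sqrt s)) ^ 3" using q by (intro power_mono) auto
    then have "\<bar>heat_series 1 y s\<bar> * q ^ 3 \<le> \<bar>heat_series 1 y s\<bar> * (8 * max y (sqrt s) ^ 3)"
      by (intro mult_left_mono) (auto simp: power_mult_distrib)
    also have "\<dots> = 8 * (\<bar>heat_series 1 y s\<bar> * max y (sqrt s) ^ 3)" by simp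
    also have "\<dots> \<le> 8 * ((A + B) * y)"
    proof (intro mult_left_mono)
      have "0 \<le> A * y" "0 \<le> B * y" using A(1) B(1) y by auto
      then show "\<bar>heat_series 1 y s\<bar> * max y (sqrt s) ^ 3 \<le> (A + B) * y"
        using near far by (auto simp: max_def algebra_simps)
    qed simp
    finally show ?thesis unfolding q3 using q(1) by (simp add: pos_le_divide_eq mult_ac)
  qed
  moreover have "8 * (A + B) \<ge> 0" using A(1) B(1) by simp
  ultimately show thesis using that by blast
qed

text \<open>The antiderivative is - 2 y / sqrt (s + y^2). From a = 0 on, the integral stays below 2
  for every y: this is the uniform mass bound of an approximate identity.\<close>

lemma has_integral_heat_majorant:
  fixes y :: real
  assumes "y > 0" "0 \<le> a" "a \<le> b"
  shows "((\<lambda>s. y / ((s + y\<^sup>2) * sqrt (s + y\<^sup>2))) has_integral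
           2 * y / sqrt (a + y\<^sup>2) - 2 * y / sqrt (b + y\<^sup>2)) {a..b}"
proof -
  have "((\<lambda>s. y / ((s + y\<^sup>2) * sqrt (s + y\<^sup>2))) has_integral
      - (2 * y / sqrt (b + y\<^sup>2)) - - (2 * y / sqrt (a + y\<^sup>2))) {a..b}"
  proof (rule fundamental_theorem_of_calculus[OF assms(3)])
    fix s assume "s \<in> {a..b}"
    then have s: "s + y\<^sup>2 > 0" using assms by (simp add: add_nonneg_pos)
    then have "((\<lambda>s. - (2 * y / sqrt (s + y\<^sup>2))) has_real_derivative
        y / ((s + y\<^sup>2) * sqrt (s + y\<^sup>2))) (at s within {a..b})"
      by (auto intro!: derivative_eq_intros simp: field_simps)
    then show "((\<lambda>s. - (2 * y / sqrt (s + y\<^sup>2))) has_vector_derivative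
        y / ((s + y\<^sup>2) * sqrt (s + y\<^sup>2))) (at s within {a..b})"
      by (simp add: has_real_derivative_iff_has_vector_derivative)
  qed
  then show ?thesis by simp
qed

section \<open>The unit step response and its initial value\<close>

text \<open>The solution of the heat equation on \<open>(0,\<pi>)\<close> with boundary values \<open>1\<close> and \<open>0\<close> and initial
  value \<open>0\<close>, and its integral over \<open>[y,\<pi>]\<close>.\<close>

definition step_response :: "real \<Rightarrow> real \<Rightarrow> real" where
  "step_response y s = 1 - y / pi - 2 / pi * heat_series (- 1) y s"

definition step_response_tail :: "real \<Rightarrow> real \<Rightarrow> real" where
  "step_response_tail y s
     = (pi - y)\<^sup>2 / (2 * pi) + 2 / pi * (heat_series (- 2) y s - heat_series (- 2) pi s)"

text \<open>j = -2 is the largest index whose coefficients are summable without damping. This is why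
  the tail can be followed down to s = 0 directly, while \<open>step_response\<close> needs a
  detour.\<close>

lemma continuous_on_heat_series_minus_2:
  "continuous_on (UNIV \<times> {0..}) (\<lambda>(y, s). heat_series (- 2) y s)"
proof (rule continuous_on_heat_series_majorized)
  show "summable (\<lambda>n. inverse (real (Suc n) ^ 2))"
    using summable_ignore_initial_segment[OF inverse_power_summable[of 2, where 'a=real], of 1] by simp
  fix n :: nat and y s :: real assume "(y, s) \<in> UNIV \<times> {0..}"
  then have "\<bar>heat_term (- 2) n y s\<bar> \<le> heat_majorant (- 2) 0 n"
    by (intro heat_term_le_majorant) auto
  then show "\<bar>heat_term (- 2) n y s\<bar> \<le> inverse (real (Suc n) ^ 2)"
    by (simp add: heat_majorant_def power_int_minus power_int_numeral del: of_nat_Suc)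
qed

text \<open>At s = 0 the series with j = -2 equals - pi^2/6 at y = 0 and pi^2/12 at y = pi; weighted
  by 2/pi, the difference cancels the polynomial part pi/2.\<close>

lemma step_response_tail_corner: "step_response_tail 0 0 = 0"
proof -
  have b: "(\<lambda>n. 1 / real (Suc n) ^ 2) sums (pi\<^sup>2 / 6)"
    using inverse_squares_sums by (simp add: add.commute)
  have "(\<lambda>n. - (1 / real (Suc n) ^ 2)) sums (- (pi\<^sup>2 / 6))" by (rule sums_minus[OF b])
  moreover have "heat_term (- 2) n 0 0 = - (1 / real (Suc n) ^ 2)" for n
    by (simp add: heat_term_def power_int_minus power_int_numeral inverse_eq_divide del: of_nat_Suc)
  ultimately have 0: "heat_series (- 2) 0 0 = - (pi\<^sup>2 / 6)"
    by (simp add: heat_series_def sums_unique[symmetric] del: of_nat_Suc)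
  have p: "heat_term (- 2) n pi 0 = - ((- 1) ^ Suc n / real (Suc n) ^ 2)" for n
  proof -
    have 1: "cos (real (Suc n) * pi - pi) = - ((- 1) ^ Suc n)"
      by (simp only: cos_diff cos_pi sin_pi cos_npi)
    have 2: "real (Suc n) * pi + of_int (- 2) * (pi / 2) = real (Suc n) * pi - pi" by simp
    show ?thesis
      unfolding heat_term_def 2 1
      by (simp add: power_int_minus power_int_numeral divide_inverse del: of_nat_Suc power_Suc)
  qed
  \<comment> \<open>\<open>g\<close> doubles the terms 1/N^2 with even N and kills the odd ones, so
    its sum is half of pi^2/6; subtracting it from 1/N^2 produces the alternating series at y =
    pi.\<close>
  define g where "g = (\<lambda>n. (1 + (- 1) ^ Suc n) / real (Suc n) ^ 2)"
  have "(\<lambda>n. 1 / 2 * (1 / real (Suc n) ^ 2)) sums (1 / 2 * (pi\<^sup>2 / 6))" by (rule sums_mult[OF b])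
  moreover have "g (2 * n + 1) = 1 / 2 * (1 / real (Suc n) ^ 2)" for n
  proof -
    have "Suc (2 * n + 1) = 2 * Suc n" by simp
    then have "g (2 * n + 1) = (1 + (- 1) ^ (2 * Suc n)) / real (2 * Suc n) ^ 2"
      unfolding g_def by metis
    also have "(- 1 :: real) ^ (2 * Suc n) = 1" by (rule power_minus1_even)
    finally have "g (2 * n + 1) = (1 + 1) / real (2 * Suc n) ^ 2" .
    moreover have "real (2 * Suc n) = 2 * real (Suc n)" by (simp only: of_nat_mult of_nat_numeral)
    ultimately show ?thesis by (simp only: power_mult_distrib) (simp del: of_nat_Suc)
  qed
  moreover have "(\<lambda>n. g (2 * n + 1)) sums c \<longleftrightarrow> g sums c" for c
  proof (rule sums_mono_reindex)
    show "strict_mono (\<lambda>n::nat. 2 * n + 1)" by (auto simp: strict_mono_def)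
    fix n :: nat assume "n \<notin> range (\<lambda>n. 2 * n + 1)"
    then have "even n" by (metis oddE rangeI)
    then show "g n = 0" by (simp add: g_def)
  qed
  ultimately have "g sums (1 / 2 * (pi\<^sup>2 / 6))" by simp
  from sums_diff[OF b this]
  have "(\<lambda>n. 1 / real (Suc n) ^ 2 - g n) sums (pi\<^sup>2 / 6 - 1 / 2 * (pi\<^sup>2 / 6))" .
  moreover have "1 / real (Suc n) ^ 2 - g n = heat_term (- 2) n pi 0" for n
    unfolding p g_def by (simp add: diff_divide_distrib[symmetric] del: of_nat_Suc power_Suc)
  ultimately have "heat_series (- 2) pi 0 = pi\<^sup>2 / 12"
    by (simp add: heat_series_def sums_unique[symmetric] del: of_nat_Suc)
  with 0 show ?thesis by (simp add: step_response_tail_def field_simps power2_eq_square)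
qed

lemma step_response_pi: "step_response pi s = 0"
proof -
  have "heat_term (- 1) n pi s = 0" for n
  proof -
    have "cos (real (Suc n) * pi + of_int (- 1) * (pi / 2)) = 0"
      by (simp add: cos_diff del: of_nat_Suc)
    then show ?thesis by (simp add: heat_term_def del: of_nat_Suc)
  qed
  then show ?thesis by (simp add: step_response_def heat_series_def)
qed

text \<open>Expansion at y = pi, in both cases down to \<open>heat_series 1\<close>, whose decay as
  s tends to 0 is known away from y = 0. Both functions vanish at pi, so a single unknown function
  of s remains, the coefficient \<open>1 / pi + 2 / pi * heat_series 0 pi s\<close>. The tail
  determines its limit, and it in turn determines that of the step response.\<close>

lemma step_response_taylor:
  assumes "0 < y" "y < pi" "s > 0"
  obtains t u where "y < t" "t < pi" "y < u" "u < pi"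
    "step_response y s = (1 / pi + 2 / pi * heat_series 0 pi s) * (pi - y)
       - heat_series 1 t s / pi * (pi - y)\<^sup>2"
    "step_response_tail y s = (1 / pi + 2 / pi * heat_series 0 pi s) / 2 * (pi - y)\<^sup>2
       - heat_series 1 u s / (3 * pi) * (pi - y) ^ 3"
proof -
  \<comment> \<open>The list holds the tail and its successive derivatives in y; the second entry is
    negative because the tail integrates from y up to pi.\<close>
  define d where "d = (\<lambda>m y. [step_response_tail y s, - step_response y s,
    1 / pi + 2 / pi * heat_series 0 y s, 2 / pi * heat_series 1 y s] ! m)"
  have d: "((\<lambda>y. d m y) has_real_derivative d (Suc m) x) (at x)" if "m < 3" for m x
  proof -
    note D = heat_series_has_derivative_space[OF assms(3)]
    from that consider "m = 0" | "m = 1" | "m = 2" by linarith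
    then show ?thesis
    proof cases
      case 1
      then show ?thesis using D[of "-2" x]
        by (auto simp: d_def step_response_tail_def step_response_def field_simps power2_eq_square
            intro!: derivative_eq_intros)
    next
      case 2
      then show ?thesis using D[of "-1" x]
        by (auto simp: d_def step_response_def numeral_2_eq_2 intro!: derivative_eq_intros)
    next
      case 3
      then show ?thesis using D[of 0 x]
        by (auto simp: d_def numeral_3_eq_3 numeral_2_eq_2 intro!: derivative_eq_intros)
    qed
  qed
  have d0: "d 0 pi = 0" "d 1 pi = 0"
    by (simp_all add: d_def step_response_tail_def step_response_pi)
  obtain u where u: "y < u" "u < pi" "d 0 y = (\<Sum>m<3. d m pi / fact m * (y - pi) ^ m) + d 3 u / fact 3 * (y - pi) ^ 3"
    using Taylor_down[of 3 d "d 0" y pi pi] d assms by auto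
  obtain t where t: "y < t" "t < pi" "d 1 y = (\<Sum>m<2. d (Suc m) pi / fact m * (y - pi) ^ m) + d (Suc 2) t / fact 2 * (y - pi) ^ 2"
    using Taylor_down[of 2 "\<lambda>m. d (Suc m)" "d 1" y pi pi] d assms by auto
  show thesis
  proof (rule that[of t u])
    have "d 1 y = d 2 pi * (y - pi) + d 3 t / 2 * (y - pi) ^ 2"
      using t(3) d0 by (simp add: eval_nat_numeral)
    then show "step_response y s = (1 / pi + 2 / pi * heat_series 0 pi s) * (pi - y)
       - heat_series 1 t s / pi * (pi - y)\<^sup>2"
      by (simp add: d_def numeral_2_eq_2 numeral_3_eq_3) (simp add: field_simps power2_eq_square)
    have "d 0 y = d 2 pi / 2 * (y - pi) ^ 2 + d 3 u / 6 * (y - pi) ^ 3"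
      using u(3) d0 by (simp add: eval_nat_numeral)
    then show "step_response_tail y s = (1 / pi + 2 / pi * heat_series 0 pi s) / 2 * (pi - y)\<^sup>2
       - heat_series 1 u s / (3 * pi) * (pi - y) ^ 3"
      by (simp add: d_def numeral_2_eq_2 numeral_3_eq_3) (simp add: field_simps power2_eq_square)
  qed (use t u in auto)
qed

lemma continuous_on_step_response_tail:
  "continuous_on (UNIV \<times> {0..}) (\<lambda>(y, s). step_response_tail y s)"
proof -
  have "continuous_on (UNIV \<times> {0..}) (\<lambda>p. (\<lambda>(y, s). heat_series (- 2) y s) (pi, snd p :: real))"
    by (rule continuous_on_compose2[OF continuous_on_heat_series_minus_2])
       (auto intro!: continuous_intros)
  then show ?thesis
    using continuous_on_heat_series_minus_2 unfolding step_response_tail_def case_prod_beta'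
    by (intro continuous_intros) auto
qed

text \<open>The point moves with s because the intermediate points of Taylor's formula do; that they
  stay to the right of y keeps the factor 1 / y^8 uniform.\<close>

lemma heat_series_1_tendsto_0:
  assumes "0 < y" "\<And>s. y < t s" "\<And>s. t s \<le> pi"
  shows "((\<lambda>s. heat_series 1 (t s) s) \<longlongrightarrow> 0) (at_right 0)"
proof -
  obtain C where C: "C \<ge> 0"
    "\<And>y s. 0 < y \<Longrightarrow> y \<le> pi \<Longrightarrow> 0 < s \<Longrightarrow> s \<le> 1 \<Longrightarrow> \<bar>heat_series 1 y s\<bar> \<le> C * s\<^sup>2 / y ^ 8"
    using heat_series_decay_low_order[of 1 1] by auto
  have le: "\<forall>\<^sub>F s in at_right 0. norm (heat_series 1 (t s) s) \<le> C * s\<^sup>2 / y ^ 8"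
    unfolding eventually_at_right_field
  proof (intro exI[of _ 1] conjI allI impI)
    fix s :: real assume s: "0 < s" "s < 1"
    have "norm (heat_series 1 (t s) s) \<le> C * s\<^sup>2 / t s ^ 8"
      using C(2)[of "t s" s] assms(1) assms(2,3)[of s] s by auto
    also have "\<dots> \<le> C * s\<^sup>2 / y ^ 8"
      using assms(1) assms(2)[of s] C(1)
      by (intro divide_left_mono power_mono mult_pos_pos zero_less_power) auto
    finally show "norm (heat_series 1 (t s) s) \<le> C * s\<^sup>2 / y ^ 8" .
  qed simp
  have "((\<lambda>s. C * s\<^sup>2 / y ^ 8) \<longlongrightarrow> C * 0\<^sup>2 / y ^ 8) (at_right 0)"
    using assms(1) by (intro tendsto_intros) auto
  then have "((\<lambda>s. C * s\<^sup>2 / y ^ 8) \<longlongrightarrow> 0) (at_right 0)" by simp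
  with le show ?thesis by (rule Lim_null_comparison)
qed

text \<open>Continuity of the tail at s = 0 gives the Taylor coefficient \<open>\<mu>\<close> a
  limit expressed through any chosen y. The limit cannot depend on y, so the tail at s = 0 is c/2
  (pi - y)^2; its value 0 at the corner forces c = 0, and \<open>\<mu>\<close> and the step response
  tend to 0. In effect the sine series of 1 - y/pi is summed with Gaussian damping.\<close>

lemma step_response_tendsto_0:
  assumes "0 < y" "y \<le> pi"
  shows "((\<lambda>s. step_response y s) \<longlongrightarrow> 0) (at_right 0)"
proof -
  define \<mu> where "\<mu> s = 1 / pi + 2 / pi * heat_series 0 pi s" for s
  have taylor: "\<forall>s>0. \<exists>t u. y < t \<and> t < pi \<and> y < u \<and> u < pi \<and>
      step_response y s = \<mu> s * (pi - y) - heat_series 1 t s / pi * (pi - y)\<^sup>2 \<and>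
      step_response_tail y s = \<mu> s / 2 * (pi - y)\<^sup>2 - heat_series 1 u s / (3 * pi) * (pi - y) ^ 3"
    if "0 < y" "y < pi" for y
  proof (intro allI impI)
    fix s :: real assume "s > 0"
    show "\<exists>t u. y < t \<and> t < pi \<and> y < u \<and> u < pi \<and>
      step_response y s = \<mu> s * (pi - y) - heat_series 1 t s / pi * (pi - y)\<^sup>2 \<and>
      step_response_tail y s = \<mu> s / 2 * (pi - y)\<^sup>2 - heat_series 1 u s / (3 * pi) * (pi - y) ^ 3"
      unfolding \<mu>_def by (rule step_response_taylor[OF that \<open>s > 0\<close>]) blast
  qed
  have tail_lim: "((\<lambda>s. step_response_tail y s) \<longlongrightarrow> step_response_tail y 0) (at_right 0)" for y
  proof -
    have "continuous_on {0..} (\<lambda>s. (\<lambda>(y, s). step_response_tail y s) (y, s))"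
      by (rule continuous_on_compose2[OF continuous_on_step_response_tail]) (auto intro!: continuous_intros)
    then have "((\<lambda>s. step_response_tail y s) \<longlongrightarrow> step_response_tail y 0) (at 0 within {0..})"
      by (auto simp: continuous_on_def)
    then show ?thesis by (rule tendsto_within_subset) auto
  qed
  have \<mu>_lim: "(\<mu> \<longlongrightarrow> 2 * step_response_tail y 0 / (pi - y)\<^sup>2) (at_right 0)" if y: "0 < y" "y < pi" for y
  proof -
    obtain u where u: "\<And>s. s > 0 \<Longrightarrow> y < u s \<and> u s < pi \<and>
      step_response_tail y s = \<mu> s / 2 * (pi - y)\<^sup>2 - heat_series 1 (u s) s / (3 * pi) * (pi - y) ^ 3"
      using taylor[OF y] by metis
    \<comment> \<open>For s <= 0 the value pi is a placeholder: the limit lemma asks for the bounds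
      at every s.\<close>
    define u' where "u' s = (if s > 0 then u s else pi)" for s
    have u': "y < u' s" "u' s \<le> pi" for s using u[of s] y by (auto simp: u'_def)
    have lim: "((\<lambda>s. 2 * (step_response_tail y s + heat_series 1 (u' s) s / (3 * pi) * (pi - y) ^ 3) / (pi - y)\<^sup>2)
        \<longlongrightarrow> 2 * (step_response_tail y 0 + 0 / (3 * pi) * (pi - y) ^ 3) / (pi - y)\<^sup>2) (at_right 0)"
      using y by (intro tendsto_intros tail_lim heat_series_1_tendsto_0[OF y(1) u']) auto
    have "\<forall>\<^sub>F s in at_right 0. 2 * (step_response_tail y s + heat_series 1 (u' s) s / (3 * pi) * (pi - y) ^ 3) / (pi - y)\<^sup>2 = \<mu> s"
      unfolding eventually_at_right_field
    proof (intro exI[of _ 1] conjI allI impI)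
      fix s :: real assume "0 < s" "s < 1"
      then show "2 * (step_response_tail y s + heat_series 1 (u' s) s / (3 * pi) * (pi - y) ^ 3) / (pi - y)\<^sup>2 = \<mu> s"
        using u[of s] y by (simp add: u'_def)
    qed simp
    from Lim_transform_eventually[OF lim this] show ?thesis by simp
  qed
  define c where "c = 2 * step_response_tail 1 0 / (pi - 1)\<^sup>2"
  have pi: "1 < pi" using pi_gt3 by simp
  have quad: "step_response_tail y 0 = c / 2 * (pi - y)\<^sup>2" if y: "0 < y" "y < pi" for y
  proof -
    have "2 * step_response_tail y 0 / (pi - y)\<^sup>2 = c"
      unfolding c_def by (rule tendsto_unique[OF _ \<mu>_lim[OF y] \<mu>_lim[OF zero_less_one pi]]) simp
    then show ?thesis using y by (simp add: field_simps)
  qed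
  have "c = 0"
  proof -
    have "continuous_on UNIV (\<lambda>y. (\<lambda>(y, s). step_response_tail y s) (y, 0))"
      by (rule continuous_on_compose2[OF continuous_on_step_response_tail]) (auto intro!: continuous_intros)
    then have "((\<lambda>y. step_response_tail y 0) \<longlongrightarrow> step_response_tail 0 0) (at 0)"
      by (auto simp: continuous_on_def)
    then have l1: "((\<lambda>y. step_response_tail y 0) \<longlongrightarrow> 0) (at_right 0)"
      unfolding step_response_tail_corner by (rule tendsto_within_subset) auto
    have l2: "((\<lambda>y. c / 2 * (pi - y)\<^sup>2) \<longlongrightarrow> c / 2 * (pi - 0)\<^sup>2) (at_right 0)"
      by (intro tendsto_intros)
    have "\<forall>\<^sub>F y in at_right 0. c / 2 * (pi - y)\<^sup>2 = step_response_tail y 0"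
      unfolding eventually_at_right_field by (rule exI[of _ pi]) (auto simp: quad)
    from Lim_transform_eventually[OF l2 this] have "c / 2 * (pi - 0)\<^sup>2 = 0"
      using l1 by (intro tendsto_unique[of "at_right 0"]) auto
    then show ?thesis by simp
  qed
  then have \<mu>0: "(\<mu> \<longlongrightarrow> 0) (at_right 0)"
    using \<mu>_lim[OF zero_less_one pi] by (simp only: c_def)
  show ?thesis
  proof (cases "y = pi")
    case True
    then show ?thesis by (simp add: step_response_pi)
  next
    case False
    then have y: "0 < y" "y < pi" using assms by auto
    obtain t where t: "\<And>s. s > 0 \<Longrightarrow> y < t s \<and> t s < pi \<and>
      step_response y s = \<mu> s * (pi - y) - heat_series 1 (t s) s / pi * (pi - y)\<^sup>2"
      using taylor[OF y] by metis
    define t' where "t' s = (if s > 0 then t s else pi)" for s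
    have t': "y < t' s" "t' s \<le> pi" for s using t[of s] y by (auto simp: t'_def)
    have lim: "((\<lambda>s. \<mu> s * (pi - y) - heat_series 1 (t' s) s / pi * (pi - y)\<^sup>2)
        \<longlongrightarrow> 0 * (pi - y) - 0 / pi * (pi - y)\<^sup>2) (at_right 0)"
      using y by (intro tendsto_intros \<mu>0 heat_series_1_tendsto_0[OF y(1) t']) auto
    have "\<forall>\<^sub>F s in at_right 0. \<mu> s * (pi - y) - heat_series 1 (t' s) s / pi * (pi - y)\<^sup>2 = step_response y s"
      unfolding eventually_at_right_field
      by (rule exI[of _ 1]) (auto simp: t'_def t)
    from Lim_transform_eventually[OF lim this] show ?thesis by simp
  qed
qed

section \<open>The extension by zero, its total mass in time\<close>

text \<open>For \<open>j \<in> {1, 2, 3}\<close> the extension by \<open>0\<close> to \<open>s \<le> 0\<close> stays smooth away from \<open>y = 0\<close>.\<close>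

definition heat_ext :: "int \<Rightarrow> real \<Rightarrow> real \<Rightarrow> real" where
  "heat_ext j y s = (if s > 0 then heat_series j y s else 0)"

lemma heat_ext_decay:
  assumes "H > 0" "j \<in> {1, 2, 3}"
  obtains C where "C \<ge> 0"
    "\<And>y s. 0 < y \<Longrightarrow> y \<le> pi \<Longrightarrow> s \<le> H \<Longrightarrow> \<bar>heat_ext j y s\<bar> \<le> C * (max 0 s)\<^sup>2 / y ^ 8"
proof -
  obtain C where "C \<ge> 0"
    "\<And>y s. 0 < y \<Longrightarrow> y \<le> pi \<Longrightarrow> 0 < s \<Longrightarrow> s \<le> H \<Longrightarrow> \<bar>heat_series j y s\<bar> \<le> C * s\<^sup>2 / y ^ 8"
    using heat_series_decay_low_order[OF assms] by blast
  then show thesis by (intro that[of C]) (auto simp: heat_ext_def)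
qed

text \<open>For s > 0 this is continuity of the series; at a point with s <= 0 the quadratic bound
  squeezes the function to 0, since y^8 stays away from 0 nearby.\<close>

lemma continuous_on_heat_ext:
  assumes "j \<in> {1, 2, 3}"
  shows "continuous_on ({0<..pi} \<times> UNIV) (\<lambda>(y, s). heat_ext j y s)"
  unfolding continuous_on_def
proof (intro ballI)
  let ?S = "{0<..pi} \<times> (UNIV :: real set)"
  let ?F = "\<lambda>(y, s). heat_ext j y s"
  fix p :: "real \<times> real" assume p: "p \<in> ?S"
  show "(?F \<longlongrightarrow> ?F p) (at p within ?S)"
  proof (cases "snd p > 0")
    case True
    have op: "open (UNIV \<times> {0<..} :: (real \<times> real) set)" by (intro open_Times) auto
    have "continuous_on (UNIV \<times> {0<..}) ?F"
      using continuous_on_heat_series[of j]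
      by (rule continuous_on_cong[THEN iffD1, rotated -1]) (auto simp: heat_ext_def)
    moreover have "p \<in> UNIV \<times> {0<..}" using True by (simp add: mem_Times_iff)
    ultimately have "isCont ?F p" using op continuous_on_eq_continuous_at by blast
    then show ?thesis by (auto simp: isCont_def intro: tendsto_within_subset)
  next
    case False
    obtain C where C: "C \<ge> 0"
      "\<And>y s. 0 < y \<Longrightarrow> y \<le> pi \<Longrightarrow> s \<le> 1 \<Longrightarrow> \<bar>heat_ext j y s\<bar> \<le> C * (max 0 s)\<^sup>2 / y ^ 8"
      using heat_ext_decay[OF zero_less_one assms] by blast
    have "\<forall>\<^sub>F q in at p within ?S. snd q < 1"
      using False by (intro order_tendstoD(2)[of snd "snd p"] tendsto_intros) auto
    moreover have "\<forall>\<^sub>F q in at p within ?S. q \<in> ?S" by (simp add: eventually_at_filter)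
    ultimately have le: "\<forall>\<^sub>F q in at p within ?S. norm (?F q) \<le> C * (max 0 (snd q))\<^sup>2 / fst q ^ 8"
      by eventually_elim (auto intro!: C)
    have "((\<lambda>q. C * (max 0 (snd q))\<^sup>2 / fst q ^ 8) \<longlongrightarrow> C * (max 0 (snd p))\<^sup>2 / fst p ^ 8) (at p within ?S)"
      using p by (intro tendsto_intros) auto
    moreover have "C * (max 0 (snd p))\<^sup>2 / fst p ^ 8 = 0" using False by simp
    ultimately have "((\<lambda>q. C * (max 0 (snd q))\<^sup>2 / fst q ^ 8) \<longlongrightarrow> 0) (at p within ?S)" by metis
    with le have "(?F \<longlongrightarrow> 0) (at p within ?S)" by (rule Lim_null_comparison)
    moreover have "?F p = 0" using False by (simp add: heat_ext_def case_prod_beta')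
    ultimately show ?thesis by simp
  qed
qed

lemma heat_ext_has_derivative_space:
  "((\<lambda>y. heat_ext j y s) has_real_derivative heat_ext (j + 1) y s) (at y)"
  by (cases "s > 0") (auto simp: heat_ext_def heat_series_has_derivative_space)

lemma heat_ext_1_has_derivative_time:
  assumes "0 < y" "y \<le> pi"
  shows "((\<lambda>s. heat_ext 1 y s) has_real_derivative heat_ext 3 y s) (at s)"
proof -
  consider "s > 0" | "s < 0" | "s = 0" by linarith
  then show ?thesis
  proof cases
    case 1
    have "((\<lambda>s. heat_series 1 y s) has_real_derivative heat_series 3 y s) (at s)"
      using heat_series_has_derivative_time[OF 1, of 1] by simp
    then have "((\<lambda>s. heat_ext 1 y s) has_real_derivative heat_series 3 y s) (at s)"
      by (rule has_field_derivative_transform_within_open[of _ _ _ "{0<..}"])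
         (use 1 in \<open>auto simp: heat_ext_def\<close>)
    with 1 show ?thesis by (simp add: heat_ext_def)
  next
    case 2
    have "((\<lambda>s. heat_ext 1 y s) has_real_derivative 0) (at s)"
      by (rule has_field_derivative_transform_within_open[of "\<lambda>_. 0" _ _ "{..<0}"])
         (use 2 in \<open>auto simp: heat_ext_def\<close>)
    with 2 show ?thesis by (simp add: heat_ext_def)
  next
    case 3
    obtain C where C: "C \<ge> 0"
      "\<And>y s. 0 < y \<Longrightarrow> y \<le> pi \<Longrightarrow> s \<le> 1 \<Longrightarrow> \<bar>heat_ext 1 y s\<bar> \<le> C * (max 0 s)\<^sup>2 / y ^ 8"
      using heat_ext_decay[of 1 1] by auto
    \<comment> \<open>The quadratic bound leaves one power of h in the difference quotient at time
      0.\<close>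
    have "((\<lambda>h. (heat_ext 1 y (0 + h) - heat_ext 1 y 0) / h) \<longlongrightarrow> 0) (at 0)"
    proof (rule Lim_null_comparison)
      have "\<forall>\<^sub>F h in at (0::real). h < 1" by (rule order_tendstoD(2)[OF tendsto_ident_at]) simp
      moreover have "\<forall>\<^sub>F h in at (0::real). h \<noteq> 0" by (simp add: eventually_at_filter)
      ultimately show "\<forall>\<^sub>F h in at 0. norm ((heat_ext 1 y (0 + h) - heat_ext 1 y 0) / h) \<le> C * \<bar>h\<bar> / y ^ 8"
      proof eventually_elim
        case (elim h)
        have "\<bar>heat_ext 1 y h\<bar> \<le> C * (max 0 h)\<^sup>2 / y ^ 8" using C(2)[of y h] assms elim by simp
        also have "\<dots> \<le> C * h\<^sup>2 / y ^ 8"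
          using C(1) assms by (intro divide_right_mono mult_left_mono) (auto simp: max_def)
        finally have "\<bar>heat_ext 1 y h\<bar> / \<bar>h\<bar> \<le> (C * h\<^sup>2 / y ^ 8) / \<bar>h\<bar>"
          by (intro divide_right_mono) auto
        also have "h\<^sup>2 = \<bar>h\<bar> * \<bar>h\<bar>" by (simp add: power2_eq_square)
        also have "C * (\<bar>h\<bar> * \<bar>h\<bar>) / y ^ 8 / \<bar>h\<bar> = C * \<bar>h\<bar> / y ^ 8"
          using elim by (simp del: abs_mult_self_eq)
        finally show ?case by (simp add: heat_ext_def)
      qed
      have "((\<lambda>h. C * \<bar>h\<bar> / y ^ 8) \<longlongrightarrow> C * \<bar>0\<bar> / y ^ 8) (at 0)"
        using assms by (intro tendsto_intros) auto
      then show "((\<lambda>h. C * \<bar>h\<bar> / y ^ 8) \<longlongrightarrow> 0) (at 0)" by simp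
    qed
    moreover have "heat_ext 3 y 0 = 0" by (simp add: heat_ext_def)
    ultimately show ?thesis unfolding 3 DERIV_def by simp
  qed
qed

text \<open>Two steps of the index lead from j = -1 to j = 1, so - (pi/2)
  \<open>step_response\<close> is an antiderivative in time for s > 0. Its limit 0 at s = 0 makes it
  continuous on the closed interval, so the mass is read off at t alone.\<close>

lemma heat_ext_1_has_integral:
  assumes "0 < y" "y \<le> pi" "t > 0"
  shows "(heat_ext 1 y has_integral - (pi / 2) * step_response y t) {0..t}"
proof -
  define F where "F s = (if s > 0 then - (pi / 2) * step_response y s else 0)" for s
  have der: "(F has_real_derivative heat_ext 1 y s) (at s)" if "s > 0" for s
  proof -
    have "((\<lambda>s. - (pi / 2) * step_response y s) has_real_derivative heat_ext 1 y s) (at s)"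
    proof -
      have "((\<lambda>s. heat_series (- 1) y s) has_real_derivative heat_series 1 y s) (at s)"
        using heat_series_has_derivative_time[OF that, of "-1"] by simp
      then have "((\<lambda>s. - (pi / 2) * step_response y s) has_real_derivative
          - (pi / 2) * (0 - 0 - 2 / pi * heat_series 1 y s)) (at s)"
        unfolding step_response_def by (intro DERIV_cmult DERIV_diff DERIV_const)
      then show ?thesis using that by (simp add: heat_ext_def)
    qed
    then show ?thesis
      by (rule has_field_derivative_transform_within_open[of _ _ _ "{0<..}"])
         (use that in \<open>auto simp: F_def\<close>)
  qed
  have "(heat_ext 1 y has_integral F t - F 0) {0..t}"
  proof (rule fundamental_theorem_of_calculus_interior)
    show "continuous_on {0..t} F"
      unfolding continuous_on_def
    proof
      fix s assume s: "s \<in> {0..t}"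
      show "(F \<longlongrightarrow> F s) (at s within {0..t})"
      proof (cases "s = 0")
        case True
        have "((\<lambda>s. - (pi / 2) * step_response y s) \<longlongrightarrow> - (pi / 2) * 0) (at_right 0)"
          by (intro tendsto_intros step_response_tendsto_0 assms)
        moreover have "\<forall>\<^sub>F s in at_right 0. - (pi / 2) * step_response y s = F s"
          by (auto simp: eventually_at_filter F_def)
        ultimately have "(F \<longlongrightarrow> F 0) (at_right 0)"
          by (auto simp: F_def intro: Lim_transform_eventually)
        moreover have "at 0 within {0..t} = at_right 0"
          using assms(3) by (simp add: at_within_Icc_at_right)
        ultimately show ?thesis using True by simp
      next
        case False
        then have "isCont F s" using der[of s] s by (intro DERIV_isCont) auto
        then show ?thesis by (auto simp: isCont_def intro: tendsto_within_subset)
      qed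
    qed
  qed (use assms der in \<open>auto simp: has_real_derivative_iff_has_vector_derivative\<close>)
  with assms(3) show ?thesis by (simp add: F_def)
qed

text \<open>At positive time the series is continuous in y and all its terms vanish at y = 0,
  leaving the 1: the kernel recovers its full mass in the limit.\<close>

lemma step_response_tendsto_1:
  assumes "t > 0"
  shows "((\<lambda>y. step_response y t) \<longlongrightarrow> 1) (at 0)"
proof -
  have "isCont (\<lambda>y. step_response y t) 0"
    unfolding step_response_def
    using DERIV_isCont[OF heat_series_has_derivative_space[OF assms, of "-1"]]
    by (intro continuous_intros) auto
  moreover have "heat_term (- 1) n 0 t = 0" for n by (simp add: heat_term_def)
  then have "step_response 0 t = 1" by (simp add: step_response_def heat_series_def)
  ultimately show ?thesis by (simp add: isCont_def)
qed

section \<open>Convolution in time with a causal kernel\<close>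

text \<open>The kernel carries the time t - s, so derivatives in x and in t fall on the kernel, and
  \<open>\<phi>\<close> enters through its continuity.\<close>

definition time_conv :: "(real \<Rightarrow> real \<Rightarrow> real) \<Rightarrow> (real \<Rightarrow> real) \<Rightarrow> real \<Rightarrow> real \<Rightarrow> real" where
  "time_conv F \<phi> x t = integral {0..t} (\<lambda>s. F x (t - s) * \<phi> s)"

lemma time_conv_reflect: "time_conv F \<phi> x t = integral {0..t} (\<lambda>\<tau>. F x \<tau> * \<phi> (t - \<tau>))"
proof -
  have "integral {- t..0} (\<lambda>x'. F x (t - (x' + t)) * \<phi> (x' + t)) = time_conv F \<phi> x t"
    using integral_shift_real_ivl[of 0 t t "\<lambda>s. F x (t - s) * \<phi> s"] by (simp add: time_conv_def)
  moreover have "integral {- t..0} (\<lambda>x'. F x (- x') * \<phi> (t - - x'))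
      = integral {0..t} (\<lambda>\<tau>. F x \<tau> * \<phi> (t - \<tau>))"
    using Henstock_Kurzweil_Integration.integral_reflect_real[of t 0 "\<lambda>\<tau>. F x \<tau> * \<phi> (t - \<tau>)"] by simp
  ultimately show ?thesis by (simp add: add.commute)
qed

text \<open>Continuity is required across t = 0 as well, which the extended heat kernel satisfies
  for x > 0. The edge x = 0 is left out because mass concentrates there.\<close>

locale causal_kernel =
  fixes L :: real and F :: "real \<Rightarrow> real \<Rightarrow> real"
  assumes cont: "continuous_on ({0<..L} \<times> UNIV) (\<lambda>(x, t). F x t)"
    and causal: "\<And>x t. t \<le> 0 \<Longrightarrow> F x t = 0"
begin

lemma continuous_on_integrand:
  assumes "continuous_on UNIV \<phi>"
  shows "continuous_on (({0<..L} \<times> UNIV) \<times> S) (\<lambda>(p, s). F (fst p) (snd p - s) * \<phi> s)"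
proof -
  have "continuous_on (({0<..L} \<times> UNIV) \<times> S)
      (\<lambda>q. (\<lambda>(x, t). F x t) (fst (fst q), snd (fst q) - snd q) * \<phi> (snd q))"
    by (intro continuous_intros continuous_on_compose2[OF cont] continuous_on_compose2[OF assms])
       auto
  then show ?thesis by (simp add: case_prod_beta')
qed

lemma continuous_on_integrand_section:
  assumes "continuous_on UNIV \<phi>" "x \<in> {0<..L}"
  shows "continuous_on S (\<lambda>s. F x (t - s) * \<phi> s)"
proof -
  have "continuous_on S (\<lambda>s. (\<lambda>(x, t). F x t) (x, t - s) * \<phi> s)"
    using assms(2)
    by (intro continuous_intros continuous_on_compose2[OF cont] continuous_on_compose2[OF assms(1)])
       auto
  then show ?thesis by simp
qed

text \<open>By causality the upper limit of integration may be kept fixed near a given time, so the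
  parameters enter only through the integrand.\<close>

lemma time_conv_eq_integral:
  assumes "continuous_on UNIV \<phi>" "x \<in> {0<..L}" "t \<le> T" "0 \<le> T"
  shows "time_conv F \<phi> x t = integral {0..T} (\<lambda>s. F x (t - s) * \<phi> s)"
proof (cases "t \<ge> 0")
  case True
  have int: "(\<lambda>s. F x (t - s) * \<phi> s) integrable_on {0..T}"
    by (intro integrable_continuous_interval continuous_on_integrand_section assms)
  have "integral {0..t} (\<lambda>s. F x (t - s) * \<phi> s) + integral {t..T} (\<lambda>s. F x (t - s) * \<phi> s)
      = integral {0..T} (\<lambda>s. F x (t - s) * \<phi> s)"
    using True assms(3) by (intro Henstock_Kurzweil_Integration.integral_combine int) auto
  moreover have "integral {t..T} (\<lambda>s. F x (t - s) * \<phi> s) = integral {t..T} (\<lambda>s. 0)"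
    by (intro integral_cong) (auto simp: causal)
  ultimately show ?thesis by (simp add: time_conv_def)
next
  case False
  then have "integral {0..T} (\<lambda>s. F x (t - s) * \<phi> s) = integral {0..T} (\<lambda>s. 0)"
    by (intro integral_cong) (auto simp: causal)
  with False show ?thesis by (simp add: time_conv_def)
qed

lemma continuous_on_time_conv:
  assumes "continuous_on UNIV \<phi>"
  shows "continuous_on ({0<..L} \<times> UNIV) (\<lambda>(x, t). time_conv F \<phi> x t)"
  unfolding continuous_on_def
proof
  let ?G = "\<lambda>(x, t). time_conv F \<phi> x t"
  fix p :: "real \<times> real" assume p: "p \<in> {0<..L} \<times> UNIV"
  define T where "T = \<bar>snd p\<bar> + 1"
  let ?S = "{0<..L} \<times> {..<T}"
  have "continuous_on ?S (\<lambda>p. integral (cbox 0 T) (\<lambda>s. F (fst p) (snd p - s) * \<phi> s))"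
    by (rule integral_continuous_on_param)
       (rule continuous_on_subset[OF continuous_on_integrand[OF assms]], auto)
  then have "continuous_on ?S ?G"
    by (rule continuous_on_cong[THEN iffD1, rotated -1])
       (auto simp: T_def time_conv_eq_integral[OF assms, of _ _ T, unfolded T_def] )
  then have "(?G \<longlongrightarrow> ?G p) (at p within ?S)"
    using p by (auto simp: continuous_on_def T_def)
  moreover have "at p within ?S = at p within {0<..L} \<times> UNIV"
    by (rule at_within_nhd[of p "UNIV \<times> {..<T}"]) (use p in \<open>auto simp: T_def open_Times mem_Times_iff\<close>)
  ultimately show "(?G \<longlongrightarrow> ?G p) (at p within {0<..L} \<times> UNIV)" by simp
qed

end

lemma time_conv_has_derivative_space:
  assumes F: "causal_kernel L F" and F': "causal_kernel L F'"
    and der: "\<And>x t. x \<in> {0<..<L} \<Longrightarrow> ((\<lambda>y. F y t) has_real_derivative F' x t) (at x)"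
    and \<phi>: "continuous_on UNIV \<phi>" and x: "x \<in> {0<..<L}"
  shows "((\<lambda>y. time_conv F \<phi> y t) has_real_derivative time_conv F' \<phi> x t) (at x)"
proof -
  interpret F: causal_kernel L F by (rule F)
  interpret F': causal_kernel L F' by (rule F')
  have "((\<lambda>y. integral (cbox 0 t) (\<lambda>s. F y (t - s) * \<phi> s)) has_real_derivative
      integral (cbox 0 t) (\<lambda>s. F' x (t - s) * \<phi> s)) (at x within {0<..<L})"
  proof (rule leibniz_rule_field_derivative[where U = "{0<..<L}"])
    show "((\<lambda>y. F y (t - s) * \<phi> s) has_real_derivative F' y (t - s) * \<phi> s) (at y within {0<..<L})"
      if "y \<in> {0<..<L}" for y s
      by (intro DERIV_cmult_right has_field_derivative_at_within[OF der[OF that]])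
    show "(\<lambda>s. F y (t - s) * \<phi> s) integrable_on cbox 0 t" if "y \<in> {0<..<L}" for y
      unfolding cbox_interval using that
      by (intro integrable_continuous_interval F.continuous_on_integrand_section \<phi>) auto
    have "continuous_on ({0<..<L} \<times> cbox 0 t) (\<lambda>q. (\<lambda>(x, t). F' x t) (fst q, t - snd q) * \<phi> (snd q))"
      by (intro continuous_intros continuous_on_compose2[OF F'.cont] continuous_on_compose2[OF \<phi>]) auto
    then show "continuous_on ({0<..<L} \<times> cbox 0 t) (\<lambda>(y, s). F' y (t - s) * \<phi> s)"
      by (simp add: case_prod_beta')
  qed (use x in auto)
  moreover have "at x within {0<..<L} = at x" using x by (intro at_within_open) auto
  ultimately show ?thesis by (simp add: time_conv_def)
qed

text \<open>With the upper limit frozen at T beyond t no boundary term arises; the one that a moving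
  limit would produce contains \<open>F x 0\<close>, which is zero by causality.\<close>

lemma time_conv_has_derivative_time:
  assumes F: "causal_kernel L F" and F': "causal_kernel L F'"
    and der: "\<And>t. ((\<lambda>s. F x s) has_real_derivative F' x t) (at t)"
    and \<phi>: "continuous_on UNIV \<phi>" and x: "x \<in> {0<..L}"
  shows "((\<lambda>t. time_conv F \<phi> x t) has_real_derivative time_conv F' \<phi> x t) (at t)"
proof -
  interpret F: causal_kernel L F by (rule F)
  interpret F': causal_kernel L F' by (rule F')
  define T where "T = \<bar>t\<bar> + 1"
  have T: "t < T" "0 \<le> T" by (auto simp: T_def)
  have "((\<lambda>t. integral (cbox 0 T) (\<lambda>s. F x (t - s) * \<phi> s)) has_real_derivative
      integral (cbox 0 T) (\<lambda>s. F' x (t - s) * \<phi> s)) (at t within {..<T})"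
  proof (rule leibniz_rule_field_derivative[where U = "{..<T}"])
    show "((\<lambda>t. F x (t - s) * \<phi> s) has_real_derivative F' x (t - s) * \<phi> s) (at t within {..<T})" for t s
    proof -
      have "((\<lambda>t. t - s) has_real_derivative 1) (at t within {..<T})"
        by (auto intro!: derivative_eq_intros)
      from DERIV_cmult_right[OF DERIV_chain2[OF der this], of "\<phi> s"] show ?thesis by simp
    qed
    show "(\<lambda>s. F x (t - s) * \<phi> s) integrable_on cbox 0 T" for t
      unfolding cbox_interval
      by (intro integrable_continuous_interval F.continuous_on_integrand_section \<phi> x)
    have "continuous_on ({..<T} \<times> cbox 0 T) (\<lambda>q. (\<lambda>(x, t). F' x t) (x, fst q - snd q) * \<phi> (snd q))"
      using x
      by (intro continuous_intros continuous_on_compose2[OF F'.cont] continuous_on_compose2[OF \<phi>]) auto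
    then show "continuous_on ({..<T} \<times> cbox 0 T) (\<lambda>(t, s). F' x (t - s) * \<phi> s)"
      by (simp add: case_prod_beta')
  qed (use T in auto)
  moreover have "at t within {..<T} = at t" using T by (intro at_within_open) auto
  ultimately have "((\<lambda>t. integral {0..T} (\<lambda>s. F x (t - s) * \<phi> s)) has_real_derivative
      integral {0..T} (\<lambda>s. F' x (t - s) * \<phi> s)) (at t)" by simp
  then have "((\<lambda>t. integral {0..T} (\<lambda>s. F x (t - s) * \<phi> s)) has_real_derivative time_conv F' \<phi> x t) (at t)"
    using F'.time_conv_eq_integral[OF \<phi> x, of t T] T by simp
  then show ?thesis
    by (rule has_field_derivative_transform_within_open[of _ _ _ "{..<T}"])
       (use T F.time_conv_eq_integral[OF \<phi> x, of _ T] in auto)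
qed

text \<open>Collects two consequences of the majorant: a pointwise one and, its mass being at most
  2, an integral bound uniform in y and t. Doubling the constant lets one C serve both.\<close>

lemma heat_ext_1_integral_le:
  assumes "S > 0"
  obtains C where "C \<ge> 0"
    "\<And>y s. 0 < y \<Longrightarrow> y \<le> pi \<Longrightarrow> 0 \<le> s \<Longrightarrow> s \<le> S \<Longrightarrow>
       \<bar>heat_ext 1 y s\<bar> \<le> C * (y / ((s + y\<^sup>2) * sqrt (s + y\<^sup>2)))"
    "\<And>y t \<psi> M. 0 < y \<Longrightarrow> y \<le> pi \<Longrightarrow> 0 \<le> t \<Longrightarrow> t \<le> S \<Longrightarrow> continuous_on {0..t} \<psi> \<Longrightarrow>
       (\<And>s. s \<in> {0..t} \<Longrightarrow> \<bar>\<psi> s\<bar> \<le> M) \<Longrightarrow> \<bar>integral {0..t} (\<lambda>s. heat_ext 1 y s * \<psi> s)\<bar> \<le> C * M"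
proof -
  obtain C where C: "C \<ge> 0" "\<And>y s. 0 < y \<Longrightarrow> y \<le> pi \<Longrightarrow> 0 < s \<Longrightarrow> s \<le> S \<Longrightarrow>
       \<bar>heat_series 1 y s\<bar> \<le> C * (y / ((s + y\<^sup>2) * sqrt (s + y\<^sup>2)))"
    using heat_series_1_le[OF assms] by blast
  have le: "\<bar>heat_ext 1 y s\<bar> \<le> C * (y / ((s + y\<^sup>2) * sqrt (s + y\<^sup>2)))"
    if "0 < y" "y \<le> pi" "0 \<le> s" "s \<le> S" for y s
    using C(2)[of y s] that C(1) by (auto simp: heat_ext_def)
  have int: "\<bar>integral {0..t} (\<lambda>s. heat_ext 1 y s * \<psi> s)\<bar> \<le> 2 * C * M"
    if y: "0 < y" "y \<le> pi" and t: "0 \<le> t" "t \<le> S" and \<psi>: "continuous_on {0..t} \<psi>"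
      "\<And>s. s \<in> {0..t} \<Longrightarrow> \<bar>\<psi> s\<bar> \<le> M" for y t \<psi> M
  proof -
    have "continuous_on {0..t} (\<lambda>s. (\<lambda>(y, s). heat_ext 1 y s) (y, s) * \<psi> s)"
      using y by (intro continuous_intros continuous_on_compose2[OF continuous_on_heat_ext[of 1]] \<psi>) auto
    then have i1: "(\<lambda>s. heat_ext 1 y s * \<psi> s) integrable_on {0..t}"
      by (intro integrable_continuous_interval) simp
    have M: "M \<ge> 0" using \<psi>(2)[of 0] t by auto
    note h = has_integral_mult_right[OF has_integral_heat_majorant[OF y(1) order.refl t(1)], of "C * M"]
    have "norm (integral {0..t} (\<lambda>s. heat_ext 1 y s * \<psi> s))
        \<le> integral {0..t} (\<lambda>s. C * M * (y / ((s + y\<^sup>2) * sqrt (s + y\<^sup>2))))"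
    proof (rule integral_norm_bound_integral[OF i1])
      show "(\<lambda>s. C * M * (y / ((s + y\<^sup>2) * sqrt (s + y\<^sup>2)))) integrable_on {0..t}"
        using h by blast
      fix s assume s: "s \<in> {0..t}"
      have "\<bar>heat_ext 1 y s\<bar> * \<bar>\<psi> s\<bar> \<le> C * (y / ((s + y\<^sup>2) * sqrt (s + y\<^sup>2))) * M"
        using s t y C(1) by (intro mult_mono le \<psi>(2)) auto
      then show "norm (heat_ext 1 y s * \<psi> s) \<le> C * M * (y / ((s + y\<^sup>2) * sqrt (s + y\<^sup>2)))"
        by (simp add: abs_mult mult_ac)
    qed
    also have "\<dots> = C * M * (2 - 2 * y / sqrt (t + y\<^sup>2))"
      using integral_unique[OF h] y by simp
    also have "\<dots> \<le> C * M * 2" using C(1) M y t by (intro mult_left_mono) auto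
    finally show ?thesis by simp
  qed
  show thesis
  proof (rule that[of "2 * C"])
    fix y s :: real assume a: "0 < y" "y \<le> pi" "0 \<le> s" "s \<le> S"
    have "C * (y / ((s + y\<^sup>2) * sqrt (s + y\<^sup>2))) \<le> 2 * C * (y / ((s + y\<^sup>2) * sqrt (s + y\<^sup>2)))"
      using a C(1) by (intro mult_right_mono) auto
    with le[OF a] show "\<bar>heat_ext 1 y s\<bar> \<le> 2 * C * (y / ((s + y\<^sup>2) * sqrt (s + y\<^sup>2)))" by linarith
  qed (use C(1) int in auto)
qed

text \<open>\<open>\<psi> s\<close> is split into \<open>\<psi> 0\<close>, weighted by the total
  mass, and an oscillation bounded by \<open>\<epsilon> + K * s\<close>. The factor s absorbs one
  factor s + y^2 of the majorant, and the remaining y / sqrt (s + y^2) has an integral of order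
  y.\<close>

lemma heat_ext_1_approximate_identity:
  assumes "S > 0" and \<psi>: "continuous_on {0..S} \<psi>"
  shows "((\<lambda>y. integral {0..S} (\<lambda>s. heat_ext 1 y s * \<psi> s)) \<longlongrightarrow> - (pi / 2) * \<psi> 0) (at_right 0)"
proof -
  obtain C where C: "C \<ge> 0"
    "\<And>y s. 0 < y \<Longrightarrow> y \<le> pi \<Longrightarrow> 0 \<le> s \<Longrightarrow> s \<le> S \<Longrightarrow>
       \<bar>heat_ext 1 y s\<bar> \<le> C * (y / ((s + y\<^sup>2) * sqrt (s + y\<^sup>2)))"
    using heat_ext_1_integral_le[OF assms(1)] by metis
  obtain M where "\<forall>z\<in>\<psi> ` {0..S}. norm z \<le> M"
    using compact_imp_bounded[OF compact_continuous_image[OF \<psi> compact_Icc]] unfolding bounded_iff by blast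
  then have M: "\<And>s. s \<in> {0..S} \<Longrightarrow> \<bar>\<psi> s\<bar> \<le> M" by simp
  have M0: "M \<ge> 0" using M[of 0] assms(1) by auto
  have cont: "continuous_on {0..S} (\<lambda>s. heat_ext 1 y s)" if "0 < y" "y \<le> pi" for y
  proof -
    have "continuous_on {0..S} (\<lambda>s. (\<lambda>(y, s). heat_ext 1 y s) (y, s))"
      using that by (intro continuous_on_compose2[OF continuous_on_heat_ext[of 1]] continuous_intros) auto
    then show ?thesis by simp
  qed
  have err: "((\<lambda>y. integral {0..S} (\<lambda>s. heat_ext 1 y s * (\<psi> s - \<psi> 0))) \<longlongrightarrow> 0) (at_right 0)"
  proof (rule tendstoI)
    fix e :: real assume e: "e > 0"
    \<comment> \<open>The majorant has mass at most 2, so this choice keeps the first part of the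
      error below e/2; the added 4 covers C = 0.\<close>
    define \<epsilon> where "\<epsilon> = e / (4 * C + 4)"
    have \<epsilon>: "\<epsilon> > 0" "2 * C * \<epsilon> \<le> e / 2" using e C(1) by (auto simp: \<epsilon>_def field_simps)
    obtain \<delta> where \<delta>: "\<delta> > 0" "\<And>s. s \<in> {0..S} \<Longrightarrow> s < \<delta> \<Longrightarrow> \<bar>\<psi> s - \<psi> 0\<bar> \<le> \<epsilon>"
    proof -
      have "0 \<in> {0..S}" using assms(1) by simp
      then obtain \<delta> where "\<delta> > 0" "\<And>s. s \<in> {0..S} \<Longrightarrow> dist s 0 < \<delta> \<Longrightarrow> dist (\<psi> s) (\<psi> 0) < \<epsilon>"
        using \<psi>[unfolded continuous_on_iff] \<epsilon>(1) by meson
      then show thesis by (intro that[of \<delta>]) (fastforce simp: dist_real_def)+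
    qed
    \<comment> \<open>Beyond \<open>\<delta>\<close> the trivial bound 2 M is at most K s; a modulus
      linear in s avoids splitting the integral.\<close>
    define K where "K = 2 * M / \<delta>"
    have K: "K \<ge> 0" using M0 \<delta> by (simp add: K_def)
    have mod: "\<bar>\<psi> s - \<psi> 0\<bar> \<le> \<epsilon> + K * s" if s: "s \<in> {0..S}" for s
    proof (cases "s < \<delta>")
      case True
      have "0 \<le> K * s" using K s by simp
      with \<delta>(2)[OF s True] show ?thesis by linarith
    next
      case False
      have "\<bar>\<psi> s - \<psi> 0\<bar> \<le> 2 * M" using M[OF s] M[of 0] assms(1) by auto
      also have "2 * M = K * \<delta>" using \<delta> by (simp add: K_def)
      also have "\<dots> \<le> K * s" using False K by (intro mult_left_mono) auto
      finally show ?thesis using \<epsilon> by linarith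
    qed
    have bound: "\<bar>integral {0..S} (\<lambda>s. heat_ext 1 y s * (\<psi> s - \<psi> 0))\<bar>
        \<le> e / 2 + 2 * C * K * y * sqrt (S + pi\<^sup>2)" if y: "0 < y" "y \<le> pi" for y
    proof -
      have i: "((\<lambda>s. C * K * (y / sqrt (s + y\<^sup>2))) has_integral
          C * K * (2 * y * sqrt (S + y\<^sup>2) - 2 * y * sqrt (0 + y\<^sup>2))) {0..S}"
      proof (intro has_integral_mult_right fundamental_theorem_of_calculus)
        fix s assume "s \<in> {0..S}"
        then have s: "s + y\<^sup>2 > 0" using y by (simp add: add_nonneg_pos)
        then have "((\<lambda>s. 2 * y * sqrt (s + y\<^sup>2)) has_real_derivative y / sqrt (s + y\<^sup>2)) (at s within {0..S})"
          by (auto intro!: derivative_eq_intros simp: field_simps)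
        then show "((\<lambda>s. 2 * y * sqrt (s + y\<^sup>2)) has_vector_derivative y / sqrt (s + y\<^sup>2)) (at s within {0..S})"
          by (simp add: has_real_derivative_iff_has_vector_derivative)
      qed (use assms(1) in auto)
      note h = has_integral_add[OF has_integral_mult_right[OF
          has_integral_heat_majorant[OF y(1) order.refl less_imp_le[OF assms(1)]], of "C * \<epsilon>"] i]
      have "norm (integral {0..S} (\<lambda>s. heat_ext 1 y s * (\<psi> s - \<psi> 0)))
          \<le> integral {0..S} (\<lambda>s. C * \<epsilon> * (y / ((s + y\<^sup>2) * sqrt (s + y\<^sup>2))) + C * K * (y / sqrt (s + y\<^sup>2)))"
      proof (rule integral_norm_bound_integral)
        show "(\<lambda>s. heat_ext 1 y s * (\<psi> s - \<psi> 0)) integrable_on {0..S}"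
          by (intro integrable_continuous_interval continuous_intros cont y \<psi>)
        show "(\<lambda>s. C * \<epsilon> * (y / ((s + y\<^sup>2) * sqrt (s + y\<^sup>2))) + C * K * (y / sqrt (s + y\<^sup>2))) integrable_on {0..S}"
          using h by blast
        fix s assume s: "s \<in> {0..S}"
        then have pos: "s + y\<^sup>2 > 0" using y by (simp add: add_nonneg_pos)
        have "\<bar>heat_ext 1 y s\<bar> * \<bar>\<psi> s - \<psi> 0\<bar>
            \<le> C * (y / ((s + y\<^sup>2) * sqrt (s + y\<^sup>2))) * (\<epsilon> + K * s)"
          using s y C(1) by (intro mult_mono C(2) mod) auto
        also have "\<dots> \<le> C * (y / ((s + y\<^sup>2) * sqrt (s + y\<^sup>2))) * (\<epsilon> + K * (s + y\<^sup>2))"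
          using s y C(1) K by (intro mult_left_mono add_left_mono) auto
        also have "\<dots> = C * \<epsilon> * (y / ((s + y\<^sup>2) * sqrt (s + y\<^sup>2))) + C * K * (y / sqrt (s + y\<^sup>2))"
        proof -
          have 1: "C * m * (\<epsilon> + K * a) = C * \<epsilon> * m + C * K * (m * a)" for a m
            by (simp add: algebra_simps)
          have "y / (a * r) * a = y / r" if "a > 0" for a r :: real using that by simp
          note 2 = this[OF pos, of "sqrt (s + y\<^sup>2)"]
          show ?thesis by (simp only: 1 2)
        qed
        finally show "norm (heat_ext 1 y s * (\<psi> s - \<psi> 0))
            \<le> C * \<epsilon> * (y / ((s + y\<^sup>2) * sqrt (s + y\<^sup>2))) + C * K * (y / sqrt (s + y\<^sup>2))"
          by (simp add: abs_mult)
      qed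
      also have "\<dots> = C * \<epsilon> * (2 * y / sqrt (0 + y\<^sup>2) - 2 * y / sqrt (S + y\<^sup>2))
          + C * K * (2 * y * sqrt (S + y\<^sup>2) - 2 * y * sqrt (0 + y\<^sup>2))"
        by (rule integral_unique[OF h])
      also have "\<dots> \<le> C * \<epsilon> * 2 + C * K * (2 * y * sqrt (S + pi\<^sup>2))"
      proof (intro add_mono mult_left_mono)
        show "2 * y / sqrt (0 + y\<^sup>2) - 2 * y / sqrt (S + y\<^sup>2) \<le> 2" using y assms(1) by simp
        have "sqrt (S + y\<^sup>2) \<le> sqrt (S + pi\<^sup>2)" using y by (simp add: power_mono)
        then have "2 * y * sqrt (S + y\<^sup>2) \<le> 2 * y * sqrt (S + pi\<^sup>2)" using y by (intro mult_left_mono) auto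
        then show "2 * y * sqrt (S + y\<^sup>2) - 2 * y * sqrt (0 + y\<^sup>2) \<le> 2 * y * sqrt (S + pi\<^sup>2)"
          using y by (smt (verit) mult_nonneg_nonneg real_sqrt_ge_zero zero_le_power2)
      qed (use C(1) K \<epsilon> in auto)
      also have "\<dots> \<le> e / 2 + 2 * C * K * y * sqrt (S + pi\<^sup>2)" using \<epsilon>(2) by (simp add: mult_ac)
      finally show ?thesis by simp
    qed
    have "((\<lambda>y. 2 * C * K * y * sqrt (S + pi\<^sup>2)) \<longlongrightarrow> 2 * C * K * 0 * sqrt (S + pi\<^sup>2)) (at_right 0)"
      by (intro tendsto_intros)
    then have "\<forall>\<^sub>F y in at_right 0. 2 * C * K * y * sqrt (S + pi\<^sup>2) < e / 2"
      by (rule order_tendstoD(2)) (use e in simp)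
    moreover have "\<forall>\<^sub>F y in at_right (0::real). 0 < y \<and> y \<le> pi"
      unfolding eventually_at_right_field by (rule exI[of _ pi]) auto
    ultimately show "\<forall>\<^sub>F y in at_right 0.
        dist (integral {0..S} (\<lambda>s. heat_ext 1 y s * (\<psi> s - \<psi> 0))) 0 < e"
    proof eventually_elim
      case (elim y)
      then show ?case using bound[of y] by (simp add: dist_real_def)
    qed
  qed
  have main: "((\<lambda>y. - (pi / 2) * step_response y S * \<psi> 0
      + integral {0..S} (\<lambda>s. heat_ext 1 y s * (\<psi> s - \<psi> 0))) \<longlongrightarrow> - (pi / 2) * 1 * \<psi> 0 + 0) (at_right 0)"
    by (intro tendsto_intros err tendsto_within_subset[OF step_response_tendsto_1[OF assms(1)]]) auto
  have "\<forall>\<^sub>F y in at_right (0::real). - (pi / 2) * step_response y S * \<psi> 0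
      + integral {0..S} (\<lambda>s. heat_ext 1 y s * (\<psi> s - \<psi> 0)) = integral {0..S} (\<lambda>s. heat_ext 1 y s * \<psi> s)"
    unfolding eventually_at_right_field
  proof (intro exI[of _ pi] conjI allI impI)
    fix y :: real assume y: "0 < y" "y < pi"
    have c: "continuous_on {0..S} (\<lambda>s. heat_ext 1 y s)" using cont[of y] y by simp
    have "integral {0..S} (\<lambda>s. heat_ext 1 y s * \<psi> s)
        = integral {0..S} (\<lambda>s. heat_ext 1 y s * \<psi> 0 + heat_ext 1 y s * (\<psi> s - \<psi> 0))"
      by (intro integral_cong) (simp add: algebra_simps)
    also have "\<dots> = integral {0..S} (\<lambda>s. heat_ext 1 y s * \<psi> 0)
        + integral {0..S} (\<lambda>s. heat_ext 1 y s * (\<psi> s - \<psi> 0))"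
      by (intro Henstock_Kurzweil_Integration.integral_add integrable_continuous_interval continuous_intros c \<psi>)
    also have "integral {0..S} (\<lambda>s. heat_ext 1 y s * \<psi> 0) = - (pi / 2) * step_response y S * \<psi> 0"
      by (intro integral_unique has_integral_mult_left heat_ext_1_has_integral) (use y assms(1) in auto)
    finally show "- (pi / 2) * step_response y S * \<psi> 0
      + integral {0..S} (\<lambda>s. heat_ext 1 y s * (\<psi> s - \<psi> 0)) = integral {0..S} (\<lambda>s. heat_ext 1 y s * \<psi> s)" by simp
  qed simp
  from Lim_transform_eventually[OF main this] show ?thesis by simp
qed

section \<open>Maximum principle and uniqueness\<close>

text \<open>A positive \<open>f''\<close> at the single point x makes \<open>f'\<close> positive
  just to the right of x, where the mean value theorem lifts f above its maximum; no continuity of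
  the second derivative enters.\<close>

lemma second_derivative_nonpos_at_max:
  fixes f f' :: "real \<Rightarrow> real"
  assumes d: "d > 0" and f: "\<And>y. \<bar>y - x\<bar> < d \<Longrightarrow> (f has_real_derivative f' y) (at y)"
    and f': "(f' has_real_derivative f'') (at x)" and max: "\<And>y. \<bar>y - x\<bar> < d \<Longrightarrow> f y \<le> f x"
  shows "f' x = 0" "f'' \<le> 0"
proof -
  show 0: "f' x = 0"
    by (rule DERIV_local_max[OF f d]) (use max d in \<open>auto simp: abs_minus_commute\<close>)
  show "f'' \<le> 0"
  proof (rule ccontr)
    assume "\<not> f'' \<le> 0"
    then obtain e where e: "e > 0" "\<And>h. 0 < h \<Longrightarrow> h < e \<Longrightarrow> f' x < f' (x + h)"
      using DERIV_pos_inc_right[OF f'] by force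
    define h where "h = min d e / 2"
    have h: "0 < h" "h < d" "h < e" using d e by (auto simp: h_def)
    obtain z where z: "x < z" "z < x + h" "f (x + h) - f x = (x + h - x) * f' z"
      using MVT2[of x "x + h" f f'] f h by auto
    have "f' z > 0" using e(2)[of "z - x"] z h 0 by auto
    then have "f (x + h) - f x > 0" using z(3) h by simp
    then show False using max[of "x + h"] h by simp
  qed
qed

text \<open>A positive maximum lies off the sides and off the initial line. There \<open>Ux\<close>
  vanishes, \<open>Uxx\<close> is nonpositive and \<open>Ut\<close> nonnegative, against the strict
  inequality.\<close>

lemma parabolic_max_principle_strict:
  fixes U :: "real \<Rightarrow> real \<Rightarrow> real"
  assumes D: "D \<ge> 0" and ab: "a \<le> b" and sT: "s \<le> T"
    and cont: "continuous_on ({a..b} \<times> {s..T}) (\<lambda>(x, t). U x t)"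
    and dt: "\<And>x t. x \<in> {a<..<b} \<Longrightarrow> t \<in> {s<..T} \<Longrightarrow> ((\<lambda>t. U x t) has_real_derivative Ut x t) (at t)"
    and dx: "\<And>x t. x \<in> {a<..<b} \<Longrightarrow> t \<in> {s<..T} \<Longrightarrow> ((\<lambda>y. U y t) has_real_derivative Ux x t) (at x)"
    and dxx: "\<And>x t. x \<in> {a<..<b} \<Longrightarrow> t \<in> {s<..T} \<Longrightarrow> ((\<lambda>y. Ux y t) has_real_derivative Uxx x t) (at x)"
    and sub: "\<And>x t. x \<in> {a<..<b} \<Longrightarrow> t \<in> {s<..T} \<Longrightarrow> Ut x t + v * Ux x t - D * Uxx x t < 0"
    and init: "\<And>x. x \<in> {a..b} \<Longrightarrow> U x s \<le> 0"
    and bdry: "\<And>t. t \<in> {s..T} \<Longrightarrow> U a t \<le> 0 \<and> U b t \<le> 0"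
    and x: "x \<in> {a..b}" and t: "t \<in> {s..T}"
  shows "U x t \<le> 0"
proof (rule ccontr)
  assume neg: "\<not> U x t \<le> 0"
  have "compact ({a..b} \<times> {s..T})" by (intro compact_Times compact_Icc)
  moreover have "{a..b} \<times> {s..T} \<noteq> {}" using ab sT by auto
  ultimately obtain p where "p \<in> {a..b} \<times> {s..T}"
      "\<And>q. q \<in> {a..b} \<times> {s..T} \<Longrightarrow> (\<lambda>(x, t). U x t) q \<le> (\<lambda>(x, t). U x t) p"
    using continuous_attains_sup[OF _ _ cont] by blast
  then obtain x0 t0 where p: "x0 \<in> {a..b}" "t0 \<in> {s..T}"
      "\<And>y r. y \<in> {a..b} \<Longrightarrow> r \<in> {s..T} \<Longrightarrow> U y r \<le> U x0 t0"
    by (cases p) fastforce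
  have pos: "U x0 t0 > 0" using p(3)[OF x t] neg by linarith
  then have x0: "x0 \<in> {a<..<b}" and t0: "t0 \<in> {s<..T}"
    using p(1,2) bdry[of t0] init[of x0] by (auto simp: less_eq_real_def)
  define d where "d = min (x0 - a) (b - x0)"
  have d: "d > 0" using x0 by (simp add: d_def)
  have near: "y \<in> {a<..<b}" if "\<bar>y - x0\<bar> < d" for y
    using that by (auto simp: d_def)
  note space = second_derivative_nonpos_at_max[OF d, of x0 "\<lambda>y. U y t0" "\<lambda>y. Ux y t0" "Uxx x0 t0",
      OF dx[OF near t0] dxx[OF x0 t0]]
  have "Ux x0 t0 = 0" "Uxx x0 t0 \<le> 0"
    using space p(3)[OF _ p(2)] near by (force intro: less_imp_le)+
  \<comment> \<open>Only earlier times are compared, so a maximum at the final time T is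
    covered.\<close>
  moreover have "Ut x0 t0 \<ge> 0"
  proof (rule ccontr)
    assume "\<not> Ut x0 t0 \<ge> 0"
    then obtain e where e: "e > 0" "\<And>h. 0 < h \<Longrightarrow> h < e \<Longrightarrow> U x0 t0 < U x0 (t0 - h)"
      using DERIV_neg_dec_left[OF dt[OF x0 t0]] by force
    define h where "h = min e (t0 - s) / 2"
    have h: "0 < h" "h < e" "h < t0 - s" using e t0 by (auto simp: h_def)
    then have "t0 - h \<in> {s..T}" using t0 by auto
    with p(3)[OF p(1)] e(2)[OF h(1,2)] show False by (meson not_le)
  qed
  moreover have "D * Uxx x0 t0 \<le> 0" using D calculation(2) by (simp add: mult_nonneg_nonpos)
  ultimately show False using sub[OF x0 t0] by simp
qed

text \<open>Subtracting \<open>\<epsilon> + \<eta> * (t - s)\<close> makes the inequality strict and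
  the data nonpositive; doing so for U and for -U gives the absolute value.\<close>

lemma parabolic_max_principle:
  fixes U :: "real \<Rightarrow> real \<Rightarrow> real"
  assumes D: "D \<ge> 0" and ab: "a \<le> b" and sT: "s \<le> T" and \<epsilon>: "\<epsilon> \<ge> 0" and \<eta>: "\<eta> \<ge> 0"
    and cont: "continuous_on ({a..b} \<times> {s..T}) (\<lambda>(x, t). U x t)"
    and dt: "\<And>x t. x \<in> {a<..<b} \<Longrightarrow> t \<in> {s<..T} \<Longrightarrow> ((\<lambda>t. U x t) has_real_derivative Ut x t) (at t)"
    and dx: "\<And>x t. x \<in> {a<..<b} \<Longrightarrow> t \<in> {s<..T} \<Longrightarrow> ((\<lambda>y. U y t) has_real_derivative Ux x t) (at x)"
    and dxx: "\<And>x t. x \<in> {a<..<b} \<Longrightarrow> t \<in> {s<..T} \<Longrightarrow> ((\<lambda>y. Ux y t) has_real_derivative Uxx x t) (at x)"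
    and sub: "\<And>x t. x \<in> {a<..<b} \<Longrightarrow> t \<in> {s<..T} \<Longrightarrow> \<bar>Ut x t + v * Ux x t - D * Uxx x t\<bar> < \<eta>"
    and init: "\<And>x. x \<in> {a..b} \<Longrightarrow> \<bar>U x s\<bar> \<le> \<epsilon>"
    and bdry: "\<And>t. t \<in> {s..T} \<Longrightarrow> \<bar>U a t\<bar> \<le> \<epsilon> \<and> \<bar>U b t\<bar> \<le> \<epsilon>"
    and x: "x \<in> {a..b}" and t: "t \<in> {s..T}"
  shows "\<bar>U x t\<bar> \<le> \<epsilon> + \<eta> * (t - s)"
proof -
  have "\<sigma> * U x t - \<epsilon> - \<eta> * (t - s) \<le> 0" if \<sigma>: "\<sigma> = 1 \<or> \<sigma> = -1" for \<sigma>
  proof (rule parabolic_max_principle_strict[where a = a and b = b and s = s and T = T and v = v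
        and D = D and U = "\<lambda>x t. \<sigma> * U x t - \<epsilon> - \<eta> * (t - s)" and Ut = "\<lambda>x t. \<sigma> * Ut x t - \<eta>"
        and Ux = "\<lambda>x t. \<sigma> * Ux x t" and Uxx = "\<lambda>x t. \<sigma> * Uxx x t"])
    show "continuous_on ({a..b} \<times> {s..T}) (\<lambda>(x, t). \<sigma> * U x t - \<epsilon> - \<eta> * (t - s))"
      using cont unfolding case_prod_beta' by (intro continuous_intros)
    fix x t assume xt: "x \<in> {a<..<b}" "t \<in> {s<..T}"
    show "((\<lambda>t. \<sigma> * U x t - \<epsilon> - \<eta> * (t - s)) has_real_derivative \<sigma> * Ut x t - \<eta>) (at t)"
      by (auto intro!: derivative_eq_intros dt[OF xt])
    show "((\<lambda>y. \<sigma> * U y t - \<epsilon> - \<eta> * (t - s)) has_real_derivative \<sigma> * Ux x t) (at x)"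
      by (auto intro!: derivative_eq_intros dx[OF xt])
    show "((\<lambda>y. \<sigma> * Ux y t) has_real_derivative \<sigma> * Uxx x t) (at x)"
      by (auto intro!: derivative_eq_intros dxx[OF xt])
    have "\<sigma> * (Ut x t + v * Ux x t - D * Uxx x t) < \<eta>" using sub[OF xt] \<sigma> by auto
    then show "\<sigma> * Ut x t - \<eta> + v * (\<sigma> * Ux x t) - D * (\<sigma> * Uxx x t) < 0" by (simp add: algebra_simps)
  next
    fix x assume "x \<in> {a..b}"
    then show "\<sigma> * U x s - \<epsilon> - \<eta> * (s - s) \<le> 0" using init[of x] \<sigma> by auto
  next
    fix t assume t: "t \<in> {s..T}"
    then have "\<eta> * (t - s) \<ge> 0" using \<eta> by auto
    then show "\<sigma> * U a t - \<epsilon> - \<eta> * (t - s) \<le> 0 \<and> \<sigma> * U b t - \<epsilon> - \<eta> * (t - s) \<le> 0"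
      using bdry[OF t] \<sigma> by auto
  qed (use assms in auto)
  from this[of 1] this[of "-1"] show ?thesis by auto
qed

text \<open>Near \<open>x = 0\<close> the zero boundary values are attained only pointwise in \<open>t\<close>.  Integrating in
  time turns this, by dominated convergence, into a smallness uniform in \<open>t\<close> to which the
  maximum principle applies.\<close>

lemma bounded_null_solution_eq_0:
  fixes w :: "real \<Rightarrow> real \<Rightarrow> real"
  assumes D: "D > 0" and L: "L > 0"
    and w_reg: "continuous_on ({0<..L} \<times> {0..}) (\<lambda>(x, t). w x t)"
    and wt_cont: "continuous_on ({0<..<L} \<times> {0<..}) (\<lambda>(x, t). wt x t)"
    and wx_cont: "continuous_on ({0<..<L} \<times> {0<..}) (\<lambda>(x, t). wx x t)"
    and wxx_cont: "continuous_on ({0<..<L} \<times> {0<..}) (\<lambda>(x, t). wxx x t)"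
    and wt: "\<And>x t. x \<in> {0<..<L} \<Longrightarrow> t > 0 \<Longrightarrow> ((\<lambda>t. w x t) has_real_derivative wt x t) (at t)"
    and wx: "\<And>x t. x \<in> {0<..<L} \<Longrightarrow> t > 0 \<Longrightarrow> ((\<lambda>y. w y t) has_real_derivative wx x t) (at x)"
    and wxx: "\<And>x t. x \<in> {0<..<L} \<Longrightarrow> t > 0 \<Longrightarrow> ((\<lambda>y. wx y t) has_real_derivative wxx x t) (at x)"
    and pde: "\<And>x t. x \<in> {0<..<L} \<Longrightarrow> t > 0 \<Longrightarrow> wt x t + v * wx x t - D * wxx x t = 0"
    and init: "\<And>x. x \<in> {0<..L} \<Longrightarrow> w x 0 = 0"
    and left: "\<And>t. t > 0 \<Longrightarrow> ((\<lambda>x. w x t) \<longlongrightarrow> 0) (at_right 0)"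
    and right: "\<And>t. t > 0 \<Longrightarrow> w L t = 0"
    and bdd: "\<And>T. T > 0 \<Longrightarrow> \<exists>M. \<forall>x\<in>{0<..L}. \<forall>t\<in>{0..T}. \<bar>w x t\<bar> \<le> M"
    and x: "x \<in> {0<..L}" and t: "t \<ge> 0"
  shows "w x t = 0"
proof -
  define W where "W x t = integral {0..t} (\<lambda>r. w x r)" for x t
  have w_cont: "continuous_on S (\<lambda>r. w x r)" if "x \<in> {0<..L}" "S \<subseteq> {0..}" for x S
  proof -
    have "continuous_on S (\<lambda>r. (\<lambda>(x, t). w x t) (x, r))"
      using that by (intro continuous_on_compose2[OF w_reg] continuous_intros) auto
    then show ?thesis by simp
  qed
  have w_int: "(\<lambda>r. w x r) integrable_on {a..b}" if "x \<in> {0<..L}" "0 \<le> a" for x a b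
    using that by (intro integrable_continuous_interval w_cont) auto
  \<comment> \<open>The extension by zero is continuous because w starts from 0. This exhibits
    \<open>W\<close> as the convolution of a causal kernel with 1, which yields joint
    continuity.\<close>
  define F where "F x t = (if t > 0 then w x t else 0)" for x t
  have F_eq: "F x t = w x (max 0 t)" if "x \<in> {0<..L}" for x t
    using init[OF that] by (auto simp: F_def max_def)
  have "causal_kernel L F"
  proof
    have "continuous_on ({0<..L} \<times> UNIV) (\<lambda>p. (\<lambda>(x, t). w x t) (fst p, max 0 (snd p)))"
      by (intro continuous_on_compose2[OF w_reg] continuous_intros) auto
    then show "continuous_on ({0<..L} \<times> UNIV) (\<lambda>(x, t). F x t)"
      by (rule continuous_on_cong[THEN iffD1, rotated -1]) (auto simp: F_eq)
  qed (simp add: F_def)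
  then interpret causal_kernel L F .
  have W_eq: "time_conv F (\<lambda>_. 1) x t = W x t" if "x \<in> {0<..L}" for x t
    unfolding time_conv_reflect W_def by (intro integral_cong) (simp add: F_eq[OF that])
  have W_cont: "continuous_on ({0<..L} \<times> UNIV) (\<lambda>(x, t). W x t)"
    by (rule continuous_on_cong[THEN iffD1, OF _ _ continuous_on_time_conv[of "\<lambda>_. 1"]])
       (auto simp: W_eq)
  have W_diff: "W x t - W x s = integral {s..t} (\<lambda>r. w x r)" if "x \<in> {0<..L}" "0 \<le> s" "s \<le> t" for x s t
    using Henstock_Kurzweil_Integration.integral_combine[OF that(2,3) w_int[OF that(1) order.refl]]
    by (simp add: W_def)
  have W_dt: "((\<lambda>t. W x t) has_real_derivative w x t) (at t)" if "x \<in> {0<..L}" "t > 0" for x t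
  proof -
    have "((\<lambda>u. integral {0..u} (\<lambda>r. w x r)) has_real_derivative w x t) (at t within {0..t + 1})"
      using that by (intro integral_has_real_derivative w_cont) auto
    moreover have "at t within {0..t + 1} = at t"
      using that by (intro at_within_interior) auto
    ultimately show ?thesis by (simp add: W_def)
  qed
  have section_cont: "continuous_on S (\<lambda>r. g x r)"
    if "continuous_on ({0<..<L} \<times> {0<..}) (\<lambda>(x, t). g x t)" "x \<in> {0<..<L}" "S \<subseteq> {0<..}"
    for g :: "real \<Rightarrow> real \<Rightarrow> real" and x S
  proof -
    have "continuous_on S (\<lambda>r. (\<lambda>(x, t). g x t) (x, r))"
      using that by (intro continuous_on_compose2[OF that(1)] continuous_intros) auto
    then show ?thesis by simp
  qed
  have under_integral: "((\<lambda>y. integral {s..t} (\<lambda>r. g y r)) has_real_derivative integral {s..t} (\<lambda>r. g' x r)) (at x)"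
    if g: "continuous_on ({0<..<L} \<times> {0<..}) (\<lambda>(x, t). g x t)"
      and g': "continuous_on ({0<..<L} \<times> {0<..}) (\<lambda>(x, t). g' x t)"
      and der: "\<And>x t. x \<in> {0<..<L} \<Longrightarrow> t > 0 \<Longrightarrow> ((\<lambda>y. g y t) has_real_derivative g' x t) (at x)"
      and x: "x \<in> {0<..<L}" and s: "s > 0"
    for g g' :: "real \<Rightarrow> real \<Rightarrow> real" and x s t
  proof -
    have "((\<lambda>y. integral (cbox s t) (\<lambda>r. g y r)) has_real_derivative integral (cbox s t) (\<lambda>r. g' x r))
        (at x within {0<..<L})"
    proof (rule leibniz_rule_field_derivative[where U = "{0<..<L}"])
      show "((\<lambda>y. g y r) has_real_derivative g' y r) (at y within {0<..<L})"
        if "y \<in> {0<..<L}" "r \<in> cbox s t" for y r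
        using that s by (intro has_field_derivative_at_within[OF der]) auto
      show "(\<lambda>r. g y r) integrable_on cbox s t" if "y \<in> {0<..<L}" for y
        unfolding cbox_interval using that s by (intro integrable_continuous_interval section_cont[OF g]) auto
      show "continuous_on ({0<..<L} \<times> cbox s t) (\<lambda>(y, r). g' y r)"
        by (rule continuous_on_subset[OF g']) (use s in auto)
    qed (use x in auto)
    moreover have "at x within {0<..<L} = at x" using x by (intro at_within_open) auto
    ultimately show ?thesis by simp
  qed
  have w_cont': "continuous_on ({0<..<L} \<times> {0<..}) (\<lambda>(x, t). w x t)"
    by (rule continuous_on_subset[OF w_reg]) auto
  \<comment> \<open>The start s stays positive because the derivatives are controlled only at
    positive times. The side x = L carries zero data, so the time integral of |w| along
    \<open>\<rho>\<close> bounds both sides.\<close>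
  have step1: "\<bar>W x t - W x s\<bar> \<le> integral {0..T} (\<lambda>r. \<bar>w \<rho> r\<bar>) + \<eta> * (t - s)"
    if \<rho>: "0 < \<rho>" "\<rho> < L" and st: "0 < s" "s \<le> t" "t \<le> T" and x: "x \<in> {\<rho>..L}"
      and \<eta>: "\<And>y. y \<in> {\<rho>..L} \<Longrightarrow> \<bar>w y s\<bar> < \<eta>" for \<rho> s t T x \<eta>
  proof (rule parabolic_max_principle[where a = \<rho> and b = L and s = s and T = T and D = D and v = v
        and U = "\<lambda>x t. W x t - W x s" and Ut = w and Ux = "\<lambda>x t. integral {s..t} (\<lambda>r. wx x r)"
        and Uxx = "\<lambda>x t. integral {s..t} (\<lambda>r. wxx x r)"])
    have "continuous_on ({\<rho>..L} \<times> {s..T}) (\<lambda>p. (\<lambda>(x, t). W x t) (fst p, snd p) - (\<lambda>(x, t). W x t) (fst p, s))"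
      using \<rho> by (intro continuous_intros continuous_on_compose2[OF W_cont]) auto
    then show "continuous_on ({\<rho>..L} \<times> {s..T}) (\<lambda>(x, t). W x t - W x s)"
      by (simp add: case_prod_beta')
    show "0 \<le> integral {0..T} (\<lambda>r. \<bar>w \<rho> r\<bar>)"
      by (intro integral_nonneg integrable_continuous_interval continuous_intros w_cont) (use \<rho> in auto)
    have "0 \<le> \<bar>w L s\<bar>" by simp
    also have "\<dots> < \<eta>" using \<rho> by (intro \<eta>) auto
    finally show "0 \<le> \<eta>" by simp
  next
    fix x r assume xr: "x \<in> {\<rho><..<L}" "r \<in> {s<..T}"
    then have xr': "x \<in> {0<..<L}" "r > 0" using \<rho> st by auto
    then have xL: "x \<in> {0<..L}" by auto
    show "((\<lambda>t. W x t - W x s) has_real_derivative w x r) (at r)"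
      using DERIV_diff[OF W_dt[OF xL xr'(2)] DERIV_const] by simp
    have "((\<lambda>y. integral {s..r} (\<lambda>r. w y r)) has_real_derivative integral {s..r} (\<lambda>r. wx x r)) (at x)"
      using under_integral[OF w_cont' wx_cont wx xr'(1) st(1)] .
    then show "((\<lambda>y. W y r - W y s) has_real_derivative integral {s..r} (\<lambda>r. wx x r)) (at x)"
      by (rule has_field_derivative_transform_within_open[of _ _ _ "{0<..<L}"])
         (use xr xr' st in \<open>auto simp: W_diff\<close>)
    show "((\<lambda>y. integral {s..r} (\<lambda>r. wx y r)) has_real_derivative integral {s..r} (\<lambda>r. wxx x r)) (at x)"
      using under_integral[OF wx_cont wxx_cont wxx xr'(1) st(1)] .
    have int: "(\<lambda>r. wx x r) integrable_on {s..r}" "(\<lambda>r. wxx x r) integrable_on {s..r}"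
      using st(1) by (auto intro!: integrable_continuous_interval section_cont[OF wx_cont xr'(1)]
          section_cont[OF wxx_cont xr'(1)])
    have "((\<lambda>r. wt x r) has_integral w x r - w x s) {s..r}"
    proof (rule fundamental_theorem_of_calculus)
      fix q assume "q \<in> {s..r}"
      then show "((\<lambda>t. w x t) has_vector_derivative wt x q) (at q within {s..r})"
        using wt[OF xr'(1), of q] st(1)
        by (simp add: has_real_derivative_iff_has_vector_derivative has_vector_derivative_at_within)
    qed (use xr in auto)
    moreover have "((\<lambda>r. D * wxx x r - v * wx x r) has_integral
        D * integral {s..r} (\<lambda>r. wxx x r) - v * integral {s..r} (\<lambda>r. wx x r)) {s..r}"
      by (intro has_integral_diff has_integral_mult_right integrable_integral int)
    moreover have "wt x q = D * wxx x q - v * wx x q" if "q \<in> {s..r}" for q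
      using pde[OF xr'(1), of q] that st(1) by auto
    ultimately have "w x r - w x s = D * integral {s..r} (\<lambda>r. wxx x r) - v * integral {s..r} (\<lambda>r. wx x r)"
      by (metis (no_types, lifting) has_integral_cong has_integral_unique)
    then have "w x r + v * integral {s..r} (\<lambda>r. wx x r) - D * integral {s..r} (\<lambda>r. wxx x r) = w x s" by simp
    moreover have "\<bar>w x s\<bar> < \<eta>" using xr by (intro \<eta>) auto
    ultimately show "\<bar>w x r + v * integral {s..r} (\<lambda>r. wx x r) - D * integral {s..r} (\<lambda>r. wxx x r)\<bar> < \<eta>"
      by simp
  next
    fix x assume "x \<in> {\<rho>..L}"
    show "\<bar>W x s - W x s\<bar> \<le> integral {0..T} (\<lambda>r. \<bar>w \<rho> r\<bar>)"
      by (simp, intro integral_nonneg integrable_continuous_interval continuous_intros w_cont) (use \<rho> in auto)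
  next
    fix r assume r: "r \<in> {s..T}"
    have \<rho>L: "\<rho> \<in> {0<..L}" "L \<in> {0<..L}" using \<rho> by auto
    have ab: "(\<lambda>r. \<bar>w \<rho> r\<bar>) integrable_on {a..b}" if "0 \<le> a" for a b
      using that by (intro integrable_continuous_interval continuous_intros w_cont \<rho>L) auto
    have "\<bar>W \<rho> r - W \<rho> s\<bar> = norm (integral {s..r} (\<lambda>r. w \<rho> r))" using W_diff[OF \<rho>L(1)] r st by simp
    also have "\<dots> \<le> integral {s..r} (\<lambda>r. \<bar>w \<rho> r\<bar>)"
      using st by (intro integral_norm_bound_integral w_int ab \<rho>L) auto
    also have "\<dots> \<le> integral {0..T} (\<lambda>r. \<bar>w \<rho> r\<bar>)"
      using st r by (intro integral_subset_le ab) auto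
    finally have 1: "\<bar>W \<rho> r - W \<rho> s\<bar> \<le> integral {0..T} (\<lambda>r. \<bar>w \<rho> r\<bar>)" .
    have "W L r - W L s = integral {s..r} (\<lambda>r. 0)"
      unfolding W_diff[OF \<rho>L(2) less_imp_le[OF st(1)], of r, OF atLeastAtMost_iff[THEN iffD1, OF r, THEN conjunct1]]
      by (intro integral_cong) (use st right in auto)
    moreover have "0 \<le> integral {0..T} (\<lambda>r. \<bar>w \<rho> r\<bar>)" using 1 by linarith
    ultimately show "\<bar>W \<rho> r - W \<rho> s\<bar> \<le> integral {0..T} (\<lambda>r. \<bar>w \<rho> r\<bar>)
        \<and> \<bar>W L r - W L s\<bar> \<le> integral {0..T} (\<lambda>r. \<bar>w \<rho> r\<bar>)"
      using 1 by simp
  qed (use D \<rho> st x in auto)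
  \<comment> \<open>Lets s tend to 0: away from x = 0 uniform continuity reaches the initial line,
    so w at time s is uniformly small, and so is \<open>W x s\<close>.\<close>
  have step2: "\<bar>W x t\<bar> \<le> integral {0..T} (\<lambda>r. \<bar>w \<rho> r\<bar>)"
    if \<rho>: "0 < \<rho>" "\<rho> < L" and t: "0 < t" "t \<le> T" and x: "x \<in> {\<rho>..L}" for \<rho> t T x
  proof (rule field_le_epsilon)
    fix e :: real assume e: "e > 0"
    define \<eta> where "\<eta> = e / (2 * t)"
    have \<eta>: "\<eta> > 0" "\<eta> * t = e / 2" using e t by (auto simp: \<eta>_def)
    have "uniformly_continuous_on ({\<rho>..L} \<times> {0..1}) (\<lambda>(x, t). w x t)"
      by (intro compact_uniformly_continuous continuous_on_subset[OF w_reg] compact_Times compact_Icc)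
         (use \<rho> in auto)
    then obtain d where d: "d > 0" "\<And>p q. p \<in> {\<rho>..L} \<times> {0..1} \<Longrightarrow> q \<in> {\<rho>..L} \<times> {0..1} \<Longrightarrow>
        dist q p < d \<Longrightarrow> dist ((\<lambda>(x, t). w x t) q) ((\<lambda>(x, t). w x t) p) < \<eta>"
      unfolding uniformly_continuous_on_def using \<eta>(1) by meson
    have xL: "x \<in> {0<..L}" using x \<rho> by auto
    have "continuous_on UNIV (\<lambda>s. (\<lambda>(x, t). W x t) (x, s))"
      using xL by (intro continuous_on_compose2[OF W_cont] continuous_intros) auto
    then have "((\<lambda>s. W x s) \<longlongrightarrow> W x 0) (at 0)" by (auto simp: continuous_on_def)
    then have "((\<lambda>s. W x s) \<longlongrightarrow> W x 0) (at_right 0)" by (rule tendsto_within_subset) simp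
    moreover have "W x 0 = 0" by (simp add: W_def)
    ultimately have "\<forall>\<^sub>F s in at_right 0. \<bar>W x s\<bar> < e / 2"
      using tendstoD[of "\<lambda>s. W x s" 0 "at_right 0" "e / 2"] e by (simp add: dist_real_def)
    then obtain d' where d': "d' > 0" "\<And>s. 0 < s \<Longrightarrow> s < d' \<Longrightarrow> \<bar>W x s\<bar> < e / 2"
      unfolding eventually_at_right_field by auto
    define s where "s = min (min d d') (min t 1) / 2"
    have s: "0 < s" "s < d" "s < d'" "s < t" "s < 1" using d d' t by (auto simp: s_def)
    have small: "\<bar>w y s\<bar> < \<eta>" if "y \<in> {\<rho>..L}" for y
      using d(2)[of "(y, 0)" "(y, s)"] that s init[of y] \<rho> by (simp add: dist_Pair_Pair dist_real_def)
    have "\<bar>W x t - W x s\<bar> \<le> integral {0..T} (\<lambda>r. \<bar>w \<rho> r\<bar>) + \<eta> * (t - s)"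
      by (rule step1) (use \<rho> s t x small in auto)
    moreover have "\<eta> * (t - s) \<le> \<eta> * t" using \<eta> s by (intro mult_left_mono) auto
    ultimately show "\<bar>W x t\<bar> \<le> integral {0..T} (\<lambda>r. \<bar>w \<rho> r\<bar>) + e"
      using d'(2)[OF s(1,3)] \<eta>(2) by linarith
  qed
  have W0: "W x t = 0" if x: "x \<in> {0<..L}" and t: "t > 0" for x t
  proof -
    obtain M where M: "\<And>x r. x \<in> {0<..L} \<Longrightarrow> r \<in> {0..t} \<Longrightarrow> \<bar>w x r\<bar> \<le> M" using bdd[OF t] by blast
    \<comment> \<open>The offset 2 keeps every \<open>\<rho> n\<close> strictly between 0 and L,
      from n = 0 on.\<close>
    define \<rho> where "\<rho> n = L / real (n + 2)" for n
    have \<rho>: "0 < \<rho> n" "\<rho> n < L" for n using L by (simp_all add: \<rho>_def divide_less_eq)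
    have \<rho>0: "\<rho> \<longlonglongrightarrow> 0"
      unfolding \<rho>_def using LIMSEQ_ignore_initial_segment[OF lim_const_over_n[of L], of 2] by simp
    have "(\<lambda>n. integral {0..t} (\<lambda>r. \<bar>w (\<rho> n) r\<bar>)) \<longlonglongrightarrow> integral {0..t} (\<lambda>r. 0)"
    proof (rule dominated_convergence(2))
      show "(\<lambda>r. \<bar>w (\<rho> n) r\<bar>) integrable_on {0..t}" for n
        by (intro integrable_continuous_interval continuous_intros w_cont)
           (use \<rho>[of n] in \<open>auto intro: less_imp_le\<close>)
      show "(\<lambda>_. M) integrable_on {0..t}" by (rule integrable_const_ivl)
      show "norm \<bar>w (\<rho> n) r\<bar> \<le> M" if "r \<in> {0..t}" for n r
        using M[OF _ that, of "\<rho> n"] \<rho>[of n] by auto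
      show "(\<lambda>n. \<bar>w (\<rho> n) r\<bar>) \<longlonglongrightarrow> 0" if r: "r \<in> {0..t}" for r
      proof (cases "r = 0")
        case True
        have "w (\<rho> n) 0 = 0" for n using init[of "\<rho> n"] \<rho>[of n] by auto
        with True show ?thesis by simp
      next
        case False
        have "filterlim \<rho> (at_right 0) sequentially"
          unfolding filterlim_at using \<rho>0 \<rho>(1) by (auto simp: less_imp_neq[symmetric])
        from filterlim_compose[OF left[of r] this] False r show ?thesis
          by (auto intro: tendsto_rabs_zero)
      qed
    qed
    then have lim: "(\<lambda>n. integral {0..t} (\<lambda>r. \<bar>w (\<rho> n) r\<bar>)) \<longlonglongrightarrow> 0" by simp
    have "\<forall>\<^sub>F n in sequentially. \<rho> n < x" by (rule order_tendstoD(2)[OF \<rho>0]) (use x in auto)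
    then have "\<forall>\<^sub>F n in sequentially. \<bar>W x t\<bar> \<le> integral {0..t} (\<lambda>r. \<bar>w (\<rho> n) r\<bar>)"
      by eventually_elim (rule step2, use \<rho> t x in auto)
    then have "\<bar>W x t\<bar> \<le> 0" by (intro tendsto_lowerbound[OF lim]) auto
    then show ?thesis by simp
  qed
  show ?thesis
  proof (cases "t = 0")
    case False
    with t have t: "t > 0" by simp
    \<comment> \<open>\<open>W\<close> vanishes at all positive times, and its time derivative is
      w.\<close>
    have "((\<lambda>t. W x t) has_real_derivative 0) (at t)"
      by (rule has_field_derivative_transform_within_open[of "\<lambda>_. 0" _ _ "{0<..}"])
         (use t W0[OF x] in auto)
    with W_dt[OF x t] show ?thesis by (rule DERIV_unique)
  qed (use init[OF x] in simp)
qed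

lemma classical_solution_unique:
  assumes D: "D > 0" and L: "L > 0"
    and u: "classical_solution D v L c\<^sub>a c\<^sub>p u" "bounded_on_finite_times L u"
    and u': "classical_solution D v L c\<^sub>a c\<^sub>p u'" "bounded_on_finite_times L u'"
    and x: "x \<in> {0<..L}" and t: "t \<ge> 0"
  shows "u x t = u' x t"
proof -
  obtain ut ux uxx where d: "continuous_on ({0<..<L} \<times> {0<..}) (\<lambda>(x, t). ut x t) \<and>
        continuous_on ({0<..<L} \<times> {0<..}) (\<lambda>(x, t). ux x t) \<and>
        continuous_on ({0<..<L} \<times> {0<..}) (\<lambda>(x, t). uxx x t) \<and>
        (\<forall>x\<in>{0<..<L}. \<forall>t>0.
           ((\<lambda>s. u x s) has_real_derivative ut x t) (at t) \<and>
           ((\<lambda>y. u y t) has_real_derivative ux x t) (at x) \<and>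
           ((\<lambda>y. ux y t) has_real_derivative uxx x t) (at x) \<and>
           ut x t + v * ux x t - D * uxx x t = 0)"
    using u(1)[unfolded classical_solution_def, THEN conjunct1] by (elim exE)
  have a: "continuous_on ({0<..<L} \<times> {0<..}) (\<lambda>(x, t). ut x t)"
      "continuous_on ({0<..<L} \<times> {0<..}) (\<lambda>(x, t). ux x t)"
      "continuous_on ({0<..<L} \<times> {0<..}) (\<lambda>(x, t). uxx x t)" and
    b: "\<And>x t. x \<in> {0<..<L} \<Longrightarrow> t > 0 \<Longrightarrow> ((\<lambda>s. u x s) has_real_derivative ut x t) (at t)"
      "\<And>x t. x \<in> {0<..<L} \<Longrightarrow> t > 0 \<Longrightarrow> ((\<lambda>y. u y t) has_real_derivative ux x t) (at x)"
      "\<And>x t. x \<in> {0<..<L} \<Longrightarrow> t > 0 \<Longrightarrow> ((\<lambda>y. ux y t) has_real_derivative uxx x t) (at x)"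
      "\<And>x t. x \<in> {0<..<L} \<Longrightarrow> t > 0 \<Longrightarrow> ut x t + v * ux x t - D * uxx x t = 0"
    using d by blast+
  have c: "continuous_on ({0<..L} \<times> {0..}) (\<lambda>(x, t). u x t)" "\<And>x. x \<in> {0<..L} \<Longrightarrow> u x 0 = c\<^sub>a"
       "\<And>t. t > 0 \<Longrightarrow> ((\<lambda>x. u x t) \<longlongrightarrow> c\<^sub>p t) (at_right 0)" "\<And>t. t > 0 \<Longrightarrow> u L t = c\<^sub>a"
    using u(1)[unfolded classical_solution_def, THEN conjunct2] by blast+
  obtain ut' ux' uxx' where d': "continuous_on ({0<..<L} \<times> {0<..}) (\<lambda>(x, t). ut' x t) \<and>
        continuous_on ({0<..<L} \<times> {0<..}) (\<lambda>(x, t). ux' x t) \<and>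
        continuous_on ({0<..<L} \<times> {0<..}) (\<lambda>(x, t). uxx' x t) \<and>
        (\<forall>x\<in>{0<..<L}. \<forall>t>0.
           ((\<lambda>s. u' x s) has_real_derivative ut' x t) (at t) \<and>
           ((\<lambda>y. u' y t) has_real_derivative ux' x t) (at x) \<and>
           ((\<lambda>y. ux' y t) has_real_derivative uxx' x t) (at x) \<and>
           ut' x t + v * ux' x t - D * uxx' x t = 0)"
    using u'(1)[unfolded classical_solution_def, THEN conjunct1] by (elim exE)
  have a': "continuous_on ({0<..<L} \<times> {0<..}) (\<lambda>(x, t). ut' x t)"
      "continuous_on ({0<..<L} \<times> {0<..}) (\<lambda>(x, t). ux' x t)"
      "continuous_on ({0<..<L} \<times> {0<..}) (\<lambda>(x, t). uxx' x t)" and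
    b': "\<And>x t. x \<in> {0<..<L} \<Longrightarrow> t > 0 \<Longrightarrow> ((\<lambda>s. u' x s) has_real_derivative ut' x t) (at t)"
      "\<And>x t. x \<in> {0<..<L} \<Longrightarrow> t > 0 \<Longrightarrow> ((\<lambda>y. u' y t) has_real_derivative ux' x t) (at x)"
      "\<And>x t. x \<in> {0<..<L} \<Longrightarrow> t > 0 \<Longrightarrow> ((\<lambda>y. ux' y t) has_real_derivative uxx' x t) (at x)"
      "\<And>x t. x \<in> {0<..<L} \<Longrightarrow> t > 0 \<Longrightarrow> ut' x t + v * ux' x t - D * uxx' x t = 0"
    using d' by blast+
  have c': "continuous_on ({0<..L} \<times> {0..}) (\<lambda>(x, t). u' x t)" "\<And>x. x \<in> {0<..L} \<Longrightarrow> u' x 0 = c\<^sub>a"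
       "\<And>t. t > 0 \<Longrightarrow> ((\<lambda>x. u' x t) \<longlongrightarrow> c\<^sub>p t) (at_right 0)" "\<And>t. t > 0 \<Longrightarrow> u' L t = c\<^sub>a"
    using u'(1)[unfolded classical_solution_def, THEN conjunct2] by blast+
  have cont_diff: "continuous_on S (\<lambda>(x, t). f x t - g x t)"
    if "continuous_on S (\<lambda>(x, t). f x t)" "continuous_on S (\<lambda>(x, t). g x t)"
    for S and f g :: "real \<Rightarrow> real \<Rightarrow> real"
    using continuous_on_diff[OF that] by (simp add: case_prod_beta')
  have bound: "\<exists>M. \<forall>x\<in>{0<..L}. \<forall>t\<in>{0..T}. \<bar>f x t\<bar> \<le> M"
    if "bounded_on_finite_times L f" "T > 0" for f :: "real \<Rightarrow> real \<Rightarrow> real" and T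
  proof -
    have "bounded ((\<lambda>(x, t). f x t) ` ({0<..L} \<times> {0..T}))"
      using that unfolding bounded_on_finite_times_def by blast
    then obtain M where "\<forall>z\<in>(\<lambda>(x, t). f x t) ` ({0<..L} \<times> {0..T}). norm z \<le> M"
      unfolding bounded_iff by blast
    then show ?thesis by (intro exI[of _ M]) auto
  qed
  have "u x t - u' x t = 0"
  proof (rule bounded_null_solution_eq_0[where D = D and L = L and v = v and w = "\<lambda>x t. u x t - u' x t"
        and wt = "\<lambda>x t. ut x t - ut' x t" and wx = "\<lambda>x t. ux x t - ux' x t"
        and wxx = "\<lambda>x t. uxx x t - uxx' x t"])
    show "(ut x t - ut' x t) + v * (ux x t - ux' x t) - D * (uxx x t - uxx' x t) = 0"
      if "x \<in> {0<..<L}" "t > 0" for x t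
      using b(4)[OF that] b'(4)[OF that] by (simp add: algebra_simps)
    show "((\<lambda>x. u x t - u' x t) \<longlongrightarrow> 0) (at_right 0)" if "t > 0" for t
      using tendsto_diff[OF c(3)[OF that] c'(3)[OF that]] by simp
    show "\<exists>M. \<forall>x\<in>{0<..L}. \<forall>t\<in>{0..T}. \<bar>u x t - u' x t\<bar> \<le> M" if T: "T > 0" for T
    proof -
      obtain M M' where "\<forall>x\<in>{0<..L}. \<forall>t\<in>{0..T}. \<bar>u x t\<bar> \<le> M" "\<forall>x\<in>{0<..L}. \<forall>t\<in>{0..T}. \<bar>u' x t\<bar> \<le> M'"
        using bound[OF u(2) T] bound[OF u'(2) T] by blast
      then have "\<forall>x\<in>{0<..L}. \<forall>t\<in>{0..T}. \<bar>u x t - u' x t\<bar> \<le> M + M'" by fastforce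
      then show ?thesis ..
    qed
  qed (use D L x t in \<open>auto intro!: cont_diff a a' c(1) c'(1) DERIV_diff b(1-3) b'(1-3) simp: c(2,4) c'(2,4)\<close>)
  then show ?thesis by simp
qed

section \<open>Return to the original variables: the formula solves the problem\<close>

text \<open>For j = 1 the sign is opposite to that of \<open>green_kernel\<close>:
  \<open>heat_series 1\<close> carries cos (theta + pi/2) = - sin theta, so the negative prefactor
  gives the kernel that multiplies \<open>c\<^sub>p - c\<^sub>a\<close>.\<close>

definition drift_heat_kernel :: "real \<Rightarrow> real \<Rightarrow> real \<Rightarrow> int \<Rightarrow> real \<Rightarrow> real \<Rightarrow> real" where
  "drift_heat_kernel D v L j x \<tau> = - (2 * pi * D / L\<^sup>2) * exp (v / (2 * D) * x - v\<^sup>2 / (4 * D) * \<tau>)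
     * heat_ext j (pi * x / L) (D * pi\<^sup>2 / L\<^sup>2 * \<tau>)"

lemma causal_kernel_drift_heat_kernel:
  assumes "D > 0" "L > 0" "j \<in> {1, 2, 3}"
  shows "causal_kernel L (drift_heat_kernel D v L j)"
proof
  have "continuous_on ({0<..L} \<times> UNIV) (\<lambda>p. - (2 * pi * D / L\<^sup>2)
      * exp (v / (2 * D) * fst p - v\<^sup>2 / (4 * D) * snd p)
      * (\<lambda>(y, s). heat_ext j y s) (pi * fst p / L, D * pi\<^sup>2 / L\<^sup>2 * snd p))"
    using assms
    by (intro continuous_intros continuous_on_compose2[OF continuous_on_heat_ext[OF assms(3)]])
       (auto simp: field_simps)
  then show "continuous_on ({0<..L} \<times> UNIV) (\<lambda>(x, t). drift_heat_kernel D v L j x t)"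
    by (simp add: drift_heat_kernel_def case_prod_beta')
  fix x t :: real assume "t \<le> 0"
  then have "D * pi\<^sup>2 / L\<^sup>2 * t \<le> 0" using assms by (intro mult_nonneg_nonpos) auto
  then show "drift_heat_kernel D v L j x t = 0" by (simp add: drift_heat_kernel_def heat_ext_def)
qed

lemma causal_kernel_linear:
  assumes "causal_kernel L F" "causal_kernel L G"
  shows "causal_kernel L (\<lambda>x t. a * F x t + b * G x t)"
proof
  interpret F: causal_kernel L F by (rule assms)
  interpret G: causal_kernel L G by (rule assms)
  show "continuous_on ({0<..L} \<times> UNIV) (\<lambda>(x, t). a * F x t + b * G x t)"
    using continuous_on_add[OF continuous_on_mult_left[OF F.cont, of a] continuous_on_mult_left[OF G.cont, of b]]
    by (simp add: case_prod_beta')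
  show "a * F x t + b * G x t = 0" if "t \<le> 0" for x t using that by (simp add: F.causal G.causal)
qed

lemma drift_heat_kernel_has_derivative_space:
  "((\<lambda>y. drift_heat_kernel D v L j y t) has_real_derivative
     v / (2 * D) * drift_heat_kernel D v L j x t + pi / L * drift_heat_kernel D v L (j + 1) x t) (at x)"
proof -
  let ?s = "D * pi\<^sup>2 / L\<^sup>2 * t"
  have "((\<lambda>y. pi / L * y) has_real_derivative pi / L) (at x)" by (rule DERIV_cmult_Id)
  then have "((\<lambda>y. pi * y / L) has_real_derivative pi / L) (at x)" by (simp only: times_divide_eq_left)
  from DERIV_chain2[OF heat_ext_has_derivative_space this]
  have h: "((\<lambda>y. heat_ext j (pi * y / L) ?s) has_real_derivative
      heat_ext (j + 1) (pi * x / L) ?s * (pi / L)) (at x)" .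
  have e: "((\<lambda>y. - (2 * pi * D / L\<^sup>2) * exp (v / (2 * D) * y - v\<^sup>2 / (4 * D) * t)) has_real_derivative
      v / (2 * D) * (- (2 * pi * D / L\<^sup>2) * exp (v / (2 * D) * x - v\<^sup>2 / (4 * D) * t))) (at x)"
  proof -
    have "((\<lambda>y. c * exp (a * y - b)) has_real_derivative a * (c * exp (a * x - b))) (at x)" for a b c
      by (auto intro!: derivative_eq_intros)
    then show ?thesis .
  qed
  show ?thesis
    unfolding drift_heat_kernel_def
    by (rule DERIV_cong[OF DERIV_mult'[OF e h]]) (simp only: mult_ac add_ac)
qed

lemma drift_heat_kernel_has_derivative_time:
  assumes "D > 0" "L > 0" "x \<in> {0<..L}"
  shows "((\<lambda>s. drift_heat_kernel D v L 1 x s) has_real_derivative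
     - (v\<^sup>2 / (4 * D)) * drift_heat_kernel D v L 1 x t
       + D * pi\<^sup>2 / L\<^sup>2 * drift_heat_kernel D v L 3 x t) (at t)"
proof -
  have y: "0 < pi * x / L" "pi * x / L \<le> pi" using assms by (auto simp: field_simps)
  have "((\<lambda>s. D * pi\<^sup>2 / L\<^sup>2 * s) has_real_derivative D * pi\<^sup>2 / L\<^sup>2) (at t)"
    by (rule DERIV_cmult_Id)
  from DERIV_chain2[OF heat_ext_1_has_derivative_time[OF y] this]
  have h: "((\<lambda>s. heat_ext 1 (pi * x / L) (D * pi\<^sup>2 / L\<^sup>2 * s)) has_real_derivative
      heat_ext 3 (pi * x / L) (D * pi\<^sup>2 / L\<^sup>2 * t) * (D * pi\<^sup>2 / L\<^sup>2)) (at t)" .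
  have e: "((\<lambda>s. - (2 * pi * D / L\<^sup>2) * exp (v / (2 * D) * x - v\<^sup>2 / (4 * D) * s)) has_real_derivative
      - (v\<^sup>2 / (4 * D)) * (- (2 * pi * D / L\<^sup>2) * exp (v / (2 * D) * x - v\<^sup>2 / (4 * D) * t))) (at t)"
  proof -
    have "((\<lambda>s. c * exp (a - b * s)) has_real_derivative - b * (c * exp (a - b * t))) (at t)" for a b c
      by (auto intro!: derivative_eq_intros)
    then show ?thesis .
  qed
  show ?thesis
    unfolding drift_heat_kernel_def
    by (rule DERIV_cong[OF DERIV_mult'[OF e h]]) (simp only: mult_ac add_ac)
qed

text \<open>Rescaling time puts all dependence of the kernel on D and L into the point pi x / L and
  the upper limit. The factor 2/pi is 2 pi D / L^2 divided by the time scale; its negative meets the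
  limit mass - pi/2 with product 1.\<close>

lemma time_conv_drift_heat_kernel:
  assumes "D > 0" "L > 0" "t \<ge> 0"
  shows "time_conv (drift_heat_kernel D v L 1) \<phi> x t
    = - (2 / pi) * exp (v / (2 * D) * x) * integral {0..D * pi\<^sup>2 / L\<^sup>2 * t}
        (\<lambda>s. heat_ext 1 (pi * x / L) s * (exp (- (v\<^sup>2 / (4 * D) * (s / (D * pi\<^sup>2 / L\<^sup>2))))
          * \<phi> (t - s / (D * pi\<^sup>2 / L\<^sup>2))))"
proof -
  define d where "d = D * pi\<^sup>2 / L\<^sup>2"
  have d: "d > 0" using assms by (simp add: d_def)
  let ?f = "\<lambda>s. heat_ext 1 (pi * x / L) s * (exp (- (v\<^sup>2 / (4 * D) * (s / d))) * \<phi> (t - s / d))"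
  have im: "(\<lambda>x. x / d) ` {0..d * t} = {0..t}"
    using d image_divide_atLeastAtMost[of d 0 "d * t"] by simp
  have "time_conv (drift_heat_kernel D v L 1) \<phi> x t
      = integral {0..t} (\<lambda>\<tau>. - (2 * pi * D / L\<^sup>2) * exp (v / (2 * D) * x) * ?f (d * \<tau>))"
  proof -
    have "exp (v / (2 * D) * x - v\<^sup>2 / (4 * D) * \<tau>) = exp (v / (2 * D) * x) * exp (- (v\<^sup>2 / (4 * D) * \<tau>))" for \<tau>
      by (simp only: exp_add[symmetric] add_uminus_conv_diff)
    moreover have "d * \<tau> / d = \<tau>" for \<tau> using d by simp
    ultimately show ?thesis
      unfolding time_conv_reflect drift_heat_kernel_def d_def[symmetric] by (simp only: mult_ac)
  qed
  also have "\<dots> = - (2 * pi * D / L\<^sup>2) * exp (v / (2 * D) * x) * integral {0..t} (\<lambda>\<tau>. ?f (d * \<tau>))"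
    by (rule integral_mult_right)
  also have "integral {0..t} (\<lambda>\<tau>. ?f (d * \<tau>)) = 1 / d * integral {0..d * t} ?f"
    using integral_stretch_real[of d 0 "d * t" ?f] d unfolding im by simp
  also have "- (2 * pi * D / L\<^sup>2) * exp (v / (2 * D) * x) * (1 / d * integral {0..d * t} ?f)
      = - (2 / pi) * exp (v / (2 * D) * x) * integral {0..d * t} ?f"
  proof -
    have "2 * pi * D / L\<^sup>2 / d = 2 / pi" using assms by (simp add: d_def power2_eq_square)
    moreover have "- c * E * (1 / d * I) = - (c / d) * E * I" for c E I by simp
    ultimately show ?thesis by metis
  qed
  finally show ?thesis unfolding d_def .
qed

lemma kernel_term_eq_heat_term:
  "kernel_term D v L (Suc n) x \<tau> = - (2 * pi * D / L\<^sup>2) * exp (- (v\<^sup>2 / (4 * D) * \<tau>))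
     * heat_term 1 n (pi * x / L) (D * pi\<^sup>2 / L\<^sup>2 * \<tau>)"
proof -
  let ?N = "real (Suc n)"
  have "decay_rate D v L (Suc n) * \<tau> = - (v\<^sup>2 / (4 * D) * \<tau>) + - (?N\<^sup>2 * (D * pi\<^sup>2 / L\<^sup>2 * \<tau>))"
    by (simp add: decay_rate_def left_diff_distrib del: of_nat_Suc)
  then have 1: "exp (decay_rate D v L (Suc n) * \<tau>)
      = exp (- (v\<^sup>2 / (4 * D) * \<tau>)) * exp (- (?N\<^sup>2 * (D * pi\<^sup>2 / L\<^sup>2 * \<tau>)))"
    by (simp only: exp_add)
  have 2: "cos (?N * (pi * x / L) + of_int 1 * (pi / 2)) = - sin (?N * pi * x / L)"
    by (simp add: cos_add mult.assoc del: of_nat_Suc)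
  show ?thesis
    unfolding kernel_term_def heat_term_def 1 2 by (simp del: of_nat_Suc)
qed

lemma green_kernel_eq:
  assumes "D > 0" "L > 0" "\<tau> > 0"
  shows "summable (\<lambda>n. kernel_term D v L (Suc n) x \<tau>)"
    "green_kernel D v L x \<tau> = - drift_heat_kernel D v L 1 x \<tau>"
proof -
  have s: "D * pi\<^sup>2 / L\<^sup>2 * \<tau> > 0" using assms by simp
  note sm = summable_heat_term[OF s, of 1 "pi * x / L"]
  show "summable (\<lambda>n. kernel_term D v L (Suc n) x \<tau>)"
    unfolding kernel_term_eq_heat_term by (rule summable_mult[OF sm])
  show "green_kernel D v L x \<tau> = - drift_heat_kernel D v L 1 x \<tau>"
    unfolding green_kernel_def kernel_term_eq_heat_term suminf_mult[OF sm] drift_heat_kernel_def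
      heat_series_def[symmetric] drift_exponent_def
    using s by (simp add: heat_ext_def exp_diff exp_minus field_simps)
qed

text \<open>Freezing \<open>c\<^sub>p\<close> at its initial value for negative times gives a
  continuous function on the whole line; only arguments in [0, t] enter. The two kernels are
  compared at positive times, and the endpoint 0 is a null set.\<close>

lemma conc_eq_time_conv:
  assumes D: "D > 0" and L: "L > 0" and x: "x \<in> {0<..L}" and t: "t \<ge> 0"
    and c\<^sub>p: "continuous_on {0..} c\<^sub>p"
  shows "set_integrable lborel {0<..t} (\<lambda>\<tau>. green_kernel D v L x \<tau> * (c\<^sub>a - c\<^sub>p (t - \<tau>)))"
    and "conc D v L c\<^sub>a c\<^sub>p x t
      = c\<^sub>a + time_conv (drift_heat_kernel D v L 1) (\<lambda>s. c\<^sub>p (max 0 s) - c\<^sub>a) x t"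
proof -
  let ?\<phi> = "\<lambda>s. c\<^sub>p (max 0 s) - c\<^sub>a"
  let ?q = "\<lambda>\<tau>. drift_heat_kernel D v L 1 x \<tau> * ?\<phi> (t - \<tau>)"
  interpret causal_kernel L "drift_heat_kernel D v L 1"
    by (rule causal_kernel_drift_heat_kernel[OF D L]) simp
  have "continuous_on {0..t} (\<lambda>\<tau>. (\<lambda>(x, t). drift_heat_kernel D v L 1 x t) (x, \<tau>) * ?\<phi> (t - \<tau>))"
    using x by (intro continuous_intros continuous_on_compose2[OF cont] continuous_on_compose2[OF c\<^sub>p]) auto
  then have "continuous_on {0..t} ?q" by simp
  then have "set_integrable lborel {0<..t} ?q"
    by (intro set_integrable_subset[OF borel_integrable_atLeastAtMost']) auto
  moreover have eq: "green_kernel D v L x \<tau> * (c\<^sub>a - c\<^sub>p (t - \<tau>)) = ?q \<tau>" if "\<tau> \<in> {0<..t}" for \<tau>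
    using that by (simp add: green_kernel_eq[OF D L] algebra_simps)
  ultimately show int: "set_integrable lborel {0<..t} (\<lambda>\<tau>. green_kernel D v L x \<tau> * (c\<^sub>a - c\<^sub>p (t - \<tau>)))"
    using set_integrable_cong[of lborel lborel "{0<..t}" "{0<..t}"
        "\<lambda>\<tau>. green_kernel D v L x \<tau> * (c\<^sub>a - c\<^sub>p (t - \<tau>))" ?q] by simp
  have "(LBINT \<tau>:{0<..t}. green_kernel D v L x \<tau> * (c\<^sub>a - c\<^sub>p (t - \<tau>))) = integral {0<..t} ?q"
    unfolding set_borel_integral_eq_integral(2)[OF int] by (rule integral_cong) (rule eq)
  also have "\<dots> = integral {0..t} ?q"
  proof (rule integral_subset_negligible)
    have "{0..t} - {0<..t} \<subseteq> {0}" by auto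
    then show "negligible ({0..t} - {0<..t})" by (rule negligible_subset[OF negligible_sing])
  qed auto
  finally show "conc D v L c\<^sub>a c\<^sub>p x t = c\<^sub>a + time_conv (drift_heat_kernel D v L 1) ?\<phi> x t"
    by (simp add: conc_def time_conv_reflect)
qed

lemma conc_classical_solution:
  assumes D: "D > 0" and L: "L > 0" and c\<^sub>p: "continuous_on {0..} c\<^sub>p"
  shows "classical_solution D v L c\<^sub>a c\<^sub>p (conc D v L c\<^sub>a c\<^sub>p)"
proof -
  define \<phi> where "\<phi> s = c\<^sub>p (max 0 s) - c\<^sub>a" for s
  have \<phi>: "continuous_on UNIV \<phi>"
    unfolding \<phi>_def by (intro continuous_intros continuous_on_compose2[OF c\<^sub>p]) auto
  let ?k = "drift_heat_kernel D v L"
  define \<alpha> where "\<alpha> = v / (2 * D)"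
  define a where "a = pi / L"
  define q where "q = ?k 1"
  define qx where "qx x t = \<alpha> * ?k 1 x t + a * ?k 2 x t" for x t
  define qxx where "qxx x t = \<alpha> * qx x t + a * (\<alpha> * ?k 2 x t + a * ?k 3 x t)" for x t
  define qt where "qt x t = - (v\<^sup>2 / (4 * D)) * ?k 1 x t + D * pi\<^sup>2 / L\<^sup>2 * ?k 3 x t" for x t
  have k: "causal_kernel L (?k j)" if "j \<in> {1, 2, 3}" for j
    by (rule causal_kernel_drift_heat_kernel[OF D L that])
  have K: "causal_kernel L q" "causal_kernel L qx" "causal_kernel L qxx" "causal_kernel L qt"
    unfolding q_def qx_def qxx_def qt_def by (intro causal_kernel_linear k; simp)+
  have dx: "((\<lambda>y. q y t) has_real_derivative qx x t) (at x)"
       "((\<lambda>y. qx y t) has_real_derivative qxx x t) (at x)" for x t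
  proof -
    have k1: "((\<lambda>y. q y t) has_real_derivative qx x t) (at x)"
      using drift_heat_kernel_has_derivative_space[of D v L 1 t x] by (simp add: q_def qx_def \<alpha>_def a_def)
    have k2: "((\<lambda>y. ?k 2 y t) has_real_derivative \<alpha> * ?k 2 x t + a * ?k 3 x t) (at x)"
      using drift_heat_kernel_has_derivative_space[of D v L 2 t x] by (simp add: \<alpha>_def a_def)
    show "((\<lambda>y. q y t) has_real_derivative qx x t) (at x)" by (rule k1)
    show "((\<lambda>y. qx y t) has_real_derivative qxx x t) (at x)"
    proof -
      have "(\<lambda>y. qx y t) = (\<lambda>y. \<alpha> * q y t + a * ?k 2 y t)" by (simp add: qx_def q_def)
      then show ?thesis
        using DERIV_add[OF DERIV_cmult[OF k1, of \<alpha>] DERIV_cmult[OF k2, of a]]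
        by (simp only: qxx_def)
    qed
  qed
  have dt: "((\<lambda>s. q x s) has_real_derivative qt x t) (at t)" if "x \<in> {0<..L}" for x t
    unfolding q_def qt_def by (rule drift_heat_kernel_has_derivative_time[OF D L that])
  \<comment> \<open>The choice alpha = v / (2 D) cancels the term with index 2, since 2 D alpha = v.
    The index 1 terms combine to the decay rate - v^2 / (4 D), and index 3 is the pure heat
    equation.\<close>
  have heat: "qt x t = D * qxx x t - v * qx x t" for x t
  proof -
    have e: "D * (\<alpha> * \<alpha>) - v * \<alpha> = - (v\<^sup>2 / (4 * D))" "D * (2 * \<alpha>) = v" "D * (a * a) = D * pi\<^sup>2 / L\<^sup>2"
      using D by (auto simp: \<alpha>_def a_def power2_eq_square field_simps)
    have "D * qxx x t - v * qx x t
        = (D * (\<alpha> * \<alpha>) - v * \<alpha>) * ?k 1 x t + a * (D * (2 * \<alpha>) - v) * ?k 2 x t + D * (a * a) * ?k 3 x t"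
      by (simp add: qxx_def qx_def algebra_simps)
    then show ?thesis unfolding e by (simp only: qt_def diff_self mult_zero_right mult_zero_left add_0_right)
  qed
  have conc: "conc D v L c\<^sub>a c\<^sub>p x t = c\<^sub>a + time_conv q \<phi> x t" if "x \<in> {0<..L}" "t \<ge> 0" for x t
    using conc_eq_time_conv(2)[OF D L that c\<^sub>p] by (simp add: q_def \<phi>_def [abs_def])
  interpret q: causal_kernel L q by (rule K)
  interpret qx: causal_kernel L qx by (rule K)
  interpret qxx: causal_kernel L qxx by (rule K)
  interpret qt: causal_kernel L qt by (rule K)
  have sub: "{0<..<L} \<times> {0<..} \<subseteq> {0<..L} \<times> (UNIV :: real set)" by auto
  have derivs: "((\<lambda>s. conc D v L c\<^sub>a c\<^sub>p x s) has_real_derivative time_conv qt \<phi> x t) (at t)"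
      "((\<lambda>y. conc D v L c\<^sub>a c\<^sub>p y t) has_real_derivative time_conv qx \<phi> x t) (at x)"
      "((\<lambda>y. time_conv qx \<phi> y t) has_real_derivative time_conv qxx \<phi> x t) (at x)"
      "time_conv qt \<phi> x t + v * time_conv qx \<phi> x t - D * time_conv qxx \<phi> x t = 0"
    if x: "x \<in> {0<..<L}" and t: "t > 0" for x t
  proof -
    have xL: "x \<in> {0<..L}" using x by auto
    have "((\<lambda>t. c\<^sub>a + time_conv q \<phi> x t) has_real_derivative time_conv qt \<phi> x t) (at t)"
      using DERIV_add[OF DERIV_const time_conv_has_derivative_time[OF K(1,4) dt[OF xL] \<phi> xL]] by simp
    then show "((\<lambda>s. conc D v L c\<^sub>a c\<^sub>p x s) has_real_derivative time_conv qt \<phi> x t) (at t)"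
      by (rule has_field_derivative_transform_within_open[of _ _ _ "{0<..}"]) (use t conc[OF xL] in auto)
    have "((\<lambda>y. c\<^sub>a + time_conv q \<phi> y t) has_real_derivative time_conv qx \<phi> x t) (at x)"
      using DERIV_add[OF DERIV_const time_conv_has_derivative_space[OF K(1,2) dx(1) \<phi> x]] by simp
    then show "((\<lambda>y. conc D v L c\<^sub>a c\<^sub>p y t) has_real_derivative time_conv qx \<phi> x t) (at x)"
      by (rule has_field_derivative_transform_within_open[of _ _ _ "{0<..<L}"]) (use x t conc in auto)
    show "((\<lambda>y. time_conv qx \<phi> y t) has_real_derivative time_conv qxx \<phi> x t) (at x)"
      by (rule time_conv_has_derivative_space[OF K(2,3) dx(2) \<phi> x])
    have "((\<lambda>s. D * (qxx x (t - s) * \<phi> s) - v * (qx x (t - s) * \<phi> s)) has_integral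
        D * time_conv qxx \<phi> x t - v * time_conv qx \<phi> x t) {0..t}"
      unfolding time_conv_def
      by (intro has_integral_diff has_integral_mult_right integrable_integral integrable_continuous_interval
          qxx.continuous_on_integrand_section qx.continuous_on_integrand_section \<phi> xL)
    moreover have "(\<lambda>s. D * (qxx x (t - s) * \<phi> s) - v * (qx x (t - s) * \<phi> s)) = (\<lambda>s. qt x (t - s) * \<phi> s)"
      by (simp add: heat algebra_simps)
    ultimately show "time_conv qt \<phi> x t + v * time_conv qx \<phi> x t - D * time_conv qxx \<phi> x t = 0"
      by (simp add: time_conv_def[of qt] integral_unique)
  qed
  \<comment> \<open>In the rescaled variable s looks back from time t, so \<open>\<psi> 0\<close> is
    \<open>c\<^sub>p t - c\<^sub>a\<close>; the constant \<open>c\<^sub>a\<close> in front completes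
    it to \<open>c\<^sub>p t\<close>.\<close>
  have left: "((\<lambda>x. conc D v L c\<^sub>a c\<^sub>p x t) \<longlongrightarrow> c\<^sub>p t) (at_right 0)" if t: "t > 0" for t
  proof -
    define d where "d = D * pi\<^sup>2 / L\<^sup>2"
    have d: "d > 0" using D L by (simp add: d_def)
    define \<psi> where "\<psi> s = exp (- (v\<^sup>2 / (4 * D) * (s / d))) * \<phi> (t - s / d)" for s
    have \<psi>: "continuous_on {0..d * t} \<psi>"
      unfolding \<psi>_def using d by (intro continuous_intros continuous_on_compose2[OF \<phi>]) auto
    have "((\<lambda>x. pi * x / L) \<longlongrightarrow> pi * 0 / L) (at_right 0)" using L by (intro tendsto_intros) auto
    then have "filterlim (\<lambda>x. pi * x / L) (at_right 0) (at_right 0)"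
      unfolding filterlim_at using L by (auto simp: eventually_at_filter)
    from filterlim_compose[OF heat_ext_1_approximate_identity[OF _ \<psi>] this]
    have I: "((\<lambda>x. integral {0..d * t} (\<lambda>s. heat_ext 1 (pi * x / L) s * \<psi> s)) \<longlongrightarrow> - (pi / 2) * \<psi> 0) (at_right 0)"
      using d t by simp
    have lim: "((\<lambda>x. c\<^sub>a + - (2 / pi) * exp (v / (2 * D) * x) * integral {0..d * t} (\<lambda>s. heat_ext 1 (pi * x / L) s * \<psi> s))
        \<longlongrightarrow> c\<^sub>a + - (2 / pi) * exp (v / (2 * D) * 0) * (- (pi / 2) * \<psi> 0)) (at_right 0)"
      by (intro tendsto_intros I)
    have val: "c\<^sub>a + - (2 / pi) * exp (v / (2 * D) * 0) * (- (pi / 2) * \<psi> 0) = c\<^sub>p t"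
      using t by (simp add: \<psi>_def \<phi>_def field_simps)
    have tc: "time_conv q \<phi> x t = - (2 / pi) * exp (v / (2 * D) * x)
        * integral {0..d * t} (\<lambda>s. heat_ext 1 (pi * x / L) s * \<psi> s)" for x
      unfolding q_def \<psi>_def d_def by (rule time_conv_drift_heat_kernel[OF D L less_imp_le[OF t]])
    have ev: "\<forall>\<^sub>F x in at_right 0. c\<^sub>a + - (2 / pi) * exp (v / (2 * D) * x)
        * integral {0..d * t} (\<lambda>s. heat_ext 1 (pi * x / L) s * \<psi> s) = conc D v L c\<^sub>a c\<^sub>p x t"
      unfolding eventually_at_right_field
    proof (intro exI[of _ L] conjI allI impI L)
      fix x assume "0 < x" "x < L"
      then show "c\<^sub>a + - (2 / pi) * exp (v / (2 * D) * x)
        * integral {0..d * t} (\<lambda>s. heat_ext 1 (pi * x / L) s * \<psi> s) = conc D v L c\<^sub>a c\<^sub>p x t"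
        using conc[of x t] t unfolding tc by simp
    qed
    from Lim_transform_eventually[OF lim ev] show ?thesis unfolding val .
  qed
  have right: "conc D v L c\<^sub>a c\<^sub>p L t = c\<^sub>a" if "t > 0" for t
  proof -
    have "heat_term 1 n pi s = 0" for n s
      by (simp add: heat_term_def cos_add del: of_nat_Suc)
    then have "q L s = 0" for s
      using L by (simp add: q_def drift_heat_kernel_def heat_ext_def heat_series_def)
    then show ?thesis using conc[of L t] that L by (simp add: time_conv_def)
  qed
  have "continuous_on ({0<..L} \<times> {0..}) (\<lambda>p. c\<^sub>a + (\<lambda>(x, t). time_conv q \<phi> x t) p)"
    by (intro continuous_intros continuous_on_subset[OF q.continuous_on_time_conv[OF \<phi>]]) auto
  then have conc_cont: "continuous_on ({0<..L} \<times> {0..}) (\<lambda>(x, t). conc D v L c\<^sub>a c\<^sub>p x t)"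
    by (rule continuous_on_cong[THEN iffD1, rotated -1]) (auto simp: conc)
  have conc_0: "conc D v L c\<^sub>a c\<^sub>p x 0 = c\<^sub>a" for x
    by (simp add: conc_def set_lebesgue_integral_def)
  show ?thesis
    unfolding classical_solution_def
    by (intro conjI exI[of _ "time_conv qt \<phi>"] exI[of _ "time_conv qx \<phi>"] exI[of _ "time_conv qxx \<phi>"]
          ballI allI impI;
        (rule continuous_on_subset[OF qt.continuous_on_time_conv[OF \<phi>] sub]
          continuous_on_subset[OF qx.continuous_on_time_conv[OF \<phi>] sub]
          continuous_on_subset[OF qxx.continuous_on_time_conv[OF \<phi>] sub]
          conc_cont conc_0 derivs left right; assumption))
qed

text \<open>Near the corner continuity may fail, but the kernel has mass bounded uniformly in x and
  t. This places the formula in the class where solutions are unique.\<close>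

lemma conc_bounded_on_finite_times:
  assumes D: "D > 0" and L: "L > 0" and c\<^sub>p: "continuous_on {0..} c\<^sub>p"
  shows "bounded_on_finite_times L (conc D v L c\<^sub>a c\<^sub>p)"
  unfolding bounded_on_finite_times_def
proof (intro allI impI)
  fix T :: real assume T: "T > 0"
  define \<phi> where "\<phi> s = c\<^sub>p (max 0 s) - c\<^sub>a" for s
  have \<phi>: "continuous_on S \<phi>" for S
    unfolding \<phi>_def by (intro continuous_intros continuous_on_compose2[OF c\<^sub>p]) auto
  obtain M where M: "\<forall>z\<in>\<phi> ` {0..T}. norm z \<le> M"
    using compact_imp_bounded[OF compact_continuous_image[OF \<phi> compact_Icc]] unfolding bounded_iff by blast
  define d where "d = D * pi\<^sup>2 / L\<^sup>2"
  have d: "d > 0" using D L by (simp add: d_def)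
  then have dT: "d * T > 0" using T by simp
  obtain C where C: "C \<ge> 0" "\<And>y t \<psi> M. 0 < y \<Longrightarrow> y \<le> pi \<Longrightarrow> 0 \<le> t \<Longrightarrow> t \<le> d * T \<Longrightarrow> continuous_on {0..t} \<psi> \<Longrightarrow>
       (\<And>s. s \<in> {0..t} \<Longrightarrow> \<bar>\<psi> s\<bar> \<le> M) \<Longrightarrow> \<bar>integral {0..t} (\<lambda>s. heat_ext 1 y s * \<psi> s)\<bar> \<le> C * M"
  proof (rule heat_ext_1_integral_le[OF dT])
    fix C :: real
    assume "C \<ge> 0" "\<And>y t \<psi> M. 0 < y \<Longrightarrow> y \<le> pi \<Longrightarrow> 0 \<le> t \<Longrightarrow> t \<le> d * T \<Longrightarrow> continuous_on {0..t} \<psi> \<Longrightarrow>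
       (\<And>s. s \<in> {0..t} \<Longrightarrow> \<bar>\<psi> s\<bar> \<le> M) \<Longrightarrow> \<bar>integral {0..t} (\<lambda>s. heat_ext 1 y s * \<psi> s)\<bar> \<le> C * M"
    then show thesis by (rule that)
  qed
  have "\<bar>conc D v L c\<^sub>a c\<^sub>p x t\<bar> \<le> \<bar>c\<^sub>a\<bar> + 2 / pi * (exp (\<bar>v / (2 * D)\<bar> * L) * (C * M))"
    if x: "x \<in> {0<..L}" and t: "t \<in> {0..T}" for x t
  proof -
    define \<psi> where "\<psi> s = exp (- (v\<^sup>2 / (4 * D) * (s / d))) * \<phi> (t - s / d)" for s
    let ?I = "integral {0..d * t} (\<lambda>s. heat_ext 1 (pi * x / L) s * \<psi> s)"
    have I: "\<bar>?I\<bar> \<le> C * M"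
    proof (rule C(2))
      show "continuous_on {0..d * t} \<psi>"
        unfolding \<psi>_def using d by (intro continuous_intros continuous_on_compose2[OF \<phi>]) auto
      fix s assume s: "s \<in> {0..d * t}"
      have "0 \<le> s / d" "s / d \<le> t" using s d by (auto simp: divide_le_eq mult.commute)
      then have "t - s / d \<in> {0..T}" using t by auto
      then have "\<bar>\<phi> (t - s / d)\<bar> \<le> M" using M by auto
      moreover have "v\<^sup>2 / (4 * D) * (s / d) \<ge> 0" using s d D by auto
      ultimately have "exp (- (v\<^sup>2 / (4 * D) * (s / d))) * \<bar>\<phi> (t - s / d)\<bar> \<le> 1 * M"
        by (intro mult_mono) auto
      then show "\<bar>\<psi> s\<bar> \<le> M" by (simp add: \<psi>_def abs_mult)
    qed (use x t d L in \<open>auto simp: field_simps\<close>)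
    have "r * x \<le> \<bar>r\<bar> * L" for r using x by (intro mult_mono abs_ge_self) auto
    then have "v / (2 * D) * x \<le> \<bar>v / (2 * D)\<bar> * L" .
    then have "exp (v / (2 * D) * x) * \<bar>?I\<bar> \<le> exp (\<bar>v / (2 * D)\<bar> * L) * (C * M)"
      using I by (intro mult_mono) auto
    then have "2 / pi * (exp (v / (2 * D) * x) * \<bar>?I\<bar>) \<le> 2 / pi * (exp (\<bar>v / (2 * D)\<bar> * L) * (C * M))"
      by (intro mult_left_mono) auto
    moreover have "conc D v L c\<^sub>a c\<^sub>p x t = c\<^sub>a + - (2 / pi) * exp (v / (2 * D) * x) * ?I"
      using conc_eq_time_conv(2)[OF D L x _ c\<^sub>p, of t v c\<^sub>a] t
        time_conv_drift_heat_kernel[OF D L, of t v \<phi> x]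
      unfolding \<phi>_def[abs_def, symmetric] \<psi>_def d_def by (simp only: atLeastAtMost_iff)
    moreover have "\<bar>- (2 / pi) * exp (v / (2 * D) * x) * ?I\<bar> = 2 / pi * (exp (v / (2 * D) * x) * \<bar>?I\<bar>)"
      by (simp add: abs_mult)
    ultimately show ?thesis
      using abs_triangle_ineq[of c\<^sub>a "- (2 / pi) * exp (v / (2 * D) * x) * ?I"] by linarith
  qed
  then show "bounded ((\<lambda>(x, t). conc D v L c\<^sub>a c\<^sub>p x t) ` ({0<..L} \<times> {0..T}))"
    unfolding bounded_iff by (intro exI[of _ "\<bar>c\<^sub>a\<bar> + 2 / pi * (exp (\<bar>v / (2 * D)\<bar> * L) * (C * M))"]) auto
qed

theorem mainTheorem1:
  fixes D v L c\<^sub>a :: real and c\<^sub>p c\<^sub>p' :: "real \<Rightarrow> real"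
  assumes "D > 0" and "L > 0"
    and "\<And>t. t \<ge> 0 \<Longrightarrow> (c\<^sub>p has_real_derivative c\<^sub>p' t) (at t within {0..})"
    and "continuous_on {0..} c\<^sub>p'"
  shows "(\<forall>x\<in>{0<..L}. \<forall>\<tau>>0. summable (\<lambda>n. kernel_term D v L (Suc n) x \<tau>)) \<and>
    (\<forall>x\<in>{0<..L}. \<forall>t>0.
       set_integrable lborel {0<..t} (\<lambda>\<tau>. green_kernel D v L x \<tau> * (c\<^sub>a - c\<^sub>p (t - \<tau>)))) \<and>
    classical_solution D v L c\<^sub>a c\<^sub>p (conc D v L c\<^sub>a c\<^sub>p) \<and>
    bounded_on_finite_times L (conc D v L c\<^sub>a c\<^sub>p) \<and>
    (\<forall>u. classical_solution D v L c\<^sub>a c\<^sub>p u \<and> bounded_on_finite_times L u \<longrightarrow>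
       (\<forall>x\<in>{0<..L}. \<forall>t\<ge>0. u x t = conc D v L c\<^sub>a c\<^sub>p x t))"
proof -
  have c\<^sub>p: "continuous_on {0..} c\<^sub>p"
    unfolding continuous_on_eq_continuous_within using DERIV_continuous[OF assms(3)] by simp
  note sol = conc_classical_solution[OF assms(1,2) c\<^sub>p] conc_bounded_on_finite_times[OF assms(1,2) c\<^sub>p]
  show ?thesis
  proof (intro conjI ballI allI impI)
    fix x \<tau> :: real assume "\<tau> > 0"
    then show "summable (\<lambda>n. kernel_term D v L (Suc n) x \<tau>)" by (rule green_kernel_eq[OF assms(1,2)])
  next
    fix x t :: real assume "x \<in> {0<..L}" "t > 0"
    then show "set_integrable lborel {0<..t} (\<lambda>\<tau>. green_kernel D v L x \<tau> * (c\<^sub>a - c\<^sub>p (t - \<tau>)))"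
      by (intro conc_eq_time_conv(1)[OF assms(1,2) _ _ c\<^sub>p]) auto
  next
    fix u x and t :: real
    assume "classical_solution D v L c\<^sub>a c\<^sub>p u \<and> bounded_on_finite_times L u" "x \<in> {0<..L}" "t \<ge> 0"
    then show "u x t = conc D v L c\<^sub>a c\<^sub>p x t"
      by (intro classical_solution_unique[OF assms(1,2) _ _ sol]) auto
  qed (rule sol)+
qed

end
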